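(* Let $\bar x\in\Gamma$ be a stationary point of (P), let MSCQ hold at $\bar x$ with modulus $\sigma>0$, and suppose $\nabla g(\bar x)u=0$ for all $u\in K_\Gamma(\bar x,-\nabla f(\bar x))$. Assume there is $\kappa>0$ such that: (a) for every $u\in K_\Gamma(\bar x,-\nabla f(\bar x))\cap\mathcal S$ and every $\lambda\in\Lambda(\bar x,-\nabla f(\bar x);u)$: $\langle(\nabla^2 f(\bar x)+\nabla^2\langle\lambda,g\rangle(\bar x))u,u\rangle>\frac1\kappa$; (b) for every $(u,\lambda,v,w)\in\mathcal Z$: $$\langle(\nabla^2 f(\bar x)+\nabla^2\langle\lambda,g\rangle(\bar x))u,u\rangle+\frac{\rho(u,\lambda,v)}{\nabla g_0(\bar x)w+\frac12\nabla^2 g_0(\bar x)(v,v)}>\frac1\kappa\quad\text{whenever }\nabla g(\bar x)w+\tfrac12\nabla^2 g(\bar x)(v,v)\ne0,$$ and $\langle(\nabla^2 f(\bar x)+\nabla^2\langle\lambda,g\rangle(\bar x))u,u\rangle>\frac1\kappa$ whenever $\rho(u,\lambda,v)=0$. Then $\bar x$ is a tilt-stable local minimizer of (P) with modulus $\kappa$, and $\mathrm{tilt}(f+\delta_\Gamma,\bar x)\le 1/\min\{\chi_1,\chi_2,\chi_3\}$, where $\chi_1:=\inf\{\langle(\nabla^2 f(\bar x)+\nabla^2\langle\lambda,g\rangle(\bar x))u,u\rangle: u\in K_\Gamma(\bar x,-\nabla f(\bar x))\cap\mathcal S,\ \lambda\in\Lambda(\bar x,-\nabla f(\bar x);u)\}$,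 $\chi_2:=\inf\{\langle(\nabla^2 f(\bar x)+\nabla^2\langle\lambda,g\rangle(\bar x))u,u\rangle:\exists v,w\text{ with }(u,\lambda,v,w)\in\mathcal Z,\ \rho(u,\lambda,v)=0\}$, $\chi_3:=\inf\{\langle(\nabla^2 f(\bar x)+\nabla^2\langle\lambda,g\rangle(\bar x))u,u\rangle+\frac{\rho(u,\lambda,v)}{\nabla g_0(\bar x)w+\frac12\nabla^2 g_0(\bar x)(v,v)}:(u,\lambda,v,w)\in\mathcal Z,\ \nabla g(\bar x)w+\frac12\nabla^2 g(\bar x)(v,v)\ne0\}$.
   Context: Setting. Let $n,m\ge1$ and let $\mathcal Q:=\{(q_0,q_r)\in\mathbb R\times\mathbb R^m:\|q_r\|\le q_0\}$ be the second-order cone. For $q=(q_0,q_r)\in\mathbb R^{1+m}$ write $\hat q:=(-q_0,q_r)$, and let $\mathcal Q^*:=\{\hat q: q\in\mathcal Q\}=\{(q_0,q_r):\|q_r\|\le-q_0\}$. The normal cone to $\mathcal Q$ at $q\in\mathcal Q$ is $N_{\mathcal Q}(q)=\mathcal Q^*$ if $q=0$, $N_{\mathcal Q}(q)=\{0\}$ if $q\in\operatorname{int}\mathcal Q$, and $N_{\mathcal Q}(q)=\{\alpha\hat q:\alpha\ge0\}$ if $q\in\operatorname{bd}\mathcal Q\setminus\{0\}$. Problem (P) is: minimize $f(x)$ subject to $x\in\Gamma:=\{x\in\mathbb R^n: g(x)\in\mathcal Q\}$, where $f:\mathbb R^n\to\mathbb R$ and $g=(g_0,g_r):\mathbb R^n\to\mathbb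 R\times\mathbb R^m$ are $C^2$-smooth around a point $\bar x\in\Gamma$ with $g(\bar x)=0$. $\nabla g(x)$ is the Jacobian, $\nabla g(x)^*$ its transpose, $\nabla^2 g(x)(u,v)\in\mathbb R^{1+m}$ is the vector with components $u^T\nabla^2 g_i(x)v$, and $\nabla^2\langle\lambda,g\rangle(x)=\sum_i\lambda_i\nabla^2 g_i(x)$. $\mathcal S$ is the unit sphere. Infima over empty sets are $+\infty$. MSCQ. The metric subregularity constraint qualification (MSCQ) holds at $\bar x$ with modulus $\sigma>0$ if there is a neighborhood $U$ of $\bar x$ with $\operatorname{dist}(x;\Gamma)\le\sigma\operatorname{dist}(g(x);\mathcal Q)$ for all $x\in U$. Multipliers and cones. $T_\Gamma(x)$ is the Bouligand tangent cone $\{v:\exists t_k\downarrow0,\ v_k\to v,\ x+t_kv_k\in\Gamma\}$. For $x\in\Gamma$, $x^*\in\mathbb R^n$: $\Lambda(x,x^* ):=\{\lambda\in N_{\mathcal Q}(g(x)):\nabla g(x)^*\lambda=x^*\}$; $\Lambda^0(x,x^* ):=\{0\}$ if $x^*=0$ and $\Lambda^0(x,x^* ):=\Lambda(x,x^* )$ otherwise; the critical cone is $K_\Gamma(x,x^* ):=\{u\in T_\Gamma(x):\langle x^*,u\rangle=0\}$. The curvature mapping is $\mathcal H(x,\lambda):=\frac{-\lambda_0}{g_0(x)}\big(\nabla g_r(x)^*\nabla g_r(x)-\nabla g_0(x)^*\nabla g_0(x)\big)$ if $g(x)\in\operatorname{bd}\mathcal Q\setminus\{0\}$ and $\mathcal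 H(x,\lambda):=0$ otherwise. The directional multiplier set is $\Lambda(x,x^*;u):=\operatorname{argmax}_{\lambda\in\Lambda(x,x^* )}\langle(\nabla^2\langle\lambda,g\rangle(x)+\mathcal H(x,\lambda))u,u\rangle$. The set $\mathcal Z$ and the function $\rho$. $\mathcal Z:=\{(u,\lambda,v,w)\in\mathcal S\times\Lambda^0(\bar x,-\nabla f(\bar x))\times\mathcal S\times\mathbb R^n:\ \langle\lambda,\nabla g(\bar x)u\rangle=0,\ \lambda_0(\|\nabla g_r(\bar x)u\|^2-(\nabla g_0(\bar x)u)^2)=0,\ \nabla g(\bar x)v=0,\ \lambda\in N_{\mathcal Q}(\nabla g(\bar x)w+\tfrac12\nabla^2 g(\bar x)(v,v))\}$ (the last condition includes $\nabla g(\bar x)w+\tfrac12\nabla^2 g(\bar x)(v,v)\in\mathcal Q$). For $(u,\lambda,v)\in\mathbb R^n\times\mathcal Q^*\times\mathbb R^n$, $$\rho(u,\lambda,v):=\inf_{z\in\mathbb R^n}\Big\{-\lambda_0\Big(\|\nabla g_r(\bar x)z+\nabla^2 g_r(\bar x)(v,u)\|^2-\big(\nabla g_0(\bar x)z+\nabla^2 g_0(\bar x)(v,u)\big)^2\Big)\;\Big|\;\langle\lambda,\nabla g(\bar x)z+\nabla^2 g(\bar x)(v,u)\rangle=0\Big\},$$ with $\rho(u,\lambda,v):=+\infty$ if the constraint set is empty. Stationarity and tilt stability. $\bar x$ is a stationary point of (P) if $-\nabla f(\bar x)\in N_\Gamma(\bar x)$, where $N_\Gamma$ is the limiting (Mordukhovich)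 normal cone. Let $\varphi:=f+\delta_\Gamma$ ($\delta_\Gamma$ the indicator function of $\Gamma$). $\bar x$ is a tilt-stable local minimizer of (P) with modulus $\kappa>0$ if there is $\gamma>0$ such that $M_\gamma(v^* ):=\operatorname{argmin}\{\varphi(x)-\langle v^*,x\rangle:\|x-\bar x\|\le\gamma\}$ is single-valued and Lipschitz continuous with constant $\kappa$ on a neighborhood of $0$, with $M_\gamma(0)=\{\bar x\}$. The exact bound of tilt stability is $\mathrm{tilt}(\varphi,\bar x):=\inf_{\gamma>0}\operatorname{lip}M_\gamma(0)$, where $\operatorname{lip}M_\gamma(0)$ is the infimum of the Lipschitz constants of $M_\gamma$ on neighborhoods of $0$. *)

theory Defs
  imports "HOL-Analysis.Analysis"
begin

definition SOC :: "(real \<times> 'b::euclidean_space) set" where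
  "SOC = {q. norm (snd q) \<le> fst q}"

definition hatq :: "real \<times> 'b::euclidean_space \<Rightarrow> real \<times> 'b" where
  "hatq q = (- fst q, snd q)"

definition SOCdual :: "(real \<times> 'b::euclidean_space) set" where
  "SOCdual = hatq ` SOC"

definition normQ :: "real \<times> 'b::euclidean_space \<Rightarrow> (real \<times> 'b) set" where
  "normQ q = (if q \<notin> SOC then {}
              else if q = 0 then SOCdual
              else if q \<in> interior SOC then {0}
              else {\<alpha> *\<^sub>R hatq q | \<alpha>. \<alpha> \<ge> 0})"

definition C2_near :: "('a::euclidean_space \<Rightarrow> 'c::real_normed_vector) \<Rightarrow> ('a \<Rightarrow> 'a \<Rightarrow> 'c)
    \<Rightarrow> ('a \<Rightarrow> 'a \<Rightarrow> 'a \<Rightarrow> 'c) \<Rightarrow> 'a \<Rightarrow> bool" where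
  "C2_near h Dh D2h x0 \<longleftrightarrow>
     (\<exists>r>0. (\<forall>x\<in>ball x0 r. (h has_derivative Dh x) (at x) \<and>
                (\<forall>d. ((\<lambda>y. Dh y d) has_derivative (\<lambda>k. D2h x k d)) (at x))) \<and>
            (\<forall>d k. continuous_on (ball x0 r) (\<lambda>x. D2h x k d)))"

definition feas :: "('a \<Rightarrow> real \<times> 'b::euclidean_space) \<Rightarrow> 'a set" where
  "feas g = {x. g x \<in> SOC}"

definition grad :: "('a::euclidean_space \<Rightarrow> 'a \<Rightarrow> real) \<Rightarrow> 'a \<Rightarrow> 'a" where
  "grad Df x = (\<Sum>b\<in>Basis. Df x b *\<^sub>R b)"

definition adjJ :: "('a::euclidean_space \<Rightarrow> 'a \<Rightarrow> 'c::real_inner) \<Rightarrow> 'a \<Rightarrow> 'c \<Rightarrow> 'a" where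
  "adjJ Dg x l = (\<Sum>b\<in>Basis. (l \<bullet> Dg x b) *\<^sub>R b)"

definition tangent_cone :: "'a::real_normed_vector set \<Rightarrow> 'a \<Rightarrow> 'a set" where
  "tangent_cone S x = {v. \<exists>t vs. (\<forall>k. t k > 0) \<and> t \<longlonglongrightarrow> 0 \<and> vs \<longlonglongrightarrow> v \<and>
                          (\<forall>k. x + t k *\<^sub>R vs k \<in> S)}"

definition reg_normal :: "'a::real_inner set \<Rightarrow> 'a \<Rightarrow> 'a set" where
  "reg_normal S x = (if x \<notin> S then {} else
     {xs. \<forall>\<epsilon>>0. \<exists>\<delta>>0. \<forall>y\<in>S. norm (y - x) < \<delta> \<longrightarrow> xs \<bullet> (y - x) \<le> \<epsilon> * norm (y - x)})"

definition lim_normal :: "'a::real_inner set \<Rightarrow> 'a \<Rightarrow> 'a set" where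
  "lim_normal S x = (if x \<notin> S then {} else
     {xs. \<exists>xk xsk. (\<forall>k. xk k \<in> S \<and> xsk k \<in> reg_normal S (xk k)) \<and>
                   xk \<longlonglongrightarrow> x \<and> xsk \<longlonglongrightarrow> xs})"

text \<open>Quadratic form of the curvature mapping H(x,lambda): u |-> <H(x,lambda)u,u>.\<close>
definition curvQ :: "('a \<Rightarrow> real \<times> 'b::euclidean_space) \<Rightarrow> ('a \<Rightarrow> 'a \<Rightarrow> real \<times> 'b)
    \<Rightarrow> 'a \<Rightarrow> real \<times> 'b \<Rightarrow> 'a \<Rightarrow> real" where
  "curvQ g Dg x l u = (if g x \<in> frontier SOC - {0}
      then (- fst l / fst (g x)) * ((norm (snd (Dg x u)))\<^sup>2 - (fst (Dg x u))\<^sup>2) else 0)"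

definition Lam :: "('a::euclidean_space \<Rightarrow> real \<times> 'b::euclidean_space) \<Rightarrow> ('a \<Rightarrow> 'a \<Rightarrow> real \<times> 'b)
    \<Rightarrow> 'a \<Rightarrow> 'a \<Rightarrow> (real \<times> 'b) set" where
  "Lam g Dg x xs = {l \<in> normQ (g x). adjJ Dg x l = xs}"

definition Lam0 :: "('a::euclidean_space \<Rightarrow> real \<times> 'b::euclidean_space) \<Rightarrow> ('a \<Rightarrow> 'a \<Rightarrow> real \<times> 'b)
    \<Rightarrow> 'a \<Rightarrow> 'a \<Rightarrow> (real \<times> 'b) set" where
  "Lam0 g Dg x xs = (if xs = 0 then {0} else Lam g Dg x xs)"

definition crit_cone :: "'a::real_inner set \<Rightarrow> 'a \<Rightarrow> 'a \<Rightarrow> 'a set" where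
  "crit_cone S x xs = {u \<in> tangent_cone S x. xs \<bullet> u = 0}"

definition LamDir :: "('a::euclidean_space \<Rightarrow> real \<times> 'b::euclidean_space) \<Rightarrow> ('a \<Rightarrow> 'a \<Rightarrow> real \<times> 'b)
    \<Rightarrow> ('a \<Rightarrow> 'a \<Rightarrow> 'a \<Rightarrow> real \<times> 'b) \<Rightarrow> 'a \<Rightarrow> 'a \<Rightarrow> 'a \<Rightarrow> (real \<times> 'b) set" where
  "LamDir g Dg D2g x xs u = {l \<in> Lam g Dg x xs. \<forall>\<mu>\<in>Lam g Dg x xs.
      \<mu> \<bullet> D2g x u u + curvQ g Dg x \<mu> u \<le> l \<bullet> D2g x u u + curvQ g Dg x l u}"

definition Zset :: "('a::euclidean_space \<Rightarrow> real \<times> 'b::euclidean_space) \<Rightarrow> ('a \<Rightarrow> 'a \<Rightarrow> real \<times> 'b)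
    \<Rightarrow> ('a \<Rightarrow> 'a \<Rightarrow> 'a \<Rightarrow> real \<times> 'b) \<Rightarrow> ('a \<Rightarrow> 'a \<Rightarrow> real) \<Rightarrow> 'a
    \<Rightarrow> ('a \<times> (real \<times> 'b) \<times> 'a \<times> 'a) set" where
  "Zset g Dg D2g Df xb = {(u, l, v, w). norm u = 1 \<and> l \<in> Lam0 g Dg xb (- grad Df xb) \<and>
      norm v = 1 \<and> l \<bullet> Dg xb u = 0 \<and>
      fst l * ((norm (snd (Dg xb u)))\<^sup>2 - (fst (Dg xb u))\<^sup>2) = 0 \<and>
      Dg xb v = 0 \<and> l \<in> normQ (Dg xb w + (1/2) *\<^sub>R D2g xb v v)}"

definition rho :: "('a::euclidean_space \<Rightarrow> 'a \<Rightarrow> real \<times> 'b::euclidean_space)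
    \<Rightarrow> ('a \<Rightarrow> 'a \<Rightarrow> 'a \<Rightarrow> real \<times> 'b) \<Rightarrow> 'a \<Rightarrow> 'a \<Rightarrow> real \<times> 'b \<Rightarrow> 'a \<Rightarrow> ereal" where
  "rho Dg D2g xb u l v = Inf ((\<lambda>z. ereal (- fst l *
        ((norm (snd (Dg xb z + D2g xb v u)))\<^sup>2 - (fst (Dg xb z + D2g xb v u))\<^sup>2)))
      ` {z. l \<bullet> (Dg xb z + D2g xb v u) = 0})"

definition MSCQ :: "('a::euclidean_space \<Rightarrow> real \<times> 'b::euclidean_space) \<Rightarrow> 'a \<Rightarrow> real \<Rightarrow> bool" where
  "MSCQ g xb \<sigma> \<longleftrightarrow> (\<exists>U. open U \<and> xb \<in> U \<and>
      (\<forall>x\<in>U. infdist x (feas g) \<le> \<sigma> * infdist (g x) SOC))"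

definition phi :: "('a \<Rightarrow> real) \<Rightarrow> 'a set \<Rightarrow> 'a \<Rightarrow> ereal" where
  "phi f S x = (if x \<in> S then ereal (f x) else \<infinity>)"

definition Mtilt :: "('a::real_inner \<Rightarrow> ereal) \<Rightarrow> 'a \<Rightarrow> real \<Rightarrow> 'a \<Rightarrow> 'a set" where
  "Mtilt \<phi> xb \<gamma> vs = {x. norm (x - xb) \<le> \<gamma> \<and>
      (\<forall>y. norm (y - xb) \<le> \<gamma> \<longrightarrow> \<phi> x - ereal (vs \<bullet> x) \<le> \<phi> y - ereal (vs \<bullet> y))}"

definition lip_on :: "('a::metric_space \<Rightarrow> 'c::metric_space set) \<Rightarrow> 'a set \<Rightarrow> real \<Rightarrow> bool" where
  "lip_on M U L \<longleftrightarrow> (\<forall>v\<in>U. \<exists>x. M v = {x}) \<and>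
      (\<forall>v\<in>U. \<forall>w\<in>U. \<forall>x\<in>M v. \<forall>y\<in>M w. dist x y \<le> L * dist v w)"

definition tilt_stable :: "('a::real_inner \<Rightarrow> ereal) \<Rightarrow> 'a \<Rightarrow> real \<Rightarrow> bool" where
  "tilt_stable \<phi> xb \<kappa> \<longleftrightarrow> (\<exists>\<gamma>>0. Mtilt \<phi> xb \<gamma> 0 = {xb} \<and>
      (\<exists>U. open U \<and> 0 \<in> U \<and> lip_on (Mtilt \<phi> xb \<gamma>) U \<kappa>))"

definition lipM0 :: "('a::real_inner \<Rightarrow> ereal) \<Rightarrow> 'a \<Rightarrow> real \<Rightarrow> ereal" where
  "lipM0 \<phi> xb \<gamma> = Inf {ereal L | L. L \<ge> 0 \<and>
      (\<exists>U. open U \<and> 0 \<in> U \<and> lip_on (Mtilt \<phi> xb \<gamma>) U L)}"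

definition tilt_bound :: "('a::real_inner \<Rightarrow> ereal) \<Rightarrow> 'a \<Rightarrow> ereal" where
  "tilt_bound \<phi> xb = (INF \<gamma>\<in>{0<..}. lipM0 \<phi> xb \<gamma>)"

end

theory Submission
  imports Defs
begin

text \<open>
  A subgradient of \<open>f + \<delta>\<^sub>\<Gamma>\<close> at a feasible \<open>x\<close> near \<open>xb\<close> is \<open>\<nabla>f(x) + \<nabla>g(x)\<^sup>*l\<close> with \<open>l\<close> normal to the cone at
  \<open>g(x)\<close> and, by metric subregularity, \<open>|l|\<close> bounded. Taylor expansion at two points shows that the
  subgradient mapping is hypomonotone, so \<open>z \<mapsto> argmin (f + s/2 |x - xb|\<^sup>2 - z \<bullet> x)\<close> is Lipschitz near
  \<open>0\<close> for large \<open>s\<close>. If every subgradient pair near \<open>(xb, 0)\<close> is strongly monotone with modulus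
  \<open>1/\<kappa>\<close> against all pairs sufficiently close to it, then this pointwise property integrates along
  segments in \<open>z\<close> to uniform strong monotonicity, which yields quadratic growth and tilt stability.

  Were pointwise strong monotonicity to fail at pairs \<open>(x\<^sub>k, v\<^sub>k) \<rightarrow> (xb, 0)\<close>, one would obtain limit
  multipliers and directions at each \<open>x\<^sub>k\<close> with small second-order form. The hypothesis on the critical
  cone says that the range of \<open>\<nabla>g(xb)\<close> meets the face of the cone orthogonal to a multiplier only in
  \<open>0\<close>; by normalization, \<open>g(x\<^sub>k)\<close> is then of order \<open>|x\<^sub>k - xb|\<^sup>2\<close> and the critical directions satisfy
  \<open>\<nabla>g(x\<^sub>k)u\<^sub>k = O(|x\<^sub>k - xb|)\<close>, so the limits land in the set of condition (b), or of condition (a)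
  when \<open>x\<^sub>k = xb\<close>.
\<close>

section \<open>Second-order cone\<close>

text \<open>If both points of a violating pair moved to \<open>xb\<close> at once, their rates of
  convergence would be unrelated. Demanding strong monotonicity only on a neighbourhood that depends
  on the pair separates the limits: first y tends to x with x fixed, then x tends to
  \<open>xb\<close>. Such non-uniform neighbourhoods suffice because monotonicity is rewritten in a
  cocoercive form along a segment of parameters; that form adds up over adjacent pieces, so
  compactness of the segment makes it global. In the inner limit the gap (m - l) . (g y - g x)
  between multipliers is not negligible. On the boundary of the cone it is an exact multiple of
  \<open>lorentz (g y - g x)\<close>, and after division by |y - x|^2 it tends to the curvature form
  at x. That form has g_0(x) as a denominator, so it is kept as an inequality multiplied by g_0(x).
  In the outer limit this inequality is divided by |x - xb|^2: g_0(x) becomes the denominator in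
  condition (b), and the other side becomes a value of the objective of \<open>rho\<close>.\<close>

lemma SOCdual_iff: "l \<in> SOCdual \<longleftrightarrow> norm (snd l) \<le> - fst l"
proof
  assume "norm (snd l) \<le> - fst l"
  then have "hatq l \<in> SOC" and "l = hatq (hatq l)"
    by (auto simp: SOC_def hatq_def)
  then show "l \<in> SOCdual" unfolding SOCdual_def by blast
qed (auto simp: SOCdual_def SOC_def hatq_def)

lemma closed_SOC: "closed (SOC :: (real \<times> 'b::euclidean_space) set)"
  unfolding SOC_def by (intro closed_Collect_le continuous_intros)

lemma closed_SOCdual: "closed (SOCdual :: (real \<times> 'b::euclidean_space) set)"
proof -
  have "(SOCdual :: (real \<times> 'b) set) = {l. norm (snd l) \<le> - fst l}"
    using SOCdual_iff by auto
  moreover have "closed {l :: real \<times> 'b. norm (snd l) \<le> - fst l}"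
    by (intro closed_Collect_le continuous_intros)
  ultimately show ?thesis by simp
qed

lemma SOC_add: "p \<in> SOC \<Longrightarrow> q \<in> SOC \<Longrightarrow> p + q \<in> SOC"
  unfolding SOC_def using norm_triangle_ineq[of "snd p" "snd q"] by auto

lemma SOC_scaleR: "q \<in> SOC \<Longrightarrow> 0 \<le> c \<Longrightarrow> c *\<^sub>R q \<in> SOC"
  unfolding SOC_def by (auto intro: mult_left_mono)

lemma zero_in_SOC: "0 \<in> SOC"
  by (simp add: SOC_def)

lemma zero_in_SOCdual: "0 \<in> SOCdual"
  by (simp add: SOCdual_iff)

lemma convex_SOC: "convex (SOC :: (real \<times> 'b::euclidean_space) set)"
  by (intro convexI SOC_add SOC_scaleR)

lemma convex_SOCdual: "convex (SOCdual :: (real \<times> 'b::euclidean_space) set)"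
proof (rule convexI)
  fix p q :: "real \<times> 'b" and a b :: real
  assume *: "p \<in> SOCdual" "q \<in> SOCdual" "0 \<le> a" "0 \<le> b"
  have "norm (a *\<^sub>R snd p + b *\<^sub>R snd q) \<le> a * norm (snd p) + b * norm (snd q)"
    using * by (intro norm_triangle_le) simp
  also have "\<dots> \<le> a * (- fst p) + b * (- fst q)"
    using * by (intro add_mono mult_left_mono) (auto simp: SOCdual_iff)
  finally show "a *\<^sub>R p + b *\<^sub>R q \<in> SOCdual" by (simp add: SOCdual_iff)
qed

lemma SOC_SOCdual_inner:
  assumes "l \<in> SOCdual" "q \<in> SOC" shows "l \<bullet> q \<le> 0"
proof -
  have "l \<bullet> q = fst l * fst q + snd l \<bullet> snd q" by (simp add: inner_prod_def)
  also have "snd l \<bullet> snd q \<le> norm (snd l) * norm (snd q)" by (rule norm_cauchy_schwarz)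
  also have "\<dots> \<le> (- fst l) * fst q"
    using assms unfolding SOCdual_iff SOC_def using norm_ge_zero[of "snd l"] norm_ge_zero[of "snd q"]
    by (intro mult_mono) (auto simp del: norm_ge_zero)
  finally show ?thesis by simp
qed

text \<open>The polar inequality is tested on the axis of the cone, or, if \<open>snd l\<close> is
  nonzero, on the boundary ray leaning towards \<open>snd l\<close>, where it is sharpest.\<close>

lemma SOCdual_polar:
  assumes "\<And>q. q \<in> SOC \<Longrightarrow> l \<bullet> q \<le> 0" shows "l \<in> SOCdual"
proof (cases "snd l = 0")
  case True
  have "l \<bullet> (1, 0) \<le> 0" by (rule assms) (simp add: SOC_def)
  then show ?thesis using True by (simp add: SOCdual_iff inner_prod_def)
next
  case False
  have "l \<bullet> (norm (snd l), snd l) \<le> 0" by (rule assms) (simp add: SOC_def)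
  then have "norm (snd l) * (fst l + norm (snd l)) \<le> 0"
    by (simp add: inner_prod_def dot_square_norm power2_eq_square algebra_simps)
  then show ?thesis using False by (simp add: SOCdual_iff mult_le_0_iff)
qed

text \<open>The residual of the projection onto a convex cone is orthogonal to the projection and
  lies in the polar cone; normalised, it is \<open>l\<close>. In this linear form, with
  \<open>l\<close> bounded, the distance can be followed through a limit of difference
  quotients.\<close>

lemma infdist_SOC_dual:
  fixes p :: "real \<times> 'b::euclidean_space"
  obtains l where "l \<in> SOCdual" "norm l \<le> 1" "infdist p SOC = l \<bullet> p"
proof -
  define c where "c = closest_point SOC p"
  have ne: "(SOC :: (real \<times> 'b) set) \<noteq> {}" using zero_in_SOC by auto
  have c: "c \<in> SOC" unfolding c_def by (rule closest_point_in_set[OF closed_SOC ne])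
  have dot: "(p - c) \<bullet> (q - c) \<le> 0" if "q \<in> SOC" for q
    unfolding c_def by (rule closest_point_dot[OF convex_SOC closed_SOC that])
  \<comment> \<open>The cone contains both \<open>2 *\<^sub>R c\<close> and 0, and the variational
    inequality at these points gives the two opposite signs.\<close>
  have "(p - c) \<bullet> c \<le> 0"
    using dot[OF SOC_scaleR[OF c, of 2]] by (simp add: algebra_simps scaleR_2)
  moreover have "(p - c) \<bullet> c \<ge> 0"
    using dot[OF zero_in_SOC] by simp
  ultimately have pc: "(p - c) \<bullet> c = 0" by simp
  have pol: "(p - c) \<bullet> q \<le> 0" if "q \<in> SOC" for q
    using dot[OF that] pc by (simp add: inner_diff_right)
  have dist: "infdist p SOC = norm (p - c)"
  proof (rule antisym)
    show "infdist p SOC \<le> norm (p - c)"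
      using infdist_le[OF c, of p] by (simp add: dist_norm)
    obtain b where "b \<in> SOC" "infdist p SOC = dist p b"
      using infdist_attains_inf[OF closed_SOC ne] by metis
    then show "norm (p - c) \<le> infdist p SOC"
      unfolding c_def using closest_point_le[OF closed_SOC] by (metis dist_norm)
  qed
  define l where "l = (1 / norm (p - c)) *\<^sub>R (p - c)"
  have "l \<bullet> q \<le> 0" if "q \<in> SOC" for q
    using pol[OF that] by (simp add: l_def divide_nonpos_nonneg)
  then have "l \<in> SOCdual" by (rule SOCdual_polar)
  moreover have "norm l \<le> 1" by (simp add: l_def)
  moreover have "infdist p SOC = l \<bullet> p"
  proof (cases "p = c")
    case False
    have "(p - c) \<bullet> p = (p - c) \<bullet> (p - c)" using pc by (simp add: inner_diff_right)
    then show ?thesis using False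
      by (simp add: dist l_def dot_square_norm power2_eq_square)
  next
    case True
    then show ?thesis using dist by (simp add: l_def)
  qed
  ultimately show ?thesis by (rule that)
qed

text \<open>Equality case of Cauchy-Schwarz: with \<open>a\<close> chosen to match the first
  components, the squared distance from \<open>snd l\<close> to \<open>a *\<^sub>R snd q\<close> is
  at most \<open>(fst l + a * fst q)\<^sup>2\<close>, which is 0.\<close>

lemma SOC_complementary:
  fixes l q :: "real \<times> 'b::euclidean_space"
  assumes "l \<in> SOCdual" "q \<in> SOC" "l \<bullet> q = 0" "q \<noteq> 0"
  shows "l = (- fst l / fst q) *\<^sub>R hatq q"
proof -
  have q0: "fst q > 0" using assms(2,4) unfolding SOC_def
    by (metis mem_Collect_eq norm_ge_zero norm_le_zero_iff order.antisym order_le_imp_less_or_eq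
        order_trans prod.expand fst_zero snd_zero)
  define a where "a = - fst l / fst q"
  have in0: "snd l \<bullet> snd q = - fst l * fst q" using assms(3) by (simp add: inner_prod_def)
  have al: "a * fst q = - fst l" using q0 by (simp add: a_def)
  have "(norm (snd l - a *\<^sub>R snd q))\<^sup>2 = (norm (snd l))\<^sup>2 - 2 * a * (snd l \<bullet> snd q) + a\<^sup>2 * (norm (snd q))\<^sup>2"
    unfolding power2_norm_eq_inner by (simp add: algebra_simps inner_commute power2_eq_square)
  also have "\<dots> \<le> (fst l)\<^sup>2 - 2 * a * (- fst l * fst q) + a\<^sup>2 * (fst q)\<^sup>2"
  proof -
    have "(norm (snd l))\<^sup>2 \<le> (- fst l)\<^sup>2"
      using assms(1) by (intro power_mono) (auto simp: SOCdual_iff)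
    moreover have "(norm (snd q))\<^sup>2 \<le> (fst q)\<^sup>2"
      using assms(2) by (intro power_mono) (auto simp: SOC_def)
    ultimately show ?thesis unfolding in0
      using mult_left_mono[of "(norm (snd q))\<^sup>2" "(fst q)\<^sup>2" "a\<^sup>2"] by simp
  qed
  also have "\<dots> = (fst l + a * fst q)\<^sup>2" by (simp add: power2_eq_square algebra_simps)
  also have "\<dots> = 0" by (simp add: al)
  finally have "snd l = a *\<^sub>R snd q" by simp
  then show ?thesis using al by (simp add: hatq_def prod_eq_iff a_def)
qed

lemma SOC_complementary_frontier:
  fixes l q :: "real \<times> 'b::euclidean_space"
  assumes "l \<in> SOCdual" "q \<in> SOC" "l \<bullet> q = 0" "q \<noteq> 0" "l \<noteq> 0"
  shows "norm (snd q) = fst q" "fst q > 0"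
proof -
  show q0: "fst q > 0" using assms(2,4) unfolding SOC_def
    by (metis mem_Collect_eq norm_ge_zero norm_le_zero_iff order.antisym order_le_imp_less_or_eq
        order_trans prod.expand fst_zero snd_zero)
  have "l = (- fst l / fst q) *\<^sub>R hatq q" using assms(1-4) by (rule SOC_complementary)
  with assms(5) have "fst l \<noteq> 0" by (metis div_0 minus_zero scaleR_zero_left)
  moreover have "l \<bullet> q = (- fst l / fst q) * ((norm (snd q))\<^sup>2 - (fst q)\<^sup>2)"
    by (subst SOC_complementary[OF assms(1-4)])
       (simp add: hatq_def inner_prod_def dot_square_norm power2_eq_square algebra_simps)
  ultimately have "(norm (snd q))\<^sup>2 = (fst q)\<^sup>2" using assms(3) q0 by auto
  then show "norm (snd q) = fst q" using q0 by (simp add: power2_eq_iff_nonneg)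
qed

text \<open>Complementarity turns the case distinction of \<open>normQ\<close> into conditions that
  are stable under limits.\<close>

lemma mem_normQ_iff:
  fixes l q :: "real \<times> 'b::euclidean_space"
  shows "l \<in> normQ q \<longleftrightarrow> q \<in> SOC \<and> l \<in> SOCdual \<and> l \<bullet> q = 0"
proof -
  consider "q \<notin> SOC" | "q = 0" | "q \<in> interior SOC" "q \<noteq> 0" | "q \<in> SOC" "q \<notin> interior SOC" "q \<noteq> 0"
    by blast
  then show ?thesis
  proof cases
    case 3
    have qS: "q \<in> SOC" using 3 interior_subset by blast
    have "l = 0" if l: "l \<in> SOCdual" "l \<bullet> q = 0"
    proof -
      obtain e where e: "e > 0" "cball q e \<subseteq> SOC"
        using 3(1) by (auto simp: mem_interior_cball)
      \<comment> \<open>The step keeps \<open>q + c *\<^sub>R l\<close> in the ball inside the cone;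
        testing \<open>l\<close> there leaves \<open>c * (l \<bullet> l) \<le> 0\<close>. The added
        1 covers \<open>l = 0\<close>.\<close>
      define c where "c = e / (norm l + 1)"
      have c: "c > 0" using e by (simp add: c_def add_nonneg_pos)
      have "c * norm l \<le> e" using e mult_left_mono[of "norm l" "norm l + 1" e] by (simp add: c_def pos_divide_le_eq add_nonneg_pos)
      then have "q + c *\<^sub>R l \<in> SOC"
        using e c by (intro subsetD[OF e(2)]) (simp add: dist_norm)
      then have "l \<bullet> (q + c *\<^sub>R l) \<le> 0" by (rule SOC_SOCdual_inner[OF l(1)])
      then have "c * (l \<bullet> l) \<le> 0" using l(2) by (simp add: inner_add_right)
      then show "l = 0" using c by (simp add: mult_le_0_iff) (metis inner_ge_zero inner_eq_zero_iff order.antisym)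
    qed
    then show ?thesis using 3 qS zero_in_SOCdual by (auto simp: normQ_def)
  next
    case 4
    have "open {p :: real \<times> 'b. norm (snd p) < fst p}"
      by (intro open_Collect_less continuous_intros)
    moreover have "{p :: real \<times> 'b. norm (snd p) < fst p} \<subseteq> SOC" by (auto simp: SOC_def)
    ultimately have "{p :: real \<times> 'b. norm (snd p) < fst p} \<subseteq> interior SOC"
      by (rule interior_maximal[rotated])
    with 4(1,2) have bd: "norm (snd q) = fst q" by (force simp: SOC_def)
    have q0: "fst q > 0" using bd 4(3)
      by (metis fst_zero norm_eq_zero norm_ge_zero order_le_imp_less_or_eq prod.expand snd_zero)
    have "l \<in> SOCdual \<and> l \<bullet> q = 0" if "l = \<alpha> *\<^sub>R hatq q" "\<alpha> \<ge> 0" for \<alpha>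
      using that bd by (simp add: SOCdual_iff hatq_def inner_prod_def dot_square_norm power2_eq_square)
    moreover have "\<exists>\<alpha>. l = \<alpha> *\<^sub>R hatq q \<and> 0 \<le> \<alpha>" if l: "l \<in> SOCdual" "l \<bullet> q = 0"
    proof -
      have "- fst l \<ge> 0" using l(1) norm_ge_zero[of "snd l"] unfolding SOCdual_iff by linarith
      then show ?thesis
        using SOC_complementary[OF l(1) 4(1) l(2) 4(3)] q0 by (metis divide_nonneg_pos)
    qed
    ultimately show ?thesis using 4 by (auto simp: normQ_def)
  qed (auto simp: normQ_def zero_in_SOC)
qed

text \<open>\<open>curvQ\<close> and the objective of \<open>rho\<close> are multiples of this
  indefinite form. It is nonpositive exactly on the cone and on its negative, and its polar bilinear
  form is \<open>hatq p \<bullet> q\<close>.\<close>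

abbreviation lorentz :: "real \<times> 'b::euclidean_space \<Rightarrow> real" where
  "lorentz d \<equiv> (norm (snd d))\<^sup>2 - (fst d)\<^sup>2"

lemma SOCdual_fst_nonpos: "l \<in> SOCdual \<Longrightarrow> fst l \<le> 0"
  unfolding SOCdual_iff using norm_ge_zero[of "snd l"] by linarith

lemma SOCdual_fst_zero: "l \<in> SOCdual \<Longrightarrow> fst l = 0 \<Longrightarrow> l = 0"
  unfolding SOCdual_iff by (auto simp: prod_eq_iff)

text \<open>By Cauchy-Schwarz, a vector orthogonal to a nonzero dual element is not interior to the
  cone or to its negative. Hence the objective of \<open>rho\<close> is nonnegative on its
  constraint set.\<close>

lemma lorentz_nonneg:
  fixes l d :: "real \<times> 'b::euclidean_space"
  assumes "l \<in> SOCdual" "l \<bullet> d = 0"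
  shows "0 \<le> - fst l * lorentz d"
proof (cases "fst l = 0")
  case False
  have "(fst l * fst d)\<^sup>2 = (snd l \<bullet> snd d)\<^sup>2"
    using assms(2) by (simp add: inner_prod_def add_eq_0_iff)
  also have "\<dots> \<le> (norm (snd l) * norm (snd d))\<^sup>2"
    by (metis Cauchy_Schwarz_ineq2 abs_le_square_iff abs_mult abs_norm_cancel)
  also have "\<dots> \<le> (- fst l * norm (snd d))\<^sup>2"
    using assms(1) by (intro power_mono mult_right_mono) (auto simp: SOCdual_iff)
  finally have "(fst l)\<^sup>2 * (fst d)\<^sup>2 \<le> (fst l)\<^sup>2 * (norm (snd d))\<^sup>2"
    by (simp add: power_mult_distrib)
  then have "(fst d)\<^sup>2 \<le> (norm (snd d))\<^sup>2" using False by simp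
  then show ?thesis using SOCdual_fst_nonpos[OF assms(1)] by (intro mult_nonneg_nonneg) auto
qed simp

lemma lorentz_nonpos: "l \<in> SOCdual \<Longrightarrow> d \<in> SOC \<Longrightarrow> - fst l * lorentz d \<le> 0"
  using SOCdual_fst_nonpos[of l] unfolding SOC_def
  by (intro mult_nonneg_nonpos) (auto intro: power_mono)

lemma lorentz_null_in_SOC:
  assumes "lorentz d \<le> 0" shows "d \<in> SOC \<or> - d \<in> SOC"
proof -
  have "norm (snd d) \<le> \<bar>fst d\<bar>" using assms by (simp add: abs_le_square_iff[symmetric])
  then show ?thesis by (auto simp: SOC_def abs_if split: if_splits)
qed

text \<open>Polarisation of the Lorentz form: both vectors are null, so only their difference
  contributes. All curvature in the proof comes from this identity.\<close>

lemma inner_hatq_frontier: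
  assumes "norm (snd p) = fst p" "norm (snd q) = fst q"
  shows "hatq p \<bullet> q = - lorentz (q - p) / 2"
proof -
  have "(norm (snd q - snd p))\<^sup>2 = (fst q)\<^sup>2 + (fst p)\<^sup>2 - 2 * (snd p \<bullet> snd q)"
    using assms by (simp add: power2_norm_eq_inner algebra_simps inner_commute)
      (simp add: dot_square_norm)
  then show ?thesis by (simp add: hatq_def inner_prod_def power2_eq_square algebra_simps)
qed

section \<open>Strict second-order expansions\<close>

text \<open>\<open>C2_near\<close> differentiates \<open>Dh y d\<close> for each fixed
  \<open>d\<close>, so linearity in \<open>d\<close> is not part of it. It follows from linearity of
  \<open>Dh y\<close> near \<open>x0\<close> and uniqueness of derivatives.\<close>

lemma bilinear_C2_near:
  fixes h :: "'a::euclidean_space \<Rightarrow> 'c::real_normed_vector"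
  assumes "C2_near h Dh D2h x0"
  shows "bounded_bilinear (D2h x0)"
proof -
  obtain r where r: "r > 0"
    and D: "\<And>x. x \<in> ball x0 r \<Longrightarrow> (h has_derivative Dh x) (at x)"
    and D2: "\<And>x d. x \<in> ball x0 r \<Longrightarrow> ((\<lambda>y. Dh y d) has_derivative (\<lambda>k. D2h x k d)) (at x)"
    using assms unfolding C2_near_def by blast
  have x0: "x0 \<in> ball x0 r" using r by simp
  have lin: "linear (Dh x)" if "x \<in> ball x0 r" for x
    using D[OF that] by (simp add: has_derivative_linear)
  have "linear (D2h x0 k)" for k
  proof (rule linearI)
    fix d e :: 'a and c :: real
    have "((\<lambda>y. Dh y d + Dh y e) has_derivative (\<lambda>k. D2h x0 k d + D2h x0 k e)) (at x0)"
      by (intro derivative_intros D2 x0)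
    moreover have "((\<lambda>y. Dh y (d + e)) has_derivative (\<lambda>k. D2h x0 k (d + e))) (at x0)"
      by (intro D2 x0)
    then have "((\<lambda>y. Dh y d + Dh y e) has_derivative (\<lambda>k. D2h x0 k (d + e))) (at x0)"
      by (rule has_derivative_transform_within_open[OF _ open_ball x0]) (simp add: linear_add lin)
    ultimately show "D2h x0 k (d + e) = D2h x0 k d + D2h x0 k e"
      using has_derivative_unique by metis
    have "((\<lambda>y. c *\<^sub>R Dh y d) has_derivative (\<lambda>k. c *\<^sub>R D2h x0 k d)) (at x0)"
      by (intro derivative_intros D2 x0)
    moreover have "((\<lambda>y. Dh y (c *\<^sub>R d)) has_derivative (\<lambda>k. D2h x0 k (c *\<^sub>R d))) (at x0)"
      by (intro D2 x0)
    then have "((\<lambda>y. c *\<^sub>R Dh y d) has_derivative (\<lambda>k. D2h x0 k (c *\<^sub>R d))) (at x0)"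
      by (rule has_derivative_transform_within_open[OF _ open_ball x0]) (simp add: linear_scale lin)
    ultimately show "D2h x0 k (c *\<^sub>R d) = c *\<^sub>R D2h x0 k d"
      using has_derivative_unique by metis
  qed
  moreover have "linear (\<lambda>k. D2h x0 k d)" for d
    by (rule has_derivative_linear[OF D2[OF x0]])
  ultimately have "bilinear (D2h x0)" by (simp add: bilinear_def)
  then show ?thesis by (simp add: bilinear_conv_bounded_bilinear)
qed

lemma C2_near_strict_expansion:
  fixes h :: "'a::euclidean_space \<Rightarrow> 'c::real_normed_vector"
  assumes C2: "C2_near h Dh D2h x0" and e: "\<epsilon> > 0"
  obtains \<delta> where "\<delta> > 0"
    "\<And>x. x \<in> ball x0 \<delta> \<Longrightarrow> (h has_derivative Dh x) (at x)"
    "\<And>x d. x \<in> ball x0 \<delta> \<Longrightarrow> isCont (\<lambda>y. Dh y d) x"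
    "\<And>x y d. x \<in> ball x0 \<delta> \<Longrightarrow> y \<in> ball x0 \<delta> \<Longrightarrow>
        norm (Dh y d - Dh x d - D2h x0 (y - x) d) \<le> \<epsilon> * norm (y - x) * norm d"
    "\<And>x y. x \<in> ball x0 \<delta> \<Longrightarrow> y \<in> ball x0 \<delta> \<Longrightarrow>
        norm (h y - h x - Dh x (y - x) - (1/2) *\<^sub>R D2h x0 (y - x) (y - x)) \<le> \<epsilon> * (norm (y - x))\<^sup>2"
proof -
  obtain r where r: "r > 0"
    and D: "\<And>x. x \<in> ball x0 r \<Longrightarrow> (h has_derivative Dh x) (at x)"
    and D2: "\<And>x d. x \<in> ball x0 r \<Longrightarrow> ((\<lambda>y. Dh y d) has_derivative (\<lambda>k. D2h x k d)) (at x)"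
    and cont: "\<And>d k. continuous_on (ball x0 r) (\<lambda>x. D2h x k d)"
    using C2 unfolding C2_near_def by blast
  have x0: "x0 \<in> ball x0 r" using r by simp
  interpret B: bounded_bilinear "D2h x0" by (rule bilinear_C2_near[OF C2])
  define N where "N = real DIM('a)"
  have N: "N > 0" by (simp add: N_def)
  \<comment> \<open>Two expansions over \<open>Basis\<close>, one in the increment and one in the
    direction, each cost a factor \<open>N\<close>.\<close>
  define e1 where "e1 = \<epsilon> / (N * N)"
  have e1: "e1 > 0" using e N by (simp add: e1_def)
  have "\<forall>\<^sub>F y in nhds x0. norm (D2h y i b - D2h x0 i b) < e1" for i b
  proof -
    have "isCont (\<lambda>x. D2h x i b) x0"
      using cont[of i b] x0 by (simp add: continuous_on_eq_continuous_at)
    then have "((\<lambda>x. D2h x i b) \<longlongrightarrow> D2h x0 i b) (nhds x0)"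
      using tendsto_at_iff_tendsto_nhds unfolding isCont_def by blast
    then show ?thesis using e1 by (simp add: tendsto_iff dist_norm)
  qed
  then have "\<forall>\<^sub>F y in nhds x0. \<forall>i\<in>Basis. \<forall>b\<in>Basis. norm (D2h y i b - D2h x0 i b) < e1"
    by (intro eventually_ball_finite ballI) auto
  then obtain \<delta>1 where \<delta>1: "\<delta>1 > 0"
    and small: "\<And>y i b. y \<in> ball x0 \<delta>1 \<Longrightarrow> i \<in> Basis \<Longrightarrow> b \<in> Basis \<Longrightarrow> norm (D2h y i b - D2h x0 i b) < e1"
    unfolding eventually_nhds_metric by (auto simp: dist_commute)
  define \<delta> where "\<delta> = min r \<delta>1"
  have sub: "ball x0 \<delta> \<subseteq> ball x0 r" "ball x0 \<delta> \<subseteq> ball x0 \<delta>1" by (auto simp: \<delta>_def)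
  have one: "norm (Dh y b - Dh x b - D2h x0 (y - x) b) \<le> (N * e1) * norm (y - x)"
    if x: "x \<in> ball x0 \<delta>" and y: "y \<in> ball x0 \<delta>" and b: "b \<in> Basis" for x y b
  proof -
    have der: "((\<lambda>y. Dh y b - D2h x0 y b) has_derivative (\<lambda>k. D2h p k b - D2h x0 k b)) (at p within ball x0 \<delta>)"
      if "p \<in> ball x0 \<delta>" for p
      using that sub
      by (intro has_derivative_diff has_derivative_at_withinI[OF D2]
          bounded_linear_imp_has_derivative[OF B.bounded_linear_left]) auto
    have bd: "onorm (\<lambda>k. D2h p k b - D2h x0 k b) \<le> N * e1" if p: "p \<in> ball x0 \<delta>" for p
    proof (rule onorm_bound)
      show "0 \<le> N * e1" using N e1 by simp
      fix k :: 'a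
      have lin: "linear (\<lambda>k. D2h p k b - D2h x0 k b)"
        using has_derivative_linear[OF der[OF p]] .
      have "D2h p k b - D2h x0 k b = (\<Sum>i\<in>Basis. (k \<bullet> i) *\<^sub>R (D2h p i b - D2h x0 i b))"
        using linear_sum[OF lin, of "\<lambda>i. (k \<bullet> i) *\<^sub>R i" Basis]
        by (simp only: linear_scale[OF lin] euclidean_representation)
      also have "norm \<dots> \<le> (\<Sum>i\<in>(Basis::'a set). norm k * e1)"
      proof (rule sum_norm_le)
        fix i :: 'a assume i: "i \<in> Basis"
        show "norm ((k \<bullet> i) *\<^sub>R (D2h p i b - D2h x0 i b)) \<le> norm k * e1"
          using small[OF subsetD[OF sub(2) p] i b] Basis_le_norm[OF i, of k]
          by (auto intro!: mult_mono)
      qed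
      also have "\<dots> = N * e1 * norm k" by (simp add: N_def)
      finally show "norm (D2h p k b - D2h x0 k b) \<le> N * e1 * norm k" .
    qed
    have "norm ((Dh y b - D2h x0 y b) - (Dh x b - D2h x0 x b)) \<le> (N * e1) * norm (y - x)"
      by (rule differentiable_bound[OF convex_ball[of x0 \<delta>] der bd y x])
    then show ?thesis by (simp add: B.diff_left algebra_simps)
  qed
  have first: "norm (Dh y d - Dh x d - D2h x0 (y - x) d) \<le> \<epsilon> * norm (y - x) * norm d"
    if x: "x \<in> ball x0 \<delta>" and y: "y \<in> ball x0 \<delta>" for x y d
  proof -
    have lin: "linear (Dh x)" "linear (Dh y)" using x y sub by (blast intro: has_derivative_linear D)+
    have L: "linear (\<lambda>d. Dh y d - Dh x d - D2h x0 (y - x) d)"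
      by (rule linearI) (auto simp: linear_add[OF lin(1)] linear_add[OF lin(2)] linear_scale[OF lin(1)]
          linear_scale[OF lin(2)] B.add_right B.scaleR_right algebra_simps)
    have "Dh y d - Dh x d - D2h x0 (y - x) d =
        (\<Sum>b\<in>Basis. (d \<bullet> b) *\<^sub>R (Dh y b - Dh x b - D2h x0 (y - x) b))"
      using linear_sum[OF L, of "\<lambda>b. (d \<bullet> b) *\<^sub>R b" Basis]
      by (simp only: linear_scale[OF L] euclidean_representation)
    also have "norm \<dots> \<le> (\<Sum>b\<in>(Basis::'a set). norm d * (N * e1 * norm (y - x)))"
    proof (rule sum_norm_le)
      fix b :: 'a assume b: "b \<in> Basis"
      show "norm ((d \<bullet> b) *\<^sub>R (Dh y b - Dh x b - D2h x0 (y - x) b)) \<le> norm d * (N * e1 * norm (y - x))"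
        using one[OF x y b] Basis_le_norm[OF b, of d] by (auto intro!: mult_mono)
    qed
    also have "\<dots> = (N * N * e1) * norm (y - x) * norm d" by (simp add: N_def)
    also have "N * N * e1 = \<epsilon>" using N by (simp add: e1_def)
    finally show ?thesis .
  qed
  have second: "norm (h y - h x - Dh x (y - x) - (1/2) *\<^sub>R D2h x0 (y - x) (y - x)) \<le> \<epsilon> * (norm (y - x))\<^sup>2"
    if x: "x \<in> ball x0 \<delta>" and y: "y \<in> ball x0 \<delta>" for x y
  proof -
    define s where "s = y - x"
    \<comment> \<open>\<open>F 1 - F 0\<close> is the Taylor remainder, and the derivative of
      \<open>F\<close> is the first-order remainder already estimated.\<close>
    define F where "F = (\<lambda>t::real. h (x + t *\<^sub>R s) - t *\<^sub>R Dh x s - (t\<^sup>2 / 2) *\<^sub>R D2h x0 s s)"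
    have mem: "x + t *\<^sub>R s \<in> ball x0 \<delta>" if "t \<in> {0..1}" for t
    proof -
      have "x + t *\<^sub>R s = (1 - t) *\<^sub>R x + t *\<^sub>R y" by (simp add: s_def algebra_simps)
      then show ?thesis using convexD_alt[OF convex_ball x y, of t] that by auto
    qed
    have der: "(F has_derivative (\<lambda>a. a *\<^sub>R (Dh (x + t *\<^sub>R s) s - Dh x s - t *\<^sub>R D2h x0 s s))) (at t within {0..1})"
      if t: "t \<in> {0..1}" for t
    proof -
      have lin: "linear (Dh (x + t *\<^sub>R s))" using mem[OF t] sub by (blast intro: has_derivative_linear D)
      have "((\<lambda>t. h (x + t *\<^sub>R s)) has_derivative (\<lambda>a. Dh (x + t *\<^sub>R s) (a *\<^sub>R s))) (at t within {0..1})"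
        by (rule has_derivative_compose[where f="\<lambda>t. x + t *\<^sub>R s" and g=h])
           (use mem[OF t] sub in \<open>auto intro!: derivative_eq_intros D\<close>)
      then have 1: "((\<lambda>t. h (x + t *\<^sub>R s)) has_derivative (\<lambda>a. a *\<^sub>R Dh (x + t *\<^sub>R s) s)) (at t within {0..1})"
        by (simp add: linear_scale[OF lin])
      have 2: "((\<lambda>t::real. t *\<^sub>R Dh x s) has_derivative (\<lambda>a. a *\<^sub>R Dh x s)) (at t within {0..1})"
        by (auto intro!: derivative_eq_intros)
      have 3: "((\<lambda>t::real. (t\<^sup>2 / 2) *\<^sub>R D2h x0 s s) has_derivative (\<lambda>a. (a * t) *\<^sub>R D2h x0 s s)) (at t within {0..1})"
        by (auto intro!: derivative_eq_intros simp: field_simps)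
      have "(F has_derivative (\<lambda>a. a *\<^sub>R Dh (x + t *\<^sub>R s) s - a *\<^sub>R Dh x s - (a * t) *\<^sub>R D2h x0 s s)) (at t within {0..1})"
        unfolding F_def by (intro has_derivative_diff 1 2 3)
      then show ?thesis by (simp add: algebra_simps)
    qed
    have bd: "onorm (\<lambda>a. a *\<^sub>R (Dh (x + t *\<^sub>R s) s - Dh x s - t *\<^sub>R D2h x0 s s)) \<le> \<epsilon> * (norm s)\<^sup>2"
      if t: "t \<in> {0..1}" for t
    proof (rule onorm_bound)
      show "0 \<le> \<epsilon> * (norm s)\<^sup>2" using e by simp
      fix a :: real
      have "norm (Dh (x + t *\<^sub>R s) s - Dh x s - t *\<^sub>R D2h x0 s s) \<le> \<epsilon> * (t * norm s) * norm s"
        using first[OF x mem[OF t], of s] t by (simp add: B.scaleR_left)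
      also have "\<dots> \<le> \<epsilon> * (1 * norm s) * norm s"
        using t e by (intro mult_right_mono mult_left_mono) auto
      finally have *: "norm (Dh (x + t *\<^sub>R s) s - Dh x s - t *\<^sub>R D2h x0 s s) \<le> \<epsilon> * (norm s)\<^sup>2"
        by (simp add: power2_eq_square)
      show "norm (a *\<^sub>R (Dh (x + t *\<^sub>R s) s - Dh x s - t *\<^sub>R D2h x0 s s)) \<le> \<epsilon> * (norm s)\<^sup>2 * norm a"
        using mult_left_mono[OF *, of "\<bar>a\<bar>"] by (simp add: mult.commute)
    qed
    have "norm (F 1 - F 0) \<le> \<epsilon> * (norm s)\<^sup>2 * norm (1 - 0 :: real)"
      by (rule differentiable_bound[OF convex_real_interval(5) der bd]) auto
    then show ?thesis by (simp add: F_def s_def algebra_simps)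
  qed
  show ?thesis
  proof (rule that[of \<delta>])
    show "\<delta> > 0" using r \<delta>1 by (simp add: \<delta>_def)
    show "(h has_derivative Dh x) (at x)" if "x \<in> ball x0 \<delta>" for x using D that sub by auto
    show "isCont (\<lambda>y. Dh y d) x" if "x \<in> ball x0 \<delta>" for x d
      using D2 that sub by (meson has_derivative_continuous subsetD)
  qed (use first second in auto)
qed

section \<open>Tilt stability from pointwise strong monotonicity\<close>

text \<open>This is subadditivity of |x|^2 / t, the perspective of the squared norm, with
  denominators cleared so that t = 0 is allowed. The common vector \<open>D\<close> is what makes
  the right-hand sides add.\<close>

lemma cocoercive_chain:
  fixes D a b :: "'a::real_inner"
  assumes c: "c > 0" and \<tau>: "0 \<le> \<tau>1" "0 \<le> \<tau>2"
    and 1: "c * (norm a)\<^sup>2 \<le> \<tau>1 * (D \<bullet> a)" and 2: "c * (norm b)\<^sup>2 \<le> \<tau>2 * (D \<bullet> b)"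
  shows "c * (norm (a + b))\<^sup>2 \<le> (\<tau>1 + \<tau>2) * (D \<bullet> (a + b))"
proof (cases "\<tau>1 = 0 \<or> \<tau>2 = 0")
  case True
  then show ?thesis
  proof
    assume "\<tau>1 = 0"
    with 1 c have "a = 0" by (simp add: mult_le_0_iff)
    then show ?thesis using 2 \<open>\<tau>1 = 0\<close> by simp
  next
    assume "\<tau>2 = 0"
    with 2 c have "b = 0" by (simp add: mult_le_0_iff)
    then show ?thesis using 1 \<open>\<tau>2 = 0\<close> by simp
  qed
next
  case False
  with \<tau> have pos: "\<tau>1 > 0" "\<tau>2 > 0" by auto
  define X where "X = \<tau>2 * (D \<bullet> a) + \<tau>1 * (D \<bullet> b)"
  have "(\<tau>1 * \<tau>2) * (2 * c * (norm a * norm b)) \<le> c * ((\<tau>2 * norm a)\<^sup>2 + (\<tau>1 * norm b)\<^sup>2)"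
    using mult_left_mono[OF sum_squares_bound[of "\<tau>2 * norm a" "\<tau>1 * norm b"], of c] c
    by (simp add: algebra_simps)
  also have "\<dots> = \<tau>2\<^sup>2 * (c * (norm a)\<^sup>2) + \<tau>1\<^sup>2 * (c * (norm b)\<^sup>2)"
    by (simp add: power_mult_distrib algebra_simps)
  also have "\<dots> \<le> \<tau>2\<^sup>2 * (\<tau>1 * (D \<bullet> a)) + \<tau>1\<^sup>2 * (\<tau>2 * (D \<bullet> b))"
    by (intro add_mono mult_left_mono 1 2) auto
  also have "\<dots> = (\<tau>1 * \<tau>2) * X" by (simp add: X_def power2_eq_square algebra_simps)
  finally have X: "2 * c * (norm a * norm b) \<le> X" using pos by (simp add: mult_le_cancel_left_pos)
  have "(norm (a + b))\<^sup>2 \<le> (norm a + norm b)\<^sup>2"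
    by (intro power_mono norm_triangle_ineq) auto
  then have "c * (norm (a + b))\<^sup>2 \<le> c * (norm a + norm b)\<^sup>2" using c by simp
  also have "\<dots> = c * (norm a)\<^sup>2 + c * (norm b)\<^sup>2 + 2 * c * (norm a * norm b)"
    by (simp add: power2_eq_square algebra_simps)
  also have "\<dots> \<le> \<tau>1 * (D \<bullet> a) + \<tau>2 * (D \<bullet> b) + X"
    using 1 2 X by simp
  also have "\<dots> = (\<tau>1 + \<tau>2) * (D \<bullet> (a + b))"
    by (simp add: X_def inner_add_right algebra_simps)
  finally show ?thesis .
qed

lemma mem_Mtilt_phi_iff:
  assumes "xb \<in> S" "\<gamma> > 0"
  shows "x \<in> Mtilt (phi f S) xb \<gamma> v \<longleftrightarrow>
    x \<in> S \<and> norm (x - xb) \<le> \<gamma> \<and> (\<forall>y\<in>S. norm (y - xb) \<le> \<gamma> \<longrightarrow> f x - v \<bullet> x \<le> f y - v \<bullet> y)"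
    (is "?L \<longleftrightarrow> ?R")
proof
  assume L: ?L
  then have le: "phi f S x - ereal (v \<bullet> x) \<le> phi f S y - ereal (v \<bullet> y)" if "norm (y - xb) \<le> \<gamma>" for y
    using that by (simp add: Mtilt_def)
  have "x \<in> S" using le[of xb] assms by (auto simp: phi_def split: if_splits)
  moreover have "f x - v \<bullet> x \<le> f y - v \<bullet> y" if "y \<in> S" "norm (y - xb) \<le> \<gamma>" for y
    using le[OF that(2)] that(1) \<open>x \<in> S\<close> by (simp add: phi_def)
  ultimately show ?R using L by (simp add: Mtilt_def)
qed (auto simp: Mtilt_def phi_def)

text \<open>\<open>G\<close> stands for the graph of the subgradient mapping and is only asked to
  contain the stationary pairs of minimisers, with and without the proximal term. In
  \<open>mono\<close> the radius may depend on the pair, which is what an argument by sequences can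
  deliver.\<close>

lemma tilt_stable_if_locally_strongly_monotone:
  fixes f :: "'a::euclidean_space \<Rightarrow> real" and G :: "'a \<Rightarrow> 'a \<Rightarrow> bool"
  assumes \<gamma>0: "\<gamma>0 > 0" and comp: "compact (S \<inter> cball xb \<gamma>0)" and xb: "xb \<in> S"
    and cont: "continuous_on (S \<inter> cball xb \<gamma>0) f" and \<kappa>: "\<kappa> > 0" and \<eta>: "\<eta> > 0"
    and first_order: "\<And>s v x \<gamma>. \<lbrakk>0 \<le> s; x \<in> S; norm (x - xb) < \<gamma>; \<gamma> \<le> \<gamma>0;
        \<And>y. y \<in> S \<Longrightarrow> norm (y - xb) \<le> \<gamma> \<Longrightarrow>
          f x + s/2 * (norm (x - xb))\<^sup>2 - v \<bullet> x \<le> f y + s/2 * (norm (y - xb))\<^sup>2 - v \<bullet> y\<rbrakk>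
        \<Longrightarrow> G x (v - s *\<^sub>R (x - xb))"
    and growth: "\<And>x. x \<in> S \<Longrightarrow> norm (x - xb) \<le> \<gamma>0 \<Longrightarrow> f xb - C * (norm (x - xb))\<^sup>2 \<le> f x"
    and hypo: "\<And>x v y w. \<lbrakk>G x v; G y w; norm (x - xb) < \<eta>; norm v < \<eta>; norm (y - xb) < \<eta>; norm w < \<eta>\<rbrakk>
        \<Longrightarrow> - r * (norm (y - x))\<^sup>2 \<le> (w - v) \<bullet> (y - x)"
    and mono: "\<And>x v. \<lbrakk>G x v; norm (x - xb) < \<eta>; norm v < \<eta>\<rbrakk> \<Longrightarrow>
        \<exists>\<delta>>0. \<forall>y w. G y w \<longrightarrow> norm (y - x) < \<delta> \<longrightarrow> norm (w - v) < \<delta> \<longrightarrow>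
          1 / \<kappa> * (norm (y - x))\<^sup>2 \<le> (w - v) \<bullet> (y - x)"
  shows "tilt_stable (phi f S) xb \<kappa>"
proof -
  \<comment> \<open>\<open>s - r \<ge> 1\<close> makes the proximal minimiser nonexpansive in the
    parameter; \<open>s/2 - C \<ge> 1/2\<close> confines it to within \<open>2 * norm z\<close> of
    \<open>xb\<close>.\<close>
  define s where "s = \<bar>r\<bar> + 2 * \<bar>C\<bar> + 1"
  have s: "s \<ge> 1" "s - r \<ge> 1" "s/2 - C \<ge> 1/2" 
    using abs_ge_self[of C] abs_ge_self[of r] abs_ge_zero[of r] abs_ge_zero[of C]
    unfolding s_def add_divide_distrib by simp_all
  \<comment> \<open>The proximal term adds \<open>s\<close> to the modulus of monotonicity.\<close>
  define c where "c = s + 1 / \<kappa>"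
  have c: "c > 0" "s < c" using s \<kappa> by (auto simp: c_def intro: add_pos_pos)
  define \<psi> where "\<psi> = (\<lambda>z x. f x + s/2 * (norm (x - xb))\<^sup>2 - z \<bullet> x)"
  have xbK: "xb \<in> S \<inter> cball xb \<gamma>0" using xb \<gamma>0 by simp
  have "\<exists>x\<in>S \<inter> cball xb \<gamma>0. \<forall>y\<in>S \<inter> cball xb \<gamma>0. \<psi> z x \<le> \<psi> z y" for z
    unfolding \<psi>_def using xbK by (intro continuous_attains_inf comp continuous_intros cont) auto
  then obtain P where PK: "\<And>z. P z \<in> S \<inter> cball xb \<gamma>0"
    and Pmin: "\<And>z y. y \<in> S \<inter> cball xb \<gamma>0 \<Longrightarrow> \<psi> z (P z) \<le> \<psi> z y" by metis
  have P\<gamma>: "norm (P z - xb) \<le> \<gamma>0" for z using PK[of z] by (simp add: dist_norm norm_minus_commute)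
  have near: "norm (P z - xb) \<le> 2 * norm z" for z
  proof -
    have "f (P z) + s/2 * (norm (P z - xb))\<^sup>2 - z \<bullet> P z \<le> f xb - z \<bullet> xb"
      using Pmin[OF xbK, of z] by (simp add: \<psi>_def)
    moreover have "f xb - C * (norm (P z - xb))\<^sup>2 \<le> f (P z)"
      using PK[of z] P\<gamma>[of z] by (intro growth) auto
    ultimately have "(s/2 - C) * (norm (P z - xb))\<^sup>2 \<le> z \<bullet> (P z - xb)"
      by (simp add: algebra_simps inner_diff_right)
    moreover have "1/2 * (norm (P z - xb))\<^sup>2 \<le> (s/2 - C) * (norm (P z - xb))\<^sup>2"
      using s(3) by (rule mult_right_mono) simp
    moreover have "z \<bullet> (P z - xb) \<le> norm z * norm (P z - xb)" by (rule norm_cauchy_schwarz)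
    ultimately have "norm (P z - xb) * norm (P z - xb) \<le> (2 * norm z) * norm (P z - xb)"
      by (simp add: power2_eq_square)
    then show ?thesis by (cases "P z = xb") (auto dest: mult_right_le_imp_le)
  qed
  \<comment> \<open>For \<open>norm z < \<rho>\<close> the minimiser is strictly inside the
    \<open>\<gamma>0\<close> ball, as \<open>first_order\<close> demands, and its subgradient, of
    norm at most \<open>(1 + 2 * s) * norm z\<close>, stays below \<open>\<eta>\<close>.\<close>
  define \<rho> where "\<rho> = min (\<gamma>0 / 2) (\<eta> / (2 + 2 * s))"
  have \<rho>: "\<rho> > 0" "2 * \<rho> \<le> \<gamma>0" "(2 + 2 * s) * \<rho> \<le> \<eta>"
  proof -
    show "\<rho> > 0" "2 * \<rho> \<le> \<gamma>0" using \<gamma>0 \<eta> s by (auto simp: \<rho>_def)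
    have "\<rho> \<le> \<eta> / (2 + 2 * s)" by (simp add: \<rho>_def)
    then show "(2 + 2 * s) * \<rho> \<le> \<eta>" using s by (simp add: pos_le_divide_eq mult.commute)
  qed
  have s\<rho>: "s * \<rho> > 0" using s \<rho>(1) by simp
  have \<rho>\<eta>: "2 * \<rho> < \<eta>" using \<rho>(3) s\<rho> by (simp add: algebra_simps)
  have GP: "G (P z) (z - s *\<^sub>R (P z - xb))" "norm (P z - xb) < \<eta>" "norm (z - s *\<^sub>R (P z - xb)) < \<eta>"
    if z: "norm z < \<rho>" for z
  proof -
    show "G (P z) (z - s *\<^sub>R (P z - xb))"
    proof (rule first_order)
      show "norm (P z - xb) < \<gamma>0" using near[of z] z \<rho>(2) by linarith
      fix y assume "y \<in> S" "norm (y - xb) \<le> \<gamma>0"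
      then show "f (P z) + s/2 * (norm (P z - xb))\<^sup>2 - z \<bullet> P z \<le> f y + s/2 * (norm (y - xb))\<^sup>2 - z \<bullet> y"
        using Pmin[of y z] by (simp add: \<psi>_def dist_norm norm_minus_commute)
    qed (use PK[of z] s in auto)
    show "norm (P z - xb) < \<eta>" using near[of z] z \<rho>\<eta> by linarith
    have "norm (z - s *\<^sub>R (P z - xb)) \<le> norm z + s * norm (P z - xb)"
      using norm_triangle_ineq4[of z "s *\<^sub>R (P z - xb)"] s by simp
    also have "\<dots> \<le> norm z + s * (2 * norm z)" using near[of z] s by (intro add_left_mono mult_left_mono) auto
    also have "\<dots> = (1 + 2 * s) * norm z" by (simp add: algebra_simps)
    also have "\<dots> \<le> (1 + 2 * s) * \<rho>" using z s by (intro mult_left_mono) auto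
    also have "\<dots> < \<eta>" using \<rho> by (simp add: algebra_simps)
    finally show "norm (z - s *\<^sub>R (P z - xb)) < \<eta>" .
  qed
  have lip: "norm (P z2 - P z1) \<le> norm (z2 - z1)" if z: "norm z1 < \<rho>" "norm z2 < \<rho>" for z1 z2
  proof -
    have "- r * (norm (P z2 - P z1))\<^sup>2 \<le> ((z2 - s *\<^sub>R (P z2 - xb)) - (z1 - s *\<^sub>R (P z1 - xb))) \<bullet> (P z2 - P z1)"
      using GP[OF z(1)] GP[OF z(2)] by (intro hypo)
    also have "\<dots> = (z2 - z1) \<bullet> (P z2 - P z1) - s * (norm (P z2 - P z1))\<^sup>2"
      unfolding power2_norm_eq_inner by (simp add: algebra_simps)
    finally have "(s - r) * (norm (P z2 - P z1))\<^sup>2 \<le> (z2 - z1) \<bullet> (P z2 - P z1)"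
      by (simp add: algebra_simps)
    moreover have "1 * (norm (P z2 - P z1))\<^sup>2 \<le> (s - r) * (norm (P z2 - P z1))\<^sup>2"
      using s(2) by (rule mult_right_mono) simp
    moreover have "(z2 - z1) \<bullet> (P z2 - P z1) \<le> norm (z2 - z1) * norm (P z2 - P z1)"
      by (rule norm_cauchy_schwarz)
    ultimately have "norm (P z2 - P z1) * norm (P z2 - P z1) \<le> norm (z2 - z1) * norm (P z2 - P z1)"
      by (simp add: power2_eq_square)
    then show ?thesis by (cases "P z2 = P z1") (auto dest: mult_right_le_imp_le)
  qed
  have coc: "c * (norm (P z2 - P z1))\<^sup>2 \<le> (z2 - z1) \<bullet> (P z2 - P z1)"
    if z: "norm z1 < \<rho>" "norm z2 < \<rho>" for z1 z2
  proof -
    define D where "D = z2 - z1"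
    define zt where "zt = (\<lambda>t. z1 + t *\<^sub>R D)"
    define q where "q = (\<lambda>t. P (zt t))"
    define vt where "vt = (\<lambda>t. zt t - s *\<^sub>R (q t - xb))"
    have zt: "norm (zt t) < \<rho>" if "0 \<le> t" "t \<le> 1" for t
    proof -
      have "zt t = (1 - t) *\<^sub>R z1 + t *\<^sub>R z2" by (simp add: zt_def D_def algebra_simps)
      then have "zt t \<in> ball 0 \<rho>" using convexD_alt[OF convex_ball, of z1 0 \<rho> z2 t] z that by auto
      then show ?thesis by simp
    qed
    \<comment> \<open>The guards make \<open>Q\<close> vacuous for intervals that leave [0,1], which
      the local hypothesis of bisection has to cover as well.\<close>
    define Q where "Q = (\<lambda>a b. 0 \<le> a \<longrightarrow> b \<le> 1 \<longrightarrow> c * (norm (q b - q a))\<^sup>2 \<le> (b - a) * (D \<bullet> (q b - q a)))"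
    have Qtrans: "Q a d" if "Q a b" "Q b d" "a \<le> b" "b \<le> d" for a b d
      unfolding Q_def
    proof (intro impI)
      assume "0 \<le> a" "d \<le> 1"
      then have "c * (norm ((q b - q a) + (q d - q b)))\<^sup>2 \<le> ((b - a) + (d - b)) * (D \<bullet> ((q b - q a) + (q d - q b)))"
        using that by (intro cocoercive_chain c(1)) (auto simp: Q_def)
      then show "c * (norm (q d - q a))\<^sup>2 \<le> (d - a) * (D \<bullet> (q d - q a))" by simp
    qed
    have "(0::real) \<le> 1" by simp
    \<comment> \<open>Bisection replaces a finite subcover: it asks for \<open>Q\<close> only on
      short intervals around each \<open>x\<close>, with a length that may depend on
      \<open>x\<close>, and for transitivity.\<close>
    then have "Q 0 1"
    proof (induction rule: Bolzano)
      case (trans a b d)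
      then show ?case by (rule Qtrans)
    next
      case (local x)
      obtain \<delta> where \<delta>: "\<delta> > 0" and mon: "\<And>y w. G y w \<Longrightarrow> norm (y - q x) < \<delta> \<Longrightarrow> norm (w - vt x) < \<delta> \<Longrightarrow>
          1 / \<kappa> * (norm (y - q x))\<^sup>2 \<le> (w - vt x) \<bullet> (y - q x)"
        using mono[OF GP[OF zt[OF local]]] unfolding q_def vt_def by auto
      \<comment> \<open>The subgradient moves at most \<open>(1 + s) * norm D\<close> per unit of
        \<open>t\<close>, so \<open>\<bar>t - x\<bar> < d\<close> keeps the pair at \<open>t\<close>
        within \<open>\<delta>\<close> of the pair at \<open>x\<close>; the added 1 covers
        \<open>D = 0\<close>.\<close>
      define d where "d = \<delta> / ((1 + s) * (norm D + 1))"
      have d: "d > 0" unfolding d_def using \<delta> s by (intro divide_pos_pos mult_pos_pos) (auto simp: add_nonneg_pos)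
      have main: "c * (norm (q t - q x))\<^sup>2 \<le> (t - x) * (D \<bullet> (q t - q x))"
        if t: "0 \<le> t" "t \<le> 1" "\<bar>t - x\<bar> < d" for t
      proof -
        have zz: "zt t - zt x = (t - x) *\<^sub>R D" by (simp add: zt_def algebra_simps)
        have "norm (q t - q x) \<le> norm (zt t - zt x)"
          unfolding q_def using t local by (intro lip zt)
        then have nq: "norm (q t - q x) \<le> \<bar>t - x\<bar> * norm D" by (simp add: zz)
        have vv: "vt t - vt x = (t - x) *\<^sub>R D - s *\<^sub>R (q t - q x)"
          using zz by (simp add: vt_def algebra_simps)
        have "norm (vt t - vt x) \<le> \<bar>t - x\<bar> * norm D + s * norm (q t - q x)"
          unfolding vv using norm_triangle_ineq4[of "(t - x) *\<^sub>R D" "s *\<^sub>R (q t - q x)"] s by simp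
        also have "\<dots> \<le> \<bar>t - x\<bar> * norm D + s * (\<bar>t - x\<bar> * norm D)"
          using nq s by (intro add_left_mono mult_left_mono) auto
        also have "\<dots> = \<bar>t - x\<bar> * ((1 + s) * norm D)" by (simp add: algebra_simps)
        finally have nv: "norm (vt t - vt x) \<le> \<bar>t - x\<bar> * ((1 + s) * norm D)" .
        have "\<bar>t - x\<bar> * ((1 + s) * norm D) \<le> \<bar>t - x\<bar> * ((1 + s) * (norm D + 1))"
          using s by (intro mult_left_mono) auto
        also have "\<dots> < d * ((1 + s) * (norm D + 1))"
          using t(3) s by (intro mult_strict_right_mono mult_pos_pos) (auto simp: add_nonneg_pos)
        also have "\<dots> = \<delta>"
        proof -
          have "(1 + s) * (norm D + 1) > 0" using s by (intro mult_pos_pos) (auto simp: add_nonneg_pos)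
          then show ?thesis unfolding d_def by (metis less_irrefl nonzero_divide_eq_eq)
        qed
        finally have lt: "\<bar>t - x\<bar> * ((1 + s) * norm D) < \<delta>" .
        have "\<bar>t - x\<bar> * norm D \<le> \<bar>t - x\<bar> * ((1 + s) * norm D)"
          using s mult_right_mono[of 1 "1 + s" "norm D"] by (intro mult_left_mono) auto
        with nq lt have "norm (q t - q x) < \<delta>" by linarith
        then have "1 / \<kappa> * (norm (q t - q x))\<^sup>2 \<le> (vt t - vt x) \<bullet> (q t - q x)"
          using nv lt GP(1)[OF zt[OF t(1,2)]] by (intro mon) (auto simp: q_def vt_def)
        also have "\<dots> = (t - x) * (D \<bullet> (q t - q x)) - s * (norm (q t - q x))\<^sup>2"
          unfolding vv power2_norm_eq_inner by (simp add: inner_diff_left)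
        finally show ?thesis by (simp add: c_def algebra_simps)
      qed
      have "Q a b" if ab: "a \<le> x" "x \<le> b" "b - a < d" for a b
      proof (rule Qtrans)
        show "Q x b" unfolding Q_def using main[of b] ab local by auto
        show "Q a x" unfolding Q_def
        proof (intro impI)
          assume "0 \<le> a" "x \<le> 1"
          then have "c * (norm (q a - q x))\<^sup>2 \<le> (a - x) * (D \<bullet> (q a - q x))"
            using main[of a] ab by auto
          then show "c * (norm (q x - q a))\<^sup>2 \<le> (x - a) * (D \<bullet> (q x - q a))"
            by (simp add: norm_minus_commute[of "q x"] inner_diff_right algebra_simps)
        qed
      qed (use ab in auto)
      then show ?case using d by blast
    qed
    then show ?thesis by (simp add: Q_def q_def zt_def D_def)
  qed
  have P0: "P 0 = xb" using near[of 0] by simp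
  have Plip: "norm (P z - xb) \<le> norm z / c" if z: "norm z < \<rho>" for z
  proof -
    have "c * (norm (P z - xb))\<^sup>2 \<le> z \<bullet> (P z - xb)" using coc[of 0 z] z \<rho>(1) by (simp add: P0)
    also have "\<dots> \<le> norm z * norm (P z - xb)" by (rule norm_cauchy_schwarz)
    finally have "(c * norm (P z - xb)) * norm (P z - xb) \<le> norm z * norm (P z - xb)"
      by (simp add: power2_eq_square)
    then have "c * norm (P z - xb) \<le> norm z" by (cases "P z = xb") (auto dest: mult_right_le_imp_le)
    then show ?thesis using c by (simp add: pos_le_divide_eq mult.commute)
  qed
  \<comment> \<open>Quadratic growth comes from the optimal value as a function of the parameter.
    Its derivative along \<open>z\<close> is governed by \<open>P\<close>, and
    \<open>norm (P z - xb) \<le> norm z / c\<close> bounds its descent by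
    \<open>(norm z)\<^sup>2 / (2 * c)\<close>.\<close>
  have strong: "f xb + 1 / (2 * \<kappa>) * (norm (x - xb))\<^sup>2 \<le> f x"
    if x: "x \<in> S \<inter> cball xb \<gamma>0" "c * norm (x - xb) < \<rho>" for x
  proof -
    \<comment> \<open>This parameter maximises the lower bound
      \<open>z \<bullet> (x - xb) - (norm z)\<^sup>2 / (2 * c)\<close>.\<close>
    define z where "z = c *\<^sub>R (x - xb)"
    have nz: "norm z < \<rho>" using x(2) c by (simp add: z_def)
    define d where "d = (norm z)\<^sup>2 / (2 * c)"
    define H where "H = (\<lambda>t. \<psi> (t *\<^sub>R z) (P (t *\<^sub>R z)))"
    \<comment> \<open>No differentiability of the value function is used: optimal values at
      \<open>n + 2\<close> equally spaced parameters are compared successively, and the Riemann sum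
      of the linear bound exceeds its integral \<open>d\<close> by
      \<open>d / (n + 1)\<close>.\<close>
    have bound: "f xb - z \<bullet> xb - d - d / (real n + 1) \<le> \<psi> z x" for n
    proof -
      define N where "N = real n + 1"
      have N: "N > 0" by (simp add: N_def)
      have ind: "f xb - (real i / N) * (z \<bullet> xb) - d * (real i * (real i + 1) / N\<^sup>2) \<le> H (real i / N)"
        if "i \<le> n + 1" for i
        using that
      proof (induction i)
        case 0
        show ?case by (simp add: H_def P0 \<psi>_def)
      next
        case (Suc i)
        define t where "t = real i / N"
        define t' where "t' = real (Suc i) / N"
        have t': "0 \<le> t'" "t' \<le> 1" using Suc.prems by (auto simp: t'_def N_def divide_simps)
        have dt: "t' - t = 1 / N" by (simp add: t_def t'_def diff_divide_distrib[symmetric])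
        have "norm (t' *\<^sub>R z) \<le> norm z" using t' by (simp add: mult_left_le_one_le)
        then have "norm (P (t' *\<^sub>R z) - xb) \<le> norm (t' *\<^sub>R z) / c" using nz by (intro Plip) auto
        then have np: "norm (P (t' *\<^sub>R z) - xb) \<le> t' * norm z / c" using t' by simp
        have "z \<bullet> (P (t' *\<^sub>R z) - xb) \<le> norm z * norm (P (t' *\<^sub>R z) - xb)" by (rule norm_cauchy_schwarz)
        also have "\<dots> \<le> norm z * (t' * norm z / c)" using np by (intro mult_left_mono) auto
        also have "\<dots> = 2 * d * t'" using c by (simp add: d_def power2_eq_square)
        finally have zp: "z \<bullet> P (t' *\<^sub>R z) \<le> z \<bullet> xb + 2 * d * t'" by (simp add: inner_diff_right)
        have "H t \<le> \<psi> (t *\<^sub>R z) (P (t' *\<^sub>R z))" unfolding H_def by (rule Pmin[OF PK])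
        also have "\<dots> = H t' + (t' - t) * (z \<bullet> P (t' *\<^sub>R z))" by (simp add: H_def \<psi>_def algebra_simps)
        also have "\<dots> \<le> H t' + (1 / N) * (z \<bullet> xb + 2 * d * t')"
          unfolding dt using zp N by (intro add_left_mono mult_left_mono) auto
        finally have "f xb - t * (z \<bullet> xb) - d * (real i * (real i + 1) / N\<^sup>2) - (1 / N) * (z \<bullet> xb + 2 * d * t') \<le> H t'"
          using Suc by (simp add: t_def)
        also have "f xb - t * (z \<bullet> xb) - d * (real i * (real i + 1) / N\<^sup>2) - (1 / N) * (z \<bullet> xb + 2 * d * t') =
           f xb - t' * (z \<bullet> xb) - d * (real (Suc i) * (real (Suc i) + 1) / N\<^sup>2)"
          using N by (simp add: t_def t'_def field_simps power2_eq_square)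
        finally show ?case by (simp add: t'_def)
      qed
      have "real (n + 1) / N = 1" by (simp add: N_def)
      then have "f xb - z \<bullet> xb - d * (real (n + 1) * (real (n + 1) + 1) / N\<^sup>2) \<le> H 1"
        using ind[of "n + 1"] by simp
      also have "H 1 \<le> \<psi> z x" using Pmin[OF x(1)] by (simp add: H_def)
      also have "real (n + 1) * (real (n + 1) + 1) / N\<^sup>2 = 1 + 1 / N"
      proof -
        have "real (n + 1) = N" by (simp add: N_def)
        then show ?thesis using N by (simp only:) (simp add: power2_eq_square field_simps)
      qed
      finally show ?thesis by (simp add: N_def algebra_simps)
    qed
    have "(\<lambda>n. f xb - z \<bullet> xb - d - d * inverse (real (Suc n))) \<longlonglongrightarrow> f xb - z \<bullet> xb - d - d * 0"
      by (intro tendsto_intros LIMSEQ_inverse_real_of_nat)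
    then have "(\<lambda>n. f xb - z \<bullet> xb - d - d / (real n + 1)) \<longlonglongrightarrow> f xb - z \<bullet> xb - d - 0"
      by (simp add: divide_inverse add.commute)
    then have "f xb - z \<bullet> xb - d - 0 \<le> \<psi> z x"
      by (rule LIMSEQ_le_const2) (use bound in auto)
    moreover have "d = c / 2 * (norm (x - xb))\<^sup>2"
      using c by (simp add: d_def z_def power_mult_distrib power2_eq_square)
    moreover have "z \<bullet> x - z \<bullet> xb = c * (norm (x - xb))\<^sup>2"
      unfolding z_def power2_norm_eq_inner by (simp add: algebra_simps)
    ultimately show ?thesis using \<kappa> by (simp add: \<psi>_def c_def algebra_simps add_divide_distrib)
  qed
  \<comment> \<open>The radius leaves room both for \<open>strong\<close> to apply in the whole ball
    and for the shifted parameter \<open>v + s *\<^sub>R (x - xb)\<close> to stay below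
    \<open>\<rho>\<close>.\<close>
  define \<gamma> where "\<gamma> = min \<gamma>0 (\<rho> / (2 * c + 2))"
  have \<gamma>: "\<gamma> > 0" "\<gamma> \<le> \<gamma>0" using \<gamma>0 \<rho> c by (auto simp: \<gamma>_def)
  have "\<gamma> \<le> \<rho> / (2 * c + 2)" by (simp add: \<gamma>_def)
  then have c\<gamma>: "2 * c * \<gamma> + 2 * \<gamma> \<le> \<rho>" using c by (simp add: pos_le_divide_eq algebra_simps)
  have c\<gamma>0: "c * \<gamma> > 0" using c \<gamma> by simp
  \<comment> \<open>Growth puts minimisers within \<open>2 * \<kappa> * norm v\<close>, so
    \<open>2 * \<kappa> * \<beta> < \<gamma>\<close> keeps them off the boundary of the ball, where
    \<open>first_order\<close> would not apply.\<close>
  define \<beta> where "\<beta> = min (\<gamma> / (4 * \<kappa>)) (\<rho> / 2)"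
  have \<beta>: "\<beta> > 0" "\<beta> \<le> \<rho> / 2" "2 * \<kappa> * \<beta> < \<gamma>"
  proof -
    show "\<beta> > 0" "\<beta> \<le> \<rho> / 2" using \<gamma> \<kappa> \<rho> by (auto simp: \<beta>_def)
    have "\<beta> \<le> \<gamma> / (4 * \<kappa>)" by (simp add: \<beta>_def)
    then have "4 * \<kappa> * \<beta> \<le> \<gamma>" using \<kappa> by (simp add: pos_le_divide_eq algebra_simps)
    moreover have "\<kappa> * \<beta> > 0" using \<kappa> \<open>\<beta> > 0\<close> by simp
    ultimately show "2 * \<kappa> * \<beta> < \<gamma>" by (simp add: algebra_simps)
  qed
  have M: "x \<in> S" "norm (x - xb) \<le> 2 * \<kappa> * norm v" "norm (v + s *\<^sub>R (x - xb)) < \<rho>" "x = P (v + s *\<^sub>R (x - xb))"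
    if xM: "x \<in> Mtilt (phi f S) xb \<gamma> v" and v: "norm v < \<beta>" for x v
  proof -
    have x: "x \<in> S" "norm (x - xb) \<le> \<gamma>"
      and xmin: "\<And>y. y \<in> S \<Longrightarrow> norm (y - xb) \<le> \<gamma> \<Longrightarrow> f x - v \<bullet> x \<le> f y - v \<bullet> y"
      using xM mem_Mtilt_phi_iff[OF xb \<gamma>(1)] by auto
    show "x \<in> S" by (rule x(1))
    have "c * norm (x - xb) \<le> c * \<gamma>" using x c by simp
    also have "\<dots> < \<rho>" using c\<gamma> c\<gamma>0 \<gamma> by linarith
    finally have "f xb + 1 / (2 * \<kappa>) * (norm (x - xb))\<^sup>2 \<le> f x"
      using x \<gamma> by (intro strong) (auto simp: dist_norm norm_minus_commute)
    moreover have "f x - v \<bullet> x \<le> f xb - v \<bullet> xb" using xb \<gamma> by (intro xmin) auto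
    ultimately have "1 / (2 * \<kappa>) * (norm (x - xb))\<^sup>2 \<le> v \<bullet> (x - xb)" by (simp add: inner_diff_right)
    also have "\<dots> \<le> norm v * norm (x - xb)" by (rule norm_cauchy_schwarz)
    finally have "norm (x - xb) * norm (x - xb) \<le> (2 * \<kappa> * norm v) * norm (x - xb)"
      using \<kappa> by (simp add: power2_eq_square field_simps)
    then show nx: "norm (x - xb) \<le> 2 * \<kappa> * norm v"
      using \<kappa> by (cases "x = xb") (auto dest: mult_right_le_imp_le)
    have "2 * \<kappa> * norm v \<le> 2 * \<kappa> * \<beta>" using v \<kappa> by simp
    with nx \<beta> have nx\<gamma>: "norm (x - xb) < \<gamma>" by linarith
    have Gx: "G x v" using first_order[of 0 x \<gamma> v] x nx\<gamma> \<gamma> xmin by simp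
    \<comment> \<open>A minimiser for \<open>v\<close> is a stationary point of the proximal problem
      with parameter \<open>z\<close>. Hypomonotonicity and \<open>s > r\<close> leave only one such
      point near \<open>xb\<close>, so it is \<open>P z\<close> and inherits the cocoercivity of
      \<open>P\<close>.\<close>
    define z where "z = v + s *\<^sub>R (x - xb)"
    have "norm z \<le> norm v + s * norm (x - xb)"
      unfolding z_def using norm_triangle_ineq[of v "s *\<^sub>R (x - xb)"] s by simp
    also have "s * norm (x - xb) \<le> c * \<gamma>" using c s x by (intro mult_mono) auto
    also have "norm v + c * \<gamma> < \<rho>" using v \<beta> c\<gamma> \<gamma> by linarith
    finally have nz: "norm z < \<rho>" by simp
    then show "norm (v + s *\<^sub>R (x - xb)) < \<rho>" by (simp add: z_def)
    have "norm v < \<eta>" using v \<beta> \<rho>\<eta> \<rho>(1) by linarith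
    moreover have "norm (x - xb) < \<eta>" using nx\<gamma> c\<gamma> c\<gamma>0 \<rho>\<eta> \<rho>(1) \<gamma> by linarith
    ultimately have "- r * (norm (x - P z))\<^sup>2 \<le> (v - (z - s *\<^sub>R (P z - xb))) \<bullet> (x - P z)"
      using GP[OF nz] Gx by (intro hypo)
    also have "v - (z - s *\<^sub>R (P z - xb)) = - (s *\<^sub>R (x - P z))" by (simp add: z_def algebra_simps)
    also have "- (s *\<^sub>R (x - P z)) \<bullet> (x - P z) = - s * (norm (x - P z))\<^sup>2"
      by (simp add: power2_norm_eq_inner)
    finally have "(s - r) * (norm (x - P z))\<^sup>2 \<le> 0" by (simp add: algebra_simps)
    then have "x = P z" using s(2) by (simp add: mult_le_0_iff)
    then show "x = P (v + s *\<^sub>R (x - xb))" by (simp add: z_def)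
  qed
  have lipM: "norm (x - y) \<le> \<kappa> * norm (v - w)"
    if x: "x \<in> Mtilt (phi f S) xb \<gamma> v" "norm v < \<beta>" and y: "y \<in> Mtilt (phi f S) xb \<gamma> w" "norm w < \<beta>"
    for x y v w
  proof -
    \<comment> \<open>The shift of the parameters contributes exactly \<open>s\<close>, which
      cancels against \<open>c = s + 1 / \<kappa>\<close>.\<close>
    have "c * (norm (x - y))\<^sup>2 \<le> ((v + s *\<^sub>R (x - xb)) - (w + s *\<^sub>R (y - xb))) \<bullet> (x - y)"
      using coc[OF M(3)[OF y] M(3)[OF x]] by (simp add: M(4)[OF x, symmetric] M(4)[OF y, symmetric])
    also have "\<dots> = (v - w) \<bullet> (x - y) + s * (norm (x - y))\<^sup>2"
      unfolding power2_norm_eq_inner by (simp add: algebra_simps)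
    finally have "1 / \<kappa> * (norm (x - y))\<^sup>2 \<le> (v - w) \<bullet> (x - y)" by (simp add: c_def algebra_simps)
    also have "\<dots> \<le> norm (v - w) * norm (x - y)" by (rule norm_cauchy_schwarz)
    finally have "norm (x - y) * norm (x - y) \<le> (\<kappa> * norm (v - w)) * norm (x - y)"
      using \<kappa> by (simp add: power2_eq_square field_simps)
    then show ?thesis using \<kappa> by (cases "x = y") (auto dest: mult_right_le_imp_le)
  qed
  have single: "\<exists>x. Mtilt (phi f S) xb \<gamma> v = {x}" if v: "norm v < \<beta>" for v
  proof -
    have "S \<inter> cball xb \<gamma> = (S \<inter> cball xb \<gamma>0) \<inter> cball xb \<gamma>" using \<gamma> by auto
    then have "compact (S \<inter> cball xb \<gamma>)" using comp by (metis closed_cball compact_Int_closed)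
    moreover have "continuous_on (S \<inter> cball xb \<gamma>) f"
      using cont \<gamma> by (elim continuous_on_subset) auto
    ultimately have "\<exists>x\<in>S \<inter> cball xb \<gamma>. \<forall>y\<in>S \<inter> cball xb \<gamma>. f x - v \<bullet> x \<le> f y - v \<bullet> y"
      using xb \<gamma> by (intro continuous_attains_inf continuous_intros) auto
    then obtain x where "x \<in> S" "norm (x - xb) \<le> \<gamma>"
      "\<And>y. y \<in> S \<Longrightarrow> norm (y - xb) \<le> \<gamma> \<Longrightarrow> f x - v \<bullet> x \<le> f y - v \<bullet> y"
      by (force simp: dist_norm norm_minus_commute)
    then have x: "x \<in> Mtilt (phi f S) xb \<gamma> v" by (simp add: mem_Mtilt_phi_iff[OF xb \<gamma>(1)])
    have "y = x" if "y \<in> Mtilt (phi f S) xb \<gamma> v" for y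
      using lipM[OF that v x v] by simp
    with x show ?thesis by blast
  qed
  show ?thesis unfolding tilt_stable_def
  proof (intro exI[of _ \<gamma>] conjI exI[of _ "ball 0 \<beta>"])
    obtain x where "Mtilt (phi f S) xb \<gamma> 0 = {x}" using single[of 0] \<beta>(1) by auto
    moreover then have "x = xb" using M(2)[of x 0] \<beta>(1) by simp
    ultimately show "Mtilt (phi f S) xb \<gamma> 0 = {xb}" by simp
    show "lip_on (Mtilt (phi f S) xb \<gamma>) (ball 0 \<beta>) \<kappa>"
      unfolding lip_on_def using single lipM by (auto simp: dist_norm)
  qed (use \<gamma> \<beta> in auto)
qed

section \<open>Multipliers under metric subregularity\<close>

lemma bounded_convergent_subseq:
  fixes X :: "nat \<Rightarrow> 'a::heine_borel"
  assumes "bounded (range X)"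
  obtains l r where "strict_mono (r :: nat \<Rightarrow> nat)" "(X \<circ> r) \<longlonglongrightarrow> l"
  using assms bounded_imp_convergent_subsequence by blast

lemma has_derivative_along_sequence:
  fixes h :: "'a::real_normed_vector \<Rightarrow> 'c::real_normed_vector"
  assumes D: "(h has_derivative A) (at x)" and t: "\<And>n::nat. t n > 0" "t \<longlonglongrightarrow> 0" and w: "ws \<longlonglongrightarrow> w"
  shows "(\<lambda>n. (1 / t n) *\<^sub>R (h (x + t n *\<^sub>R ws n) - h x)) \<longlonglongrightarrow> A w"
proof -
  interpret A: bounded_linear A by (rule has_derivative_bounded_linear[OF D])
  define e where "e = (\<lambda>n. h (x + t n *\<^sub>R ws n) - h x - A (t n *\<^sub>R ws n))"
  obtain B where B: "B > 0" "\<And>n. norm (ws n) \<le> B"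
    using convergent_imp_Bseq[OF convergentI[OF w]] by (auto simp: Bseq_def)
  have "(\<lambda>n. t n *\<^sub>R ws n) \<longlonglongrightarrow> 0 *\<^sub>R w" by (intro tendsto_intros t w)
  then have tw: "(\<lambda>n. t n *\<^sub>R ws n) \<longlonglongrightarrow> 0" by simp
  have "(\<lambda>n. (1 / t n) *\<^sub>R e n) \<longlonglongrightarrow> 0"
  proof (rule LIMSEQ_I)
    fix \<epsilon> :: real assume "\<epsilon> > 0"
    then have "\<epsilon> / (2 * B) > 0" using B by simp
    then obtain d where d: "d > 0" "\<And>y. norm (y - x) < d \<Longrightarrow> norm (h y - h x - A (y - x)) \<le> \<epsilon> / (2 * B) * norm (y - x)"
      using D unfolding has_derivative_at_alt by blast
    from tw d(1) obtain N where N: "\<And>n. n \<ge> N \<Longrightarrow> norm (t n *\<^sub>R ws n) < d"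
      by (auto simp: LIMSEQ_iff)
    have "norm ((1 / t n) *\<^sub>R e n) < \<epsilon>" if "n \<ge> N" for n
    proof -
      have "norm (e n) \<le> \<epsilon> / (2 * B) * norm (t n *\<^sub>R ws n)"
        unfolding e_def using d(2)[of "x + t n *\<^sub>R ws n"] N[OF that] by simp
      also have "\<dots> \<le> \<epsilon> / (2 * B) * (t n * B)"
        using B t(1)[of n] \<open>\<epsilon> > 0\<close> by (intro mult_left_mono) auto
      also have "\<dots> = \<epsilon> / 2 * t n" using B by simp
      finally have "norm (e n) / t n \<le> \<epsilon> / 2" unfolding pos_divide_le_eq[OF t(1)] .
      moreover have "norm ((1 / t n) *\<^sub>R e n) = norm (e n) / t n" using t(1)[of n] by simp
      ultimately show ?thesis using \<open>\<epsilon> > 0\<close> by linarith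
    qed
    then show "\<exists>N. \<forall>n\<ge>N. norm ((1 / t n) *\<^sub>R e n - 0) < \<epsilon>" by auto
  qed
  then have "(\<lambda>n. A (ws n) + (1 / t n) *\<^sub>R e n) \<longlonglongrightarrow> A w + 0"
    by (intro tendsto_intros A.tendsto w)
  moreover have "A (ws n) + (1 / t n) *\<^sub>R e n = (1 / t n) *\<^sub>R (h (x + t n *\<^sub>R ws n) - h x)" for n
    using t(1)[of n] by (simp add: e_def A.scaleR scaleR_diff_right)
  ultimately show ?thesis by simp
qed

lemma segment_sequence_in_open:
  fixes x v :: "'a::real_normed_vector"
  assumes "open U" "x \<in> U"
  obtains t where "\<And>n. t n > 0" "t \<longlonglongrightarrow> 0" "\<And>n::nat. x + t n *\<^sub>R v \<in> U"
proof -
  obtain r where r: "r > 0" "ball x r \<subseteq> U" using assms openE by blast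
  define t where "t = (\<lambda>n. r / (norm v + 1) * inverse (real (Suc n)))"
  have "r / (norm v + 1) > 0" using r by (simp add: add_nonneg_pos)
  then have t0: "t n > 0" for n unfolding t_def by (intro mult_pos_pos) auto
  have tlim: "t \<longlonglongrightarrow> 0"
    unfolding t_def by (rule tendsto_mult_right_zero[OF LIMSEQ_inverse_real_of_nat])
  have "x + t n *\<^sub>R v \<in> U" for n
  proof -
    have "t n * norm v < t n * (norm v + 1)" using t0[of n] by simp
    also have "\<dots> = r * inverse (real (Suc n))"
    proof -
      have "norm v + 1 \<noteq> 0" using norm_ge_zero[of v] by linarith
      then show ?thesis by (simp add: t_def)
    qed
    also have "\<dots> \<le> r * 1" using r by (intro mult_left_mono) (auto simp: inverse_le_1_iff)
    finally have "dist x (x + t n *\<^sub>R v) < r" using t0[of n] by (simp add: dist_norm)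
    then show ?thesis using r(2) by auto
  qed
  with t0 tlim show ?thesis by (rule that)
qed

locale soc_program =
  fixes f :: "'a::euclidean_space \<Rightarrow> real" and Df :: "'a \<Rightarrow> 'a \<Rightarrow> real"
    and D2f :: "'a \<Rightarrow> 'a \<Rightarrow> 'a \<Rightarrow> real"
    and g :: "'a \<Rightarrow> real \<times> 'b::euclidean_space" and Dg :: "'a \<Rightarrow> 'a \<Rightarrow> real \<times> 'b"
    and D2g :: "'a \<Rightarrow> 'a \<Rightarrow> 'a \<Rightarrow> real \<times> 'b"
    and xb :: 'a and \<sigma> :: real
  assumes C2f: "C2_near f Df D2f xb"
    and C2g: "C2_near g Dg D2g xb"
    and g_zero: "g xb = 0"
    and sigma_pos: "\<sigma> > 0"
    and mscq: "MSCQ g xb \<sigma>"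
begin

sublocale B2f: bounded_bilinear "D2f xb" by (rule bilinear_C2_near[OF C2f])
sublocale B2g: bounded_bilinear "D2g xb" by (rule bilinear_C2_near[OF C2g])

text \<open>Complementarity and the adjoint equation tested on directions, so that each conjunct
  passes to limits separately.\<close>

definition multiplier :: "'a \<Rightarrow> real \<times> 'b \<Rightarrow> 'a \<Rightarrow> bool" where
  "multiplier x l xs \<longleftrightarrow> g x \<in> SOC \<and> l \<in> SOCdual \<and> l \<bullet> g x = 0 \<and> (\<forall>d. l \<bullet> Dg x d = xs \<bullet> d)"

text \<open>The Frechet subdifferential of \<open>f\<close> plus the indicator of the feasible set.
  Regular normals are enough because the pairs that matter come from minimisers.\<close>

definition subgrad :: "'a \<Rightarrow> 'a \<Rightarrow> bool" where
  "subgrad x v \<longleftrightarrow> v - grad Df x \<in> reg_normal (feas g) x"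

lemma subgrad_feas: "subgrad x v \<Longrightarrow> x \<in> feas g"
  by (auto simp: subgrad_def reg_normal_def split: if_splits)

lemma xb_feas: "xb \<in> feas g"
  by (simp add: feas_def g_zero zero_in_SOC)

definition regular_at :: "'a \<Rightarrow> bool" where
  "regular_at x \<longleftrightarrow> (f has_derivative Df x) (at x) \<and> (g has_derivative Dg x) (at x) \<and>
     (\<forall>d. isCont (\<lambda>y. Df y d) x) \<and> (\<forall>d. isCont (\<lambda>y. Dg y d) x)"

lemma regular_near: obtains r where "r > 0" "\<And>x. x \<in> ball xb r \<Longrightarrow> regular_at x"
proof -
  obtain r1 where "r1 > 0" "\<And>x. x \<in> ball xb r1 \<Longrightarrow> (f has_derivative Df x) (at x)"
    "\<And>x d. x \<in> ball xb r1 \<Longrightarrow> isCont (\<lambda>y. Df y d) x"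
    by (rule C2_near_strict_expansion[OF C2f zero_less_one]) blast
  moreover obtain r2 where "r2 > 0" "\<And>x. x \<in> ball xb r2 \<Longrightarrow> (g has_derivative Dg x) (at x)"
    "\<And>x d. x \<in> ball xb r2 \<Longrightarrow> isCont (\<lambda>y. Dg y d) x"
    by (rule C2_near_strict_expansion[OF C2g zero_less_one]) blast
  ultimately show ?thesis
    by (intro that[of "min r1 r2"]) (auto simp: regular_at_def)
qed

lemma regular_xb: "regular_at xb"
  using regular_near by (metis centre_in_ball)

lemma regular_linear:
  assumes "regular_at x" shows "bounded_linear (Df x)" "bounded_linear (Dg x)"
  using assms by (auto simp: regular_at_def intro: has_derivative_bounded_linear)

lemma grad_inner:
  assumes "regular_at x" shows "grad Df x \<bullet> d = Df x d"
proof -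
  interpret bounded_linear "Df x" by (rule regular_linear(1)[OF assms])
  have "Df x d = Df x (\<Sum>b\<in>Basis. (d \<bullet> b) *\<^sub>R b)" by (simp only: euclidean_representation)
  also have "\<dots> = (\<Sum>b\<in>Basis. (d \<bullet> b) * Df x b)" by (simp add: sum scaleR)
  finally show ?thesis by (simp add: grad_def inner_sum_left inner_commute[of d] mult.commute)
qed

lemma adjJ_inner:
  assumes "regular_at x" shows "adjJ Dg x l \<bullet> d = l \<bullet> Dg x d"
proof -
  interpret bounded_linear "Dg x" by (rule regular_linear(2)[OF assms])
  have "l \<bullet> Dg x d = l \<bullet> Dg x (\<Sum>b\<in>Basis. (d \<bullet> b) *\<^sub>R b)" by (simp only: euclidean_representation)
  also have "\<dots> = (\<Sum>b\<in>Basis. (d \<bullet> b) * (l \<bullet> Dg x b))" by (simp add: sum scaleR inner_sum_right)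
  finally show ?thesis by (simp add: adjJ_def inner_sum_left inner_commute[of d] mult.commute)
qed

lemma adjJ_eq_iff:
  assumes "regular_at x" shows "adjJ Dg x l = xs \<longleftrightarrow> (\<forall>d. l \<bullet> Dg x d = xs \<bullet> d)"
  by (metis adjJ_inner[OF assms] inner_commute vector_eq_ldot)

lemma mem_Lam_iff:
  assumes "regular_at x" shows "l \<in> Lam g Dg x xs \<longleftrightarrow> multiplier x l xs"
  by (auto simp: Lam_def mem_normQ_iff multiplier_def adjJ_eq_iff[OF assms])

lemma isCont_grad:
  assumes "regular_at x" shows "isCont (grad Df) x"
  using assms unfolding regular_at_def grad_def[abs_def] by (intro continuous_intros) auto

lemma isCont_g:
  assumes "regular_at x" shows "isCont g x"
  using assms unfolding regular_at_def by (auto intro: has_derivative_continuous)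

lemma multiplier_limit:
  assumes reg: "regular_at x" and x: "xk \<longlonglongrightarrow> x" and l: "lk \<longlonglongrightarrow> l" and xs: "xsk \<longlonglongrightarrow> xs"
    and m: "\<And>k::nat. multiplier (xk k) (lk k) (xsk k)"
  shows "multiplier x l xs"
proof -
  have gk: "(\<lambda>k. g (xk k)) \<longlonglongrightarrow> g x" using isCont_tendsto_compose[OF isCont_g[OF reg] x] .
  have "g x \<in> SOC" by (rule closed_sequentially[OF closed_SOC _ gk]) (use m multiplier_def in auto)
  moreover have "l \<in> SOCdual" by (rule closed_sequentially[OF closed_SOCdual _ l]) (use m multiplier_def in auto)
  moreover have "l \<bullet> g x = 0"
  proof (rule LIMSEQ_unique)
    show "(\<lambda>k. lk k \<bullet> g (xk k)) \<longlonglongrightarrow> l \<bullet> g x" by (intro tendsto_intros l gk)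
    show "(\<lambda>k. lk k \<bullet> g (xk k)) \<longlonglongrightarrow> 0" using m by (simp add: multiplier_def)
  qed
  moreover have "l \<bullet> Dg x d = xs \<bullet> d" for d
  proof (rule LIMSEQ_unique)
    have "(\<lambda>k. Dg (xk k) d) \<longlonglongrightarrow> Dg x d"
      by (rule isCont_tendsto_compose[OF _ x]) (use reg in \<open>simp add: regular_at_def\<close>)
    then show "(\<lambda>k. lk k \<bullet> Dg (xk k) d) \<longlonglongrightarrow> l \<bullet> Dg x d" by (intro tendsto_intros l)
    have "(\<lambda>k. xsk k \<bullet> d) \<longlonglongrightarrow> xs \<bullet> d" by (intro tendsto_intros xs)
    then show "(\<lambda>k. lk k \<bullet> Dg (xk k) d) \<longlonglongrightarrow> xs \<bullet> d" using m by (simp add: multiplier_def)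
  qed
  ultimately show ?thesis by (simp add: multiplier_def)
qed

lemma mscq_near:
  obtains r where "r > 0"
    "\<And>x e. x \<in> ball xb r \<Longrightarrow> e > 0 \<Longrightarrow> \<exists>y\<in>feas g. dist x y < \<sigma> * infdist (g x) SOC + e"
proof -
  obtain U where U: "open U" "xb \<in> U" "\<And>x. x \<in> U \<Longrightarrow> infdist x (feas g) \<le> \<sigma> * infdist (g x) SOC"
    using mscq unfolding MSCQ_def by blast
  obtain r where r: "r > 0" "ball xb r \<subseteq> U" using U openE by blast
  have "\<exists>y\<in>feas g. dist x y < \<sigma> * infdist (g x) SOC + e" if "x \<in> ball xb r" "e > 0" for x e
  proof (rule ccontr)
    assume "\<not> ?thesis"
    then have "\<sigma> * infdist (g x) SOC + e \<le> infdist x (feas g)"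
      using xb_feas by (subst (2) infdist_notempty) (auto simp: not_less intro!: cINF_greatest)
    with U(3)[of x] r that show False by auto
  qed
  with r show ?thesis by (intro that) auto
qed

text \<open>If \<open>xs\<close> were not the image of a normal of norm at most
  \<open>\<sigma> * norm xs\<close>, a direction \<open>v\<close> would separate it from all such
  images. Moving along \<open>v\<close> and repairing feasibility at the cost granted by metric
  subregularity, where the distance is expressed through dual vectors, produces a bounded normal
  that contradicts the separation.\<close>

lemma mscq_multiplier:
  assumes near: "\<And>y e. y \<in> ball xb r \<Longrightarrow> e > 0 \<Longrightarrow> \<exists>z\<in>feas g. dist y z < \<sigma> * infdist (g y) SOC + e"
    and x: "x \<in> ball xb r" and reg: "regular_at x" and xs: "xs \<in> reg_normal (feas g) x"
  obtains l where "multiplier x l xs" "norm l \<le> \<sigma> * norm xs"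
proof -
  define M where "M = \<sigma> * norm xs"
  have M: "M \<ge> 0" using sigma_pos by (simp add: M_def)
  have xf: "x \<in> feas g" using xs by (auto simp: reg_normal_def split: if_splits)
  then have gS: "g x \<in> SOC" by (simp add: feas_def)
  define N where "N = {l \<in> SOCdual. l \<bullet> g x = 0} \<inter> cball 0 M"
  have "closed {l :: real \<times> 'b. l \<bullet> g x = 0}" by (intro closed_Collect_eq continuous_intros)
  moreover have "convex {l :: real \<times> 'b. l \<bullet> g x = 0}"
    by (auto simp: convex_def inner_add_left)
  moreover have N': "N = SOCdual \<inter> {l. l \<bullet> g x = 0} \<inter> cball 0 M" by (auto simp: N_def)
  ultimately have compN: "compact N" and convN: "convex N"
    by (auto simp: closed_SOCdual convex_SOCdual intro!: closed_Int_compact convex_Int)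
  have linT: "linear (adjJ Dg x)"
    by (rule linearI) (simp_all add: adjJ_def inner_add_left scaleR_add_left sum.distrib scaleR_sum_right)
  have "xs \<in> adjJ Dg x ` N"
  proof (rule ccontr)
    assume "xs \<notin> adjJ Dg x ` N"
    moreover have "compact (adjJ Dg x ` N)"
      by (intro compact_continuous_image compN linear_continuous_on) (simp add: linT linear_conv_bounded_linear[symmetric])
    moreover have "convex (adjJ Dg x ` N)" by (rule convex_linear_image[OF linT convN])
    ultimately obtain a b where ab: "a \<bullet> xs < b" "\<And>y. y \<in> adjJ Dg x ` N \<Longrightarrow> a \<bullet> y > b"
      using separating_hyperplane_closed_point[of "adjJ Dg x ` N" xs] by (metis compact_imp_closed)
    \<comment> \<open>With this sign \<open>v \<bullet> xs\<close> exceeds \<open>- b\<close>, while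
      every admissible image stays below it.\<close>
    define v where "v = - a"
    have sep: "l \<bullet> Dg x v < - b" if "l \<in> N" for l
    proof -
      have "v \<bullet> adjJ Dg x l < - b" using ab(2)[of "adjJ Dg x l"] that by (simp add: v_def)
      then show ?thesis by (simp add: adjJ_inner[OF reg, symmetric] inner_commute)
    qed
    obtain t where t0: "\<And>n. t n > 0" and tlim: "t \<longlonglongrightarrow> 0"
      and inball: "\<And>n::nat. x + t n *\<^sub>R v \<in> ball xb r"
      using segment_sequence_in_open[OF open_ball x] by blast
    define p where "p = (\<lambda>n. g (x + t n *\<^sub>R v))"
    have "\<exists>l. l \<in> SOCdual \<and> norm l \<le> 1 \<and> infdist (p n) SOC = l \<bullet> p n" for n
      by (rule infdist_SOC_dual) blast
    then obtain ll where ll: "\<And>n. ll n \<in> SOCdual" "\<And>n. norm (ll n) \<le> 1" "\<And>n. infdist (p n) SOC = ll n \<bullet> p n"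
      by metis
    \<comment> \<open>The slack \<open>(t n)\<^sup>2\<close> still vanishes after division by
      \<open>t n\<close>.\<close>
    have "\<exists>y\<in>feas g. dist (x + t n *\<^sub>R v) y < \<sigma> * infdist (p n) SOC + (t n)\<^sup>2" for n
      unfolding p_def by (intro near inball) (use t0[of n] in simp)
    then obtain y where y: "\<And>n. y n \<in> feas g" "\<And>n. dist (x + t n *\<^sub>R v) (y n) < \<sigma> * infdist (p n) SOC + (t n)\<^sup>2"
      by metis
    have "bounded (range ll)" using ll(2) by (auto simp: bounded_iff)
    then obtain l0 q where q: "strict_mono (q :: nat \<Rightarrow> nat)" and l0: "(ll \<circ> q) \<longlonglongrightarrow> l0"
      by (rule bounded_convergent_subseq)
    have tq: "(t \<circ> q) \<longlonglongrightarrow> 0" by (rule LIMSEQ_subseq_LIMSEQ[OF tlim q])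
    have diff: "(\<lambda>n. (1 / t (q n)) *\<^sub>R (p (q n) - g x)) \<longlonglongrightarrow> Dg x v"
      unfolding p_def using reg t0 tq
      by (intro has_derivative_along_sequence) (auto simp: regular_at_def o_def)
    have "(\<lambda>n. x + t (q n) *\<^sub>R v) \<longlonglongrightarrow> x + 0 *\<^sub>R v" using tq by (intro tendsto_intros) (simp add: o_def)
    then have pl: "(\<lambda>n. p (q n)) \<longlonglongrightarrow> g x"
      unfolding p_def by (intro isCont_tendsto_compose[OF isCont_g[OF reg]]) simp
    have l0d: "l0 \<in> SOCdual" by (rule closed_sequentially[OF closed_SOCdual _ l0]) (simp add: ll)
    have l0n: "norm l0 \<le> 1" by (rule LIMSEQ_le_const2[OF tendsto_norm[OF l0]]) (simp add: ll)
    have "(\<lambda>n. ll (q n) \<bullet> p (q n)) \<longlonglongrightarrow> l0 \<bullet> g x" using l0 by (intro tendsto_intros pl) (simp add: o_def)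
    then have "0 \<le> l0 \<bullet> g x" by (rule LIMSEQ_le_const) (metis ll(3) infdist_nonneg)
    then have l0g: "l0 \<bullet> g x = 0" using SOC_SOCdual_inner[OF l0d gS] by simp
    \<comment> \<open>The limit of the distance functionals, scaled by \<open>M\<close>, is the
      competing normal that will violate \<open>sep\<close>.\<close>
    have "M *\<^sub>R l0 \<in> N"
    proof -
      have "M * norm (snd l0) \<le> M * (- fst l0)"
        using l0d M unfolding SOCdual_iff by (rule mult_left_mono)
      then show ?thesis using l0g l0n M by (simp add: N_def SOCdual_iff mult_left_le)
    qed
    from sep[OF this] have Mlt: "M * (l0 \<bullet> Dg x v) < - b" by simp
    define c where "c = (\<lambda>n. \<sigma> * (ll (q n) \<bullet> ((1 / t (q n)) *\<^sub>R (p (q n) - g x))) + t (q n))"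
    define c0 where "c0 = \<sigma> * (l0 \<bullet> Dg x v)"
    have "c \<longlonglongrightarrow> \<sigma> * (l0 \<bullet> Dg x v) + 0"
      unfolding c_def using l0 tq by (intro tendsto_intros diff) (simp_all add: o_def)
    then have clim: "c \<longlonglongrightarrow> c0" by (simp add: c0_def)
    define w where "w = (\<lambda>n. (1 / t (q n)) *\<^sub>R (y (q n) - x))"
    have yw: "y (q n) = x + t (q n) *\<^sub>R w n" for n using t0[of "q n"] by (simp add: w_def)
    have wv: "norm (w n - v) \<le> c n" for n
    proof -
      have "ll (q n) \<bullet> p (q n) \<le> ll (q n) \<bullet> (p (q n) - g x)"
        using SOC_SOCdual_inner[OF ll(1) gS, of "q n"] by (simp add: inner_diff_right)
      then have "\<sigma> * infdist (p (q n)) SOC + (t (q n))\<^sup>2 \<le> \<sigma> * (ll (q n) \<bullet> (p (q n) - g x)) + (t (q n))\<^sup>2"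
        using sigma_pos ll(3)[of "q n"] by simp
      also have "\<dots> = t (q n) * c n"
        using t0[of "q n"] by (simp add: c_def power2_eq_square algebra_simps)
      finally have "dist (x + t (q n) *\<^sub>R v) (y (q n)) \<le> t (q n) * c n" using y(2)[of "q n"] by linarith
      moreover have "dist (x + t (q n) *\<^sub>R v) (y (q n)) = t (q n) * norm (w n - v)"
        unfolding yw dist_norm using t0[of "q n"]
        by (simp add: scaleR_diff_right[symmetric] norm_minus_commute)
      ultimately show ?thesis using t0[of "q n"] by simp
    qed
    have ylim: "(\<lambda>n. norm (y (q n) - x)) \<longlonglongrightarrow> 0"
    proof (rule tendsto_sandwich[of "\<lambda>n. 0" _ _ "\<lambda>n. t (q n) * (c n + norm v)"])
      have "norm (y (q n) - x) \<le> t (q n) * (c n + norm v)" for n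
      proof -
        have "norm (w n) \<le> c n + norm v" using wv[of n] norm_triangle_ineq2[of "w n" v] by linarith
        then show ?thesis using t0[of "q n"] by (simp add: yw)
      qed
      then show "\<forall>\<^sub>F n in sequentially. norm (y (q n) - x) \<le> t (q n) * (c n + norm v)" by simp
      have "(\<lambda>n. t (q n) * (c n + norm v)) \<longlonglongrightarrow> 0 * (c0 + norm v)"
        using tq clim by (intro tendsto_intros) (simp_all add: o_def)
      then show "(\<lambda>n. t (q n) * (c n + norm v)) \<longlonglongrightarrow> 0" by simp
    qed auto
    have c0n: "c0 \<ge> 0" using clim by (rule LIMSEQ_le_const) (meson norm_ge_zero order_trans wv)
    \<comment> \<open>Regular normality is tested at the feasible points \<open>x + t w\<close> with
      \<open>w\<close> within \<open>c n\<close> of \<open>v\<close>; replacing \<open>w\<close> by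
      \<open>v\<close> costs \<open>norm xs * c n\<close>, which is the whole bound in the
      limit.\<close>
    have "v \<bullet> xs \<le> norm xs * c0 + \<epsilon>" if "\<epsilon> > 0" for \<epsilon>
    proof -
      define e where "e = \<epsilon> / (c0 + norm v + 1)"
      have e: "e > 0" using that c0n by (simp add: e_def add_nonneg_pos)
      obtain \<delta> where \<delta>: "\<delta> > 0" "\<And>z. z \<in> feas g \<Longrightarrow> norm (z - x) < \<delta> \<Longrightarrow> xs \<bullet> (z - x) \<le> e * norm (z - x)"
        using xs xf e by (auto simp: reg_normal_def)
      have "\<forall>\<^sub>F n in sequentially. norm (y (q n) - x) < \<delta>"
        using order_tendstoD(2)[OF ylim \<delta>(1)] .
      then have "\<forall>\<^sub>F n in sequentially. v \<bullet> xs \<le> norm xs * c n + e * (c n + norm v)"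
      proof eventually_elim
        case (elim n)
        have "xs \<bullet> (y (q n) - x) \<le> e * norm (y (q n) - x)" using elim y(1) by (intro \<delta>(2))
        then have "t (q n) * (xs \<bullet> w n) \<le> t (q n) * (e * norm (w n))"
          using t0[of "q n"] by (simp add: yw mult.left_commute)
        then have "xs \<bullet> w n \<le> e * norm (w n)" using t0[of "q n"] by simp
        also have "\<dots> \<le> e * (c n + norm v)"
          using e wv[of n] norm_triangle_ineq2[of "w n" v] by (intro mult_left_mono) auto
        finally have 1: "xs \<bullet> w n \<le> e * (c n + norm v)" .
        have "xs \<bullet> (v - w n) \<le> norm xs * norm (v - w n)" by (rule norm_cauchy_schwarz)
        also have "\<dots> \<le> norm xs * c n" using wv[of n] by (intro mult_left_mono) (auto simp: norm_minus_commute)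
        finally show ?case using 1 by (simp add: inner_diff_right inner_commute)
      qed
      moreover have "(\<lambda>n. norm xs * c n + e * (c n + norm v)) \<longlonglongrightarrow> norm xs * c0 + e * (c0 + norm v)"
        by (intro tendsto_intros clim)
      ultimately have "v \<bullet> xs \<le> norm xs * c0 + e * (c0 + norm v)"
        by (intro tendsto_lowerbound[of _ _ sequentially]) auto
      also have "e * (c0 + norm v) \<le> e * (c0 + norm v + 1)" using e by (intro mult_left_mono) auto
      also have "e * (c0 + norm v + 1) = \<epsilon>" using c0n by (simp add: e_def add_nonneg_pos[THEN less_imp_neq[symmetric]])
      finally show ?thesis by simp
    qed
    then have "v \<bullet> xs \<le> norm xs * c0" by (rule field_le_epsilon)
    also have "\<dots> = M * (l0 \<bullet> Dg x v)" by (simp add: M_def c0_def)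
    finally show False using Mlt ab(1) by (simp add: v_def)
  qed
  then obtain l where "l \<in> N" "adjJ Dg x l = xs" by blast
  then show ?thesis using gS adjJ_eq_iff[OF reg, of l xs]
    by (intro that[of l]) (auto simp: N_def M_def multiplier_def)
qed


text \<open>Both bounds are kept. The uniform \<open>M\<close> gives compactness and uniform
  remainders; the sharper one forces the limit multiplier to vanish when the gradient of
  \<open>f\<close> at \<open>xb\<close> does, as \<open>Lam0\<close> prescribes.\<close>

lemma subgrad_multiplier:
  obtains \<eta> M where "\<eta> > 0" "M > 0" "\<And>x. x \<in> ball xb \<eta> \<Longrightarrow> regular_at x"
    "\<And>x v. subgrad x v \<Longrightarrow> norm (x - xb) < \<eta> \<Longrightarrow> norm v < \<eta> \<Longrightarrow>
      \<exists>l. multiplier x l (v - grad Df x) \<and> norm l \<le> \<sigma> * norm (v - grad Df x) \<and> norm l \<le> M"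
proof -
  obtain r1 where r1: "r1 > 0" "\<And>x e. x \<in> ball xb r1 \<Longrightarrow> e > 0 \<Longrightarrow> \<exists>y\<in>feas g. dist x y < \<sigma> * infdist (g x) SOC + e"
    using mscq_near by blast
  obtain r2 where r2: "r2 > 0" "\<And>x. x \<in> ball xb r2 \<Longrightarrow> regular_at x" using regular_near by blast
  obtain r3 where r3: "r3 > 0" "\<And>x. norm (x - xb) < r3 \<Longrightarrow> norm (grad Df x - grad Df xb) < 1"
    using isCont_grad[OF regular_xb] unfolding continuous_at_eps_delta dist_norm
    by (meson zero_less_one)
  define \<eta> where "\<eta> = min (min r1 r2) (min r3 1)"
  \<comment> \<open>The 2 allows 1 for the variation of the gradient near \<open>xb\<close> and 1
    for \<open>v\<close>.\<close>
  define M where "M = \<sigma> * (norm (grad Df xb) + 2)"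
  show ?thesis
  proof (rule that[of \<eta> M])
    show "\<eta> > 0" using r1 r2 r3 by (simp add: \<eta>_def)
    show "M > 0" unfolding M_def using sigma_pos by (intro mult_pos_pos) (auto simp: add_nonneg_pos)
    show "regular_at x" if "x \<in> ball xb \<eta>" for x using r2 that by (simp add: \<eta>_def)
    fix x v assume sg: "subgrad x v" and x: "norm (x - xb) < \<eta>" and v: "norm v < \<eta>"
    have "x \<in> ball xb r1" "x \<in> ball xb r2" using x by (auto simp: \<eta>_def dist_norm norm_minus_commute)
    then obtain l where l: "multiplier x l (v - grad Df x)" "norm l \<le> \<sigma> * norm (v - grad Df x)"
      using mscq_multiplier[OF r1(2)] r2(2) sg unfolding subgrad_def by blast
    have "norm (v - grad Df x) \<le> norm v + norm (grad Df xb) + norm (grad Df x - grad Df xb)"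
      using norm_triangle_ineq4[of v "grad Df x"] norm_triangle_ineq[of "grad Df xb" "grad Df x - grad Df xb"] by simp
    also have "\<dots> \<le> norm (grad Df xb) + 2" using r3(2)[of x] x v by (simp add: \<eta>_def)
    finally have "\<sigma> * norm (v - grad Df x) \<le> M" using sigma_pos by (simp add: M_def)
    with l show "\<exists>l. multiplier x l (v - grad Df x) \<and> norm l \<le> \<sigma> * norm (v - grad Df x) \<and> norm l \<le> M"
      by (intro exI[of _ l]) auto
  qed
qed

text \<open>Along a linearised feasible direction the point \<open>xb + t p\<close> violates the
  constraint by o(t), and metric subregularity repairs it by a displacement of order o(t).\<close>

lemma linearized_tangent:
  assumes p: "Dg xb p \<in> SOC" shows "p \<in> tangent_cone (feas g) xb"
proof -
  obtain r where r: "r > 0" "\<And>x e. x \<in> ball xb r \<Longrightarrow> e > 0 \<Longrightarrow> \<exists>y\<in>feas g. dist x y < \<sigma> * infdist (g x) SOC + e"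
    using mscq_near by blast
  obtain t where t0: "\<And>n. t n > 0" and tlim: "t \<longlonglongrightarrow> 0"
    and inball: "\<And>n::nat. xb + t n *\<^sub>R p \<in> ball xb r"
    using segment_sequence_in_open[OF open_ball, of xb xb r p] r(1) by auto
  have "\<exists>y\<in>feas g. dist (xb + t n *\<^sub>R p) y < \<sigma> * infdist (g (xb + t n *\<^sub>R p)) SOC + (t n)\<^sup>2" for n
    by (intro r(2) inball) (use t0[of n] in simp)
  then obtain y where y: "\<And>n. y n \<in> feas g"
    "\<And>n. dist (xb + t n *\<^sub>R p) (y n) < \<sigma> * infdist (g (xb + t n *\<^sub>R p)) SOC + (t n)\<^sup>2" by metis
  define vs where "vs = (\<lambda>n. (1 / t n) *\<^sub>R (y n - xb))"
  have yv: "y n = xb + t n *\<^sub>R vs n" for n using t0[of n] by (simp add: vs_def)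
  define c where "c = (\<lambda>n. \<sigma> * norm ((1 / t n) *\<^sub>R (g (xb + t n *\<^sub>R p) - g xb) - Dg xb p) + t n)"
  have "(\<lambda>n. (1 / t n) *\<^sub>R (g (xb + t n *\<^sub>R p) - g xb)) \<longlonglongrightarrow> Dg xb p"
    using regular_xb by (intro has_derivative_along_sequence t0 tlim tendsto_const) (simp add: regular_at_def)
  then have "c \<longlonglongrightarrow> \<sigma> * norm (Dg xb p - Dg xb p) + 0"
    unfolding c_def by (intro tendsto_intros tlim)
  then have clim: "c \<longlonglongrightarrow> 0" by simp
  have bound: "norm (vs n - p) \<le> c n" for n
  proof -
    have "infdist (g (xb + t n *\<^sub>R p)) SOC \<le> dist (g (xb + t n *\<^sub>R p)) (t n *\<^sub>R Dg xb p)"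
      using t0[of n] p by (intro infdist_le SOC_scaleR) auto
    also have "\<dots> = t n * norm ((1 / t n) *\<^sub>R (g (xb + t n *\<^sub>R p) - g xb) - Dg xb p)"
    proof -
      have "g (xb + t n *\<^sub>R p) - t n *\<^sub>R Dg xb p = t n *\<^sub>R ((1 / t n) *\<^sub>R (g (xb + t n *\<^sub>R p) - g xb) - Dg xb p)"
        using t0[of n] by (simp add: g_zero scaleR_diff_right)
      then show ?thesis unfolding dist_norm using t0[of n] by simp
    qed
    finally have "\<sigma> * infdist (g (xb + t n *\<^sub>R p)) SOC + (t n)\<^sup>2 \<le> t n * c n"
      using mult_left_mono[of _ _ \<sigma>] sigma_pos by (simp add: c_def power2_eq_square algebra_simps)
    then have "dist (xb + t n *\<^sub>R p) (y n) \<le> t n * c n" using y(2)[of n] by linarith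
    moreover have "dist (xb + t n *\<^sub>R p) (y n) = t n * norm (vs n - p)"
      unfolding yv dist_norm using t0[of n] by (simp add: scaleR_diff_right[symmetric] norm_minus_commute)
    ultimately show ?thesis using t0[of n] by simp
  qed
  have "(\<lambda>n. norm (vs n - p)) \<longlonglongrightarrow> 0"
    by (rule tendsto_sandwich[OF _ _ tendsto_const clim]) (use bound in auto)
  then have "vs \<longlonglongrightarrow> p" by (simp add: LIM_zero_iff tendsto_norm_zero_iff)
  then show ?thesis unfolding tangent_cone_def using t0 tlim y(1) yv by auto
qed

text \<open>The working form of the hypothesis on the critical cone. Every blow-up argument below
  yields a unit vector \<open>Dg xb p\<close> that this lemma excludes.\<close>

lemma critical_range_zero:
  assumes K_null: "\<forall>u\<in>crit_cone (feas g) xb (- grad Df xb). Dg xb u = 0"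
    and l: "multiplier xb l (- grad Df xb)" and p: "Dg xb p \<in> SOC" "l \<bullet> Dg xb p = 0"
  shows "Dg xb p = 0"
proof -
  have "- grad Df xb \<bullet> p = 0" using l p(2) by (simp add: multiplier_def)
  then show ?thesis using K_null linearized_tangent[OF p(1)] by (simp add: crit_cone_def)
qed

text \<open>The limiting normal is approached by regular normals at nearby points; their multipliers
  are bounded by \<open>mscq_multiplier\<close> and so have a limit point.\<close>

lemma stationary_multiplier:
  assumes "- grad Df xb \<in> lim_normal (feas g) xb"
  obtains l where "multiplier xb l (- grad Df xb)"
proof -
  obtain xk xsk where k: "\<And>k::nat. xsk k \<in> reg_normal (feas g) (xk k)" "xk \<longlonglongrightarrow> xb" "xsk \<longlonglongrightarrow> - grad Df xb"
    using assms by (auto simp: lim_normal_def split: if_splits)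
  obtain r1 where r1: "r1 > 0" "\<And>x e. x \<in> ball xb r1 \<Longrightarrow> e > 0 \<Longrightarrow> \<exists>y\<in>feas g. dist x y < \<sigma> * infdist (g x) SOC + e"
    using mscq_near by blast
  obtain r2 where r2: "r2 > 0" "\<And>x. x \<in> ball xb r2 \<Longrightarrow> regular_at x" using regular_near by blast
  obtain N where N: "\<And>n. n \<ge> N \<Longrightarrow> dist (xk n) xb < min r1 r2"
    using k(2) r1(1) r2(1) unfolding lim_sequentially by (meson min_less_iff_conj)
  have "\<exists>l. multiplier (xk (k + N)) l (xsk (k + N)) \<and> norm l \<le> \<sigma> * norm (xsk (k + N))" for k
  proof -
    have "xk (k + N) \<in> ball xb r1" "xk (k + N) \<in> ball xb r2" using N[of "k + N"] by (auto simp: dist_commute)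
    then show ?thesis using mscq_multiplier[OF r1(2) _ r2(2) k(1)[of "k + N"]] by blast
  qed
  then obtain lk where lk: "\<And>k. multiplier (xk (k + N)) (lk k) (xsk (k + N))"
    "\<And>k. norm (lk k) \<le> \<sigma> * norm (xsk (k + N))" by metis
  obtain B where B: "\<And>n. norm (xsk n) \<le> B"
    using convergent_imp_Bseq[OF convergentI[OF k(3)]] by (auto simp: Bseq_def)
  have "norm (lk k) \<le> \<sigma> * B" for k
    using lk(2)[of k] B[of "k + N"] sigma_pos by (meson mult_left_mono order_trans less_imp_le)
  then have "bounded (range lk)" by (auto simp: bounded_iff)
  then obtain l q where q: "strict_mono (q :: nat \<Rightarrow> nat)" and l: "(lk \<circ> q) \<longlonglongrightarrow> l"
    by (rule bounded_convergent_subseq)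
  have "multiplier xb l (- grad Df xb)"
  proof (rule multiplier_limit[OF regular_xb _ l])
    show "(\<lambda>k. xk (q k + N)) \<longlonglongrightarrow> xb" using LIMSEQ_subseq_LIMSEQ[OF LIMSEQ_ignore_initial_segment[OF k(2), of N] q] by (simp add: o_def)
    show "(\<lambda>k. xsk (q k + N)) \<longlonglongrightarrow> - grad Df xb" using LIMSEQ_subseq_LIMSEQ[OF LIMSEQ_ignore_initial_segment[OF k(3), of N] q] by (simp add: o_def)
    show "multiplier (xk (q k + N)) ((lk \<circ> q) k) (xsk (q k + N))" for k using lk(1) by simp
  qed
  then show ?thesis by (rule that)
qed

section \<open>Two-point estimates and first-order conditions for subgradients\<close>

lemma multiplier_monotone:
  assumes "multiplier x l xs" "multiplier y m ys"
  shows "0 \<le> (m - l) \<bullet> (g y - g x)" "(m - l) \<bullet> (g y - g x) = - (l \<bullet> g y) - m \<bullet> g x"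
proof -
  have "l \<bullet> g y \<le> 0" "m \<bullet> g x \<le> 0" using assms by (auto simp: multiplier_def intro: SOC_SOCdual_inner)
  moreover show "(m - l) \<bullet> (g y - g x) = - (l \<bullet> g y) - m \<bullet> g x"
    using assms by (simp add: multiplier_def inner_diff_left inner_diff_right)
  ultimately show "0 \<le> (m - l) \<bullet> (g y - g x)" by simp
qed

text \<open>\<open>g\<close> is expanded from \<open>x\<close> with weight \<open>l\<close> and from
  \<open>y\<close> with weight \<open>m\<close>. The first-order terms then collapse into the gap
  \<open>(m - l) \<bullet> (g y - g x)\<close>, kept exactly because it carries the curvature of the
  cone, and the Hessian appears with the mean multiplier.\<close>

lemma subgrad_two_point:
  assumes e: "\<epsilon> > 0" and M: "M > 0"
  obtains \<delta> where "\<delta> > 0"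
    "\<And>x y v w l m. \<lbrakk>x \<in> ball xb \<delta>; y \<in> ball xb \<delta>; multiplier x l (v - grad Df x);
        multiplier y m (w - grad Df y); norm l \<le> M; norm m \<le> M\<rbrakk> \<Longrightarrow>
      D2f xb (y - x) (y - x) + 1/2 * ((l + m) \<bullet> D2g xb (y - x) (y - x)) + (m - l) \<bullet> (g y - g x)
        - \<epsilon> * (norm (y - x))\<^sup>2 \<le> (w - v) \<bullet> (y - x)"
proof -
  \<comment> \<open>The two remainders of \<open>g\<close> have weights bounded by \<open>M\<close>
    and share half of \<open>\<epsilon>\<close>; the other half is spent on
    \<open>f\<close>.\<close>
  define e' where "e' = \<epsilon> / (2 * (2 * M))"
  have e': "e' > 0" using e M by (simp add: e'_def)
  obtain d1 where d1: "d1 > 0" and f1: "\<And>x y d. x \<in> ball xb d1 \<Longrightarrow> y \<in> ball xb d1 \<Longrightarrow>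
        norm (Df y d - Df x d - D2f xb (y - x) d) \<le> (\<epsilon> / 2) * norm (y - x) * norm d"
    by (rule C2_near_strict_expansion[OF C2f half_gt_zero[OF e]]) blast
  obtain d2 where d2: "d2 > 0" and g2: "\<And>x y. x \<in> ball xb d2 \<Longrightarrow> y \<in> ball xb d2 \<Longrightarrow>
        norm (g y - g x - Dg x (y - x) - (1/2) *\<^sub>R D2g xb (y - x) (y - x)) \<le> e' * (norm (y - x))\<^sup>2"
    by (rule C2_near_strict_expansion[OF C2g e']) blast
  obtain d3 where d3: "d3 > 0" "\<And>x. x \<in> ball xb d3 \<Longrightarrow> regular_at x" using regular_near by blast
  define \<delta> where "\<delta> = min d1 (min d2 d3)"
  show ?thesis
  proof (rule that[of \<delta>])
    show "\<delta> > 0" using d1 d2 d3 by (simp add: \<delta>_def)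
    fix x y v w l m
    assume x: "x \<in> ball xb \<delta>" and y: "y \<in> ball xb \<delta>" and l: "multiplier x l (v - grad Df x)"
      and m: "multiplier y m (w - grad Df y)" and nl: "norm l \<le> M" and nm: "norm m \<le> M"
    define s where "s = y - x"
    have reg: "regular_at x" "regular_at y" using x y d3 by (auto simp: \<delta>_def)
    interpret Dy: bounded_linear "Dg y" by (rule regular_linear(2)[OF reg(2)])
    define E1 where "E1 = g y - g x - Dg x s - (1/2) *\<^sub>R D2g xb s s"
    define E2 where "E2 = g x - g y + Dg y s - (1/2) *\<^sub>R D2g xb s s"
    have E1: "norm E1 \<le> e' * (norm s)\<^sup>2" using g2[of x y] x y by (simp add: E1_def s_def \<delta>_def)
    have "norm (g x - g y - Dg y (- s) - (1/2) *\<^sub>R D2g xb (- s) (- s)) \<le> e' * (norm (- s))\<^sup>2"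
      using g2[of y x] x y by (simp add: s_def \<delta>_def)
    then have E2: "norm E2 \<le> e' * (norm s)\<^sup>2"
      by (simp add: E2_def Dy.neg B2g.minus_left B2g.minus_right)
    have "norm (Df y s - Df x s - D2f xb s s) \<le> (\<epsilon> / 2) * norm s * norm s"
      using f1[of x y s] x y by (simp add: s_def \<delta>_def)
    then have F: "D2f xb s s - \<epsilon> / 2 * (norm s)\<^sup>2 \<le> Df y s - Df x s"
      unfolding real_norm_def power2_eq_square mult.assoc by linarith
    have "(w - v) \<bullet> s = (Df y s - Df x s) + (m \<bullet> Dg y s - l \<bullet> Dg x s)"
      using l m by (simp add: multiplier_def grad_inner[OF reg(1), symmetric] grad_inner[OF reg(2), symmetric] inner_diff_left)
    also have "m \<bullet> Dg y s - l \<bullet> Dg x s = (m - l) \<bullet> (g y - g x) + 1/2 * ((l + m) \<bullet> D2g xb s s) + (m \<bullet> E2 + l \<bullet> E1)"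
      by (simp add: E1_def E2_def algebra_simps inner_add_left inner_add_right inner_diff_left inner_diff_right)
    finally have *: "(w - v) \<bullet> s = (Df y s - Df x s) + ((m - l) \<bullet> (g y - g x) + 1/2 * ((l + m) \<bullet> D2g xb s s) + (m \<bullet> E2 + l \<bullet> E1))" .
    have "\<bar>m \<bullet> E2\<bar> \<le> M * (e' * (norm s)\<^sup>2)" "\<bar>l \<bullet> E1\<bar> \<le> M * (e' * (norm s)\<^sup>2)"
      using nm nl E1 E2 M by (auto intro!: order_trans[OF Cauchy_Schwarz_ineq2] mult_mono)
    moreover have "M * (e' * (norm s)\<^sup>2) + M * (e' * (norm s)\<^sup>2) = \<epsilon> / 2 * (norm s)\<^sup>2"
      using M by (simp add: e'_def)
    ultimately show "D2f xb (y - x) (y - x) + 1/2 * ((l + m) \<bullet> D2g xb (y - x) (y - x)) + (m - l) \<bullet> (g y - g x)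
        - \<epsilon> * (norm (y - x))\<^sup>2 \<le> (w - v) \<bullet> (y - x)"
      using * F unfolding s_def[symmetric] by linarith
  qed
qed

text \<open>The gap in the two-point estimate is nonnegative, so only the bounded Hessian terms and
  the error can be negative.\<close>

lemma subgrad_hypomonotone:
  obtains \<eta> r where "\<eta> > 0"
    "\<And>x v y w. \<lbrakk>subgrad x v; subgrad y w; norm (x - xb) < \<eta>; norm v < \<eta>; norm (y - xb) < \<eta>; norm w < \<eta>\<rbrakk>
        \<Longrightarrow> - r * (norm (y - x))\<^sup>2 \<le> (w - v) \<bullet> (y - x)"
proof -
  obtain \<eta> M where \<eta>: "\<eta> > 0" and M: "M > 0"
    and "\<And>x. x \<in> ball xb \<eta> \<Longrightarrow> regular_at x"
    and mult: "\<And>x v. subgrad x v \<Longrightarrow> norm (x - xb) < \<eta> \<Longrightarrow> norm v < \<eta> \<Longrightarrow>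
      \<exists>l. multiplier x l (v - grad Df x) \<and> norm l \<le> \<sigma> * norm (v - grad Df x) \<and> norm l \<le> M"
    by (rule subgrad_multiplier) (rule that)
  obtain \<delta> where \<delta>: "\<delta> > 0" and two: "\<And>x y v w l m. \<lbrakk>x \<in> ball xb \<delta>; y \<in> ball xb \<delta>; multiplier x l (v - grad Df x);
        multiplier y m (w - grad Df y); norm l \<le> M; norm m \<le> M\<rbrakk> \<Longrightarrow>
      D2f xb (y - x) (y - x) + 1/2 * ((l + m) \<bullet> D2g xb (y - x) (y - x)) + (m - l) \<bullet> (g y - g x)
        - 1 * (norm (y - x))\<^sup>2 \<le> (w - v) \<bullet> (y - x)"
    by (rule subgrad_two_point[OF zero_less_one M]) (rule that)
  obtain Kf where Kf: "\<And>a b. norm (D2f xb a b) \<le> norm a * norm b * Kf" using B2f.bounded by blast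
  obtain Kg where Kg: "\<And>a b. norm (D2g xb a b) \<le> norm a * norm b * Kg" using B2g.bounded by blast
  show ?thesis
  proof (rule that[of "min \<eta> \<delta>" "Kf + M * Kg + 1"])
    show "min \<eta> \<delta> > 0" using \<eta> \<delta> by simp
    fix x v y w
    assume a: "subgrad x v" "subgrad y w" "norm (x - xb) < min \<eta> \<delta>" "norm v < min \<eta> \<delta>"
      "norm (y - xb) < min \<eta> \<delta>" "norm w < min \<eta> \<delta>"
    obtain l where l: "multiplier x l (v - grad Df x)" "norm l \<le> M" using mult[OF a(1)] a by auto
    obtain m where m: "multiplier y m (w - grad Df y)" "norm m \<le> M" using mult[OF a(2)] a by auto
    define s where "s = y - x"
    have "D2f xb s s + 1/2 * ((l + m) \<bullet> D2g xb s s) + (m - l) \<bullet> (g y - g x) - 1 * (norm s)\<^sup>2 \<le> (w - v) \<bullet> s"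
      unfolding s_def by (intro two l m) (use a in \<open>auto simp: dist_norm norm_minus_commute\<close>)
    moreover have "0 \<le> (m - l) \<bullet> (g y - g x)" by (rule multiplier_monotone[OF l(1) m(1)])
    moreover have "\<bar>D2f xb s s\<bar> \<le> Kf * (norm s)\<^sup>2" using Kf[of s s] by (simp add: power2_eq_square mult.commute)
    moreover have "\<bar>(l + m) \<bullet> D2g xb s s\<bar> \<le> 2 * (M * Kg * (norm s)\<^sup>2)"
    proof -
      have "\<bar>(l + m) \<bullet> D2g xb s s\<bar> \<le> norm (l + m) * norm (D2g xb s s)" by (rule Cauchy_Schwarz_ineq2)
      also have "\<dots> \<le> (2 * M) * (norm s * norm s * Kg)"
        using l(2) m(2) norm_triangle_ineq[of l m] Kg[of s s] M by (intro mult_mono) auto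
      finally show ?thesis by (simp add: power2_eq_square algebra_simps)
    qed
    ultimately show "- (Kf + M * Kg + 1) * (norm (y - x))\<^sup>2 \<le> (w - v) \<bullet> (y - x)"
      unfolding s_def[symmetric] abs_le_iff by (simp add: algebra_simps)
  qed
qed

text \<open>The Lagrangian with multiplier \<open>l\<close> is stationary at \<open>xb\<close>,
  equals \<open>f\<close> there, and is at most \<open>f\<close> on the feasible set, since
  \<open>l\<close> is in the polar cone.\<close>

lemma quadratic_lower_bound:
  assumes l: "multiplier xb l (- grad Df xb)"
  obtains \<delta> C where "\<delta> > 0"
    "\<And>x. x \<in> feas g \<Longrightarrow> norm (x - xb) < \<delta> \<Longrightarrow> f xb - C * (norm (x - xb))\<^sup>2 \<le> f x"
proof -
  obtain d1 where d1: "d1 > 0" and f1: "\<And>x y. x \<in> ball xb d1 \<Longrightarrow> y \<in> ball xb d1 \<Longrightarrow>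
        norm (f y - f x - Df x (y - x) - (1/2) *\<^sub>R D2f xb (y - x) (y - x)) \<le> 1 * (norm (y - x))\<^sup>2"
    by (rule C2_near_strict_expansion[OF C2f zero_less_one]) blast
  obtain d2 where d2: "d2 > 0" and g2: "\<And>x y. x \<in> ball xb d2 \<Longrightarrow> y \<in> ball xb d2 \<Longrightarrow>
        norm (g y - g x - Dg x (y - x) - (1/2) *\<^sub>R D2g xb (y - x) (y - x)) \<le> 1 * (norm (y - x))\<^sup>2"
    by (rule C2_near_strict_expansion[OF C2g zero_less_one]) blast
  obtain Kf where Kf: "\<And>a b. norm (D2f xb a b) \<le> norm a * norm b * Kf" using B2f.bounded by blast
  obtain Kg where Kg: "\<And>a b. norm (D2g xb a b) \<le> norm a * norm b * Kg" using B2g.bounded by blast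
  show ?thesis
  proof (rule that[of "min d1 d2" "Kf / 2 + norm l * Kg / 2 + 1 + norm l"])
    show "min d1 d2 > 0" using d1 d2 by simp
    fix x assume x: "x \<in> feas g" "norm (x - xb) < min d1 d2"
    define s where "s = x - xb"
    have "norm (f x - f xb - Df xb s - (1/2) *\<^sub>R D2f xb s s) \<le> 1 * (norm s)\<^sup>2"
      using f1[of xb x] x d1 by (simp add: s_def dist_norm norm_minus_commute)
    then have F: "Df xb s + 1/2 * D2f xb s s - (norm s)\<^sup>2 \<le> f x - f xb" by (simp add: abs_le_iff)
    define E where "E = g x - Dg xb s - (1/2) *\<^sub>R D2g xb s s"
    have "norm (g x - g xb - Dg xb s - (1/2) *\<^sub>R D2g xb s s) \<le> 1 * (norm s)\<^sup>2"
      using g2[of xb x] x d2 by (simp add: s_def dist_norm norm_minus_commute)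
    then have E: "norm E \<le> (norm s)\<^sup>2" by (simp add: E_def g_zero)
    have "\<bar>l \<bullet> E\<bar> \<le> norm l * (norm s)\<^sup>2"
      using E by (auto intro!: order_trans[OF Cauchy_Schwarz_ineq2] mult_left_mono)
    moreover have "\<bar>l \<bullet> D2g xb s s\<bar> \<le> norm l * (norm s * norm s * Kg)"
      using Kg[of s s] by (auto intro!: order_trans[OF Cauchy_Schwarz_ineq2] mult_left_mono)
    moreover have "Df xb s = - (l \<bullet> Dg xb s)"
      using l by (simp add: multiplier_def grad_inner[OF regular_xb, symmetric])
    moreover have "l \<bullet> Dg xb s = l \<bullet> g x - 1/2 * (l \<bullet> D2g xb s s) - l \<bullet> E"
      by (simp add: E_def inner_diff_right)
    moreover have "l \<bullet> g x \<le> 0" using l x by (auto simp: multiplier_def feas_def intro: SOC_SOCdual_inner)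
    moreover have "\<bar>D2f xb s s\<bar> \<le> norm s * norm s * Kf" using Kf[of s s] by simp
    ultimately have "- (norm l * (norm s * norm s * Kg)) / 2 - norm l * (norm s)\<^sup>2 - norm s * norm s * Kf / 2 - (norm s)\<^sup>2 \<le> f x - f xb"
      using F by linarith
    then show "f xb - (Kf / 2 + norm l * Kg / 2 + 1 + norm l) * (norm (x - xb))\<^sup>2 \<le> f x"
      unfolding s_def[symmetric] by (simp add: power2_eq_square algebra_simps)
  qed
qed

lemma local_minimizer_subgrad:
  assumes reg: "regular_at x" and s: "0 \<le> s" and x: "x \<in> feas g" "norm (x - xb) < \<gamma>"
    and min: "\<And>y. y \<in> feas g \<Longrightarrow> norm (y - xb) \<le> \<gamma> \<Longrightarrow>
      f x + s/2 * (norm (x - xb))\<^sup>2 - v \<bullet> x \<le> f y + s/2 * (norm (y - xb))\<^sup>2 - v \<bullet> y"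
  shows "subgrad x (v - s *\<^sub>R (x - xb))"
proof -
  have "\<exists>\<delta>>0. \<forall>y\<in>feas g. norm (y - x) < \<delta> \<longrightarrow>
      (v - s *\<^sub>R (x - xb) - grad Df x) \<bullet> (y - x) \<le> \<epsilon> * norm (y - x)" if e: "\<epsilon> > 0" for \<epsilon>
  proof -
    obtain d where d: "d > 0" "\<And>y. norm (y - x) < d \<Longrightarrow> norm (f y - f x - Df x (y - x)) \<le> \<epsilon> / 2 * norm (y - x)"
      using reg half_gt_zero[OF e] unfolding regular_at_def has_derivative_at_alt by blast
    \<comment> \<open>The three bounds serve the differentiability of \<open>f\<close>, membership
      of \<open>y\<close> in the ball of the minimisation, and the absorption of
      \<open>s/2 * (norm (y - x))\<^sup>2\<close> into the linear error.\<close>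
    define \<delta> where "\<delta> = min d (min (\<gamma> - norm (x - xb)) (\<epsilon> / (s + 1)))"
    have \<delta>: "\<delta> > 0" using d x s e by (simp add: \<delta>_def)
    have "(v - s *\<^sub>R (x - xb) - grad Df x) \<bullet> (y - x) \<le> \<epsilon> * norm (y - x)"
      if y: "y \<in> feas g" "norm (y - x) < \<delta>" for y
    proof -
      have "norm (y - xb) \<le> norm (y - x) + norm (x - xb)" using norm_triangle_ineq[of "y - x" "x - xb"] by simp
      also have "\<dots> \<le> \<gamma>" using y by (simp add: \<delta>_def)
      finally have 1: "f x + s/2 * (norm (x - xb))\<^sup>2 - v \<bullet> x \<le> f y + s/2 * (norm (y - xb))\<^sup>2 - v \<bullet> y"
        by (rule min[OF y(1)])
      have "(norm (y - xb))\<^sup>2 = (norm (x - xb))\<^sup>2 + 2 * ((x - xb) \<bullet> (y - x)) + (norm (y - x))\<^sup>2"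
        unfolding power2_norm_eq_inner by (simp add: algebra_simps inner_commute)
      then have 2: "s/2 * (norm (y - xb))\<^sup>2 = s/2 * (norm (x - xb))\<^sup>2 + s * ((x - xb) \<bullet> (y - x)) + s/2 * (norm (y - x))\<^sup>2"
        by (simp only:) (simp add: distrib_left)
      have 3: "f y - f x - grad Df x \<bullet> (y - x) \<le> \<epsilon> / 2 * norm (y - x)"
        using d(2)[of y] y abs_ge_self[of "f y - f x - Df x (y - x)"]
        unfolding grad_inner[OF reg] \<delta>_def by simp
      have "norm (y - x) \<le> \<epsilon> / (s + 1)" using y by (simp add: \<delta>_def)
      then have "norm (y - x) * s + norm (y - x) \<le> \<epsilon>" using s by (simp add: pos_le_divide_eq algebra_simps)
      then have "norm (y - x) * s \<le> \<epsilon>" using norm_ge_zero[of "y - x"] by linarith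
      then have "(norm (y - x) * s) * norm (y - x) \<le> \<epsilon> * norm (y - x)" by (rule mult_right_mono) simp
      then have 4: "s/2 * (norm (y - x))\<^sup>2 \<le> \<epsilon> / 2 * norm (y - x)" by (simp add: power2_eq_square algebra_simps)
      have "(v - s *\<^sub>R (x - xb) - grad Df x) \<bullet> (y - x) = v \<bullet> y - v \<bullet> x - s * ((x - xb) \<bullet> (y - x)) - grad Df x \<bullet> (y - x)"
        by (simp add: inner_diff_left inner_diff_right algebra_simps)
      then show ?thesis using 1 2 3 4 by linarith
    qed
    with \<delta> show ?thesis by blast
  qed
  then show ?thesis using x(1) by (simp add: subgrad_def reg_normal_def)
qed

lemma compact_feas_near:
  assumes "\<And>x. x \<in> cball xb \<gamma> \<Longrightarrow> regular_at x"
  shows "compact (feas g \<inter> cball xb \<gamma>)" "continuous_on (feas g \<inter> cball xb \<gamma>) f"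
proof -
  have "continuous_on (cball xb \<gamma>) g"
    using assms isCont_g by (intro continuous_at_imp_continuous_on) auto
  then have "closed (cball xb \<gamma> \<inter> g -` SOC)"
    by (intro continuous_closed_preimage closed_SOC closed_cball)
  moreover have "feas g \<inter> cball xb \<gamma> = cball xb \<gamma> \<inter> (cball xb \<gamma> \<inter> g -` SOC)" by (auto simp: feas_def)
  ultimately show "compact (feas g \<inter> cball xb \<gamma>)" by (metis compact_Int_closed compact_cball)
  show "continuous_on (feas g \<inter> cball xb \<gamma>) f"
    using assms unfolding regular_at_def
    by (intro continuous_at_imp_continuous_on ballI) (auto intro: has_derivative_continuous)
qed

end

section \<open>Second-order limits\<close>

lemma tendsto_reindex:
  assumes "X \<longlonglongrightarrow> L" "filterlim r sequentially sequentially"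
  shows "(\<lambda>n. X (r n)) \<longlonglongrightarrow> L"
  using filterlim_compose[OF assms] .

text \<open>The preimages \<open>p n\<close> may diverge, so only their images are controlled. If
  the \<open>a n\<close> are bounded, closedness of the range supplies a new preimage
  \<open>z\<close> of the limit; if not, normalisation removes \<open>b\<close> and leaves a unit
  vector of the range, to be excluded by \<open>unbounded\<close>.\<close>

lemma affine_range_subseq:
  fixes A :: "'a::euclidean_space \<Rightarrow> 'c::euclidean_space"
  assumes A: "bounded_linear A" and a: "\<And>n::nat. a n = A (p n) + b n" and b: "b \<longlonglongrightarrow> b0"
    and unbounded: "\<And>r q. filterlim r sequentially sequentially \<Longrightarrow>
      filterlim (\<lambda>n::nat. norm (a (r n))) at_top sequentially \<Longrightarrow>
      (\<lambda>n. (1 / norm (a (r n))) *\<^sub>R a (r n)) \<longlonglongrightarrow> A q \<Longrightarrow> norm (A q) = 1 \<Longrightarrow> False"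
  obtains r z where "strict_mono (r :: nat \<Rightarrow> nat)" "(\<lambda>n. a (r n)) \<longlonglongrightarrow> A z + b0"
proof -
  interpret A: bounded_linear A by (rule A)
  have closed: "closed (range A)"
    by (intro closed_subspace linear_subspace_image A.linear_axioms subspace_UNIV)
  show ?thesis
  proof (cases "bounded (range a)")
    case True
    then obtain l r where r: "strict_mono (r :: nat \<Rightarrow> nat)" and l: "(a \<circ> r) \<longlonglongrightarrow> l"
      by (rule bounded_convergent_subseq)
    have "(\<lambda>n. a (r n) - b (r n)) \<longlonglongrightarrow> l - b0"
      using l LIMSEQ_subseq_LIMSEQ[OF b r] by (intro tendsto_diff) (simp_all add: o_def)
    then have "l - b0 \<in> range A" by (rule closed_sequentially[OF closed, rotated]) (simp add: a)
    then obtain z where "l - b0 = A z" by blast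
    then have "l = A z + b0" by (simp add: algebra_simps)
    with l r show ?thesis by (intro that[of r z]) (simp_all add: o_def)
  next
    case False
    \<comment> \<open>Exceeding the sum of the first norms forces the chosen index to be larger than
      \<open>n\<close>, so the indices tend to infinity although they need not increase.\<close>
    have "\<exists>k. real n + (\<Sum>j\<le>n. norm (a j)) < norm (a k)" for n
    proof (rule ccontr)
      assume "\<not> ?thesis"
      then have "norm (a k) \<le> real n + (\<Sum>j\<le>n. norm (a j))" for k by (meson not_less)
      then have "bounded (range a)" by (auto simp: bounded_iff)
      with False show False by blast
    qed
    then obtain k where k: "\<And>n. real n + (\<Sum>j\<le>n. norm (a j)) < norm (a (k n))" by metis
    have kn: "n \<le> k n" for n
    proof (rule ccontr)
      assume "\<not> n \<le> k n"
      then have "norm (a (k n)) \<le> (\<Sum>j\<le>n. norm (a j))" by (intro member_le_sum) auto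
      with k[of n] show False by linarith
    qed
    have knorm: "real n \<le> norm (a (k n))" for n
      using k[of n] sum_nonneg[of "{..n}" "\<lambda>j. norm (a j)"] by simp
    have kinf: "filterlim k sequentially sequentially"
      using filterlim_at_top_mono[OF filterlim_ident] kn by (metis always_eventually)
    have kninf: "filterlim (\<lambda>n. norm (a (k n))) at_top sequentially"
      by (rule filterlim_at_top_mono[OF filterlim_real_sequentially]) (simp add: knorm)
    define X where "X = (\<lambda>n. (1 / norm (a (k n))) *\<^sub>R a (k n))"
    have "norm (X n) \<le> 1" for n by (simp add: X_def)
    then have "bounded (range X)" by (auto simp: bounded_iff)
    then obtain l s where s: "strict_mono (s :: nat \<Rightarrow> nat)" and l: "(X \<circ> s) \<longlonglongrightarrow> l"
      by (rule bounded_convergent_subseq)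
    define r where "r = (\<lambda>n. k (s n))"
    have sinf: "filterlim s sequentially sequentially" by (rule filterlim_subseq[OF s])
    have rinf: "filterlim r sequentially sequentially"
      unfolding r_def by (rule filterlim_compose[OF kinf sinf])
    have rninf: "filterlim (\<lambda>n. norm (a (r n))) at_top sequentially"
      unfolding r_def by (rule filterlim_compose[OF kninf sinf])
    have Xl: "(\<lambda>n. (1 / norm (a (r n))) *\<^sub>R a (r n)) \<longlonglongrightarrow> l" using l by (simp add: X_def r_def o_def)
    have inv: "(\<lambda>n. 1 / norm (a (r n))) \<longlonglongrightarrow> 0"
      using tendsto_inverse_0_at_top[OF rninf] by (simp add: divide_inverse)
    have "(\<lambda>n. (1 / norm (a (r n))) *\<^sub>R a (r n) - (1 / norm (a (r n))) *\<^sub>R b (r n)) \<longlonglongrightarrow> l - 0 *\<^sub>R b0"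
      by (intro tendsto_intros Xl inv tendsto_reindex[OF b rinf])
    moreover have "(1 / norm (a (r n))) *\<^sub>R a (r n) - (1 / norm (a (r n))) *\<^sub>R b (r n) = A ((1 / norm (a (r n))) *\<^sub>R p (r n))" for n
      by (simp add: a[of "r n"] A.scaleR scaleR_diff_right[symmetric] del: scaleR_diff_right)
    ultimately have "(\<lambda>n. A ((1 / norm (a (r n))) *\<^sub>R p (r n))) \<longlonglongrightarrow> l" by simp
    then have "l \<in> range A" by (rule closed_sequentially[OF closed, rotated]) auto
    then obtain q where q: "l = A q" by blast
    have "\<forall>\<^sub>F n in sequentially. 0 < norm (a (r n))"
      using rninf unfolding filterlim_at_top_dense by blast
    then have "\<forall>\<^sub>F n in sequentially. norm ((1 / norm (a (r n))) *\<^sub>R a (r n)) = 1"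
      by eventually_elim simp
    then have "(\<lambda>n. norm ((1 / norm (a (r n))) *\<^sub>R a (r n))) \<longlonglongrightarrow> 1" by (rule tendsto_eventually)
    with tendsto_norm[OF Xl] have "norm l = 1" using LIMSEQ_unique by blast
    then show ?thesis using unbounded[OF rinf rninf] Xl q by blast
  qed
qed

lemma lorentz_scaleR: "lorentz (c *\<^sub>R d) = c\<^sup>2 * lorentz d"
  by (simp add: power_mult_distrib algebra_simps)

lemma tendsto_lorentz: "X \<longlonglongrightarrow> d \<Longrightarrow> (\<lambda>n. lorentz (X n)) \<longlonglongrightarrow> lorentz d"
  by (intro tendsto_intros)

context soc_program
begin

lemma second_order_quotient:
  assumes y: "y \<longlonglongrightarrow> xb" "\<And>k::nat. y k \<noteq> xb" and v: "(\<lambda>k. (1 / norm (y k - xb)) *\<^sub>R (y k - xb)) \<longlonglongrightarrow> v"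
  shows "(\<lambda>k. (1 / (norm (y k - xb))\<^sup>2) *\<^sub>R (g (y k) - Dg xb (y k - xb))) \<longlonglongrightarrow> (1/2) *\<^sub>R D2g xb v v"
proof -
  define t where "t = (\<lambda>k. norm (y k - xb))"
  define vk where "vk = (\<lambda>k. (1 / t k) *\<^sub>R (y k - xb))"
  have t0: "t k > 0" for k using y(2)[of k] by (simp add: t_def)
  have yv: "y k - xb = t k *\<^sub>R vk k" for k using t0[of k] by (simp add: vk_def)
  define E where "E = (\<lambda>k. (1 / (t k)\<^sup>2) *\<^sub>R (g (y k) - Dg xb (y k - xb)) - (1/2) *\<^sub>R D2g xb (vk k) (vk k))"
  have "E \<longlonglongrightarrow> 0"
  proof (rule LIMSEQ_I)
    fix \<epsilon> :: real assume e: "\<epsilon> > 0"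
    obtain d where d: "d > 0" "\<And>x y. x \<in> ball xb d \<Longrightarrow> y \<in> ball xb d \<Longrightarrow>
        norm (g y - g x - Dg x (y - x) - (1/2) *\<^sub>R D2g xb (y - x) (y - x)) \<le> (\<epsilon> / 2) * (norm (y - x))\<^sup>2"
      by (rule C2_near_strict_expansion[OF C2g half_gt_zero[OF e]]) blast
    obtain N where N: "\<And>k. k \<ge> N \<Longrightarrow> dist (y k) xb < d"
      using y(1) d(1) unfolding lim_sequentially by blast
    have "norm (E k - 0) < \<epsilon>" if "k \<ge> N" for k
    proof -
      have "D2g xb (y k - xb) (y k - xb) = (t k)\<^sup>2 *\<^sub>R D2g xb (vk k) (vk k)"
        unfolding yv by (simp add: B2g.scaleR_left B2g.scaleR_right power2_eq_square)
      then have "E k = (1 / (t k)\<^sup>2) *\<^sub>R (g (y k) - g xb - Dg xb (y k - xb) - (1/2) *\<^sub>R D2g xb (y k - xb) (y k - xb))"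
        using t0[of k] by (simp add: E_def g_zero scaleR_diff_right)
      then have "norm (E k) = (1 / (t k)\<^sup>2) * norm (g (y k) - g xb - Dg xb (y k - xb) - (1/2) *\<^sub>R D2g xb (y k - xb) (y k - xb))"
        by simp
      also have "\<dots> \<le> (1 / (t k)\<^sup>2) * ((\<epsilon> / 2) * (norm (y k - xb))\<^sup>2)"
        using d(1) N[OF that] by (intro mult_left_mono d(2)) (auto simp: dist_commute)
      also have "\<dots> = \<epsilon> / 2" using t0[of k] by (simp add: t_def)
      finally show ?thesis using e by simp
    qed
    then show "\<exists>N. \<forall>k\<ge>N. norm (E k - 0) < \<epsilon>" by blast
  qed
  moreover have "(\<lambda>k. (1/2) *\<^sub>R D2g xb (vk k) (vk k)) \<longlonglongrightarrow> (1/2) *\<^sub>R D2g xb v v"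
    using v by (intro tendsto_intros B2g.tendsto) (simp_all add: vk_def t_def)
  ultimately have "(\<lambda>k. E k + (1/2) *\<^sub>R D2g xb (vk k) (vk k)) \<longlonglongrightarrow> 0 + (1/2) *\<^sub>R D2g xb v v"
    by (rule tendsto_add)
  then show ?thesis by (simp add: E_def t_def)
qed

lemma derivative_quotient:
  assumes y: "y \<longlonglongrightarrow> xb" "\<And>k::nat. y k \<noteq> xb" and v: "(\<lambda>k. (1 / norm (y k - xb)) *\<^sub>R (y k - xb)) \<longlonglongrightarrow> v"
    and d: "dk \<longlonglongrightarrow> d"
  shows "(\<lambda>k. (1 / norm (y k - xb)) *\<^sub>R (Dg (y k) (dk k) - Dg xb (dk k))) \<longlonglongrightarrow> D2g xb v d"
proof -
  define t where "t = (\<lambda>k. norm (y k - xb))"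
  define vk where "vk = (\<lambda>k. (1 / t k) *\<^sub>R (y k - xb))"
  have t0: "t k > 0" for k using y(2)[of k] by (simp add: t_def)
  have yv: "y k - xb = t k *\<^sub>R vk k" for k using t0[of k] by (simp add: vk_def)
  define E where "E = (\<lambda>k. (1 / t k) *\<^sub>R (Dg (y k) (dk k) - Dg xb (dk k)) - D2g xb (vk k) (dk k))"
  obtain B where B: "B > 0" "\<And>n. norm (dk n) \<le> B"
    using convergent_imp_Bseq[OF convergentI[OF d]] by (auto simp: Bseq_def)
  have "E \<longlonglongrightarrow> 0"
  proof (rule LIMSEQ_I)
    fix \<epsilon> :: real assume e: "\<epsilon> > 0"
    then have e': "\<epsilon> / (2 * B) > 0" using B by simp
    obtain r where r: "r > 0" "\<And>x y d. x \<in> ball xb r \<Longrightarrow> y \<in> ball xb r \<Longrightarrow>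
        norm (Dg y d - Dg x d - D2g xb (y - x) d) \<le> (\<epsilon> / (2 * B)) * norm (y - x) * norm d"
      by (rule C2_near_strict_expansion[OF C2g e']) blast
    obtain N where N: "\<And>k. k \<ge> N \<Longrightarrow> dist (y k) xb < r"
      using y(1) r(1) unfolding lim_sequentially by blast
    have "norm (E k - 0) < \<epsilon>" if "k \<ge> N" for k
    proof -
      have "D2g xb (y k - xb) (dk k) = t k *\<^sub>R D2g xb (vk k) (dk k)"
        unfolding yv by (simp add: B2g.scaleR_left)
      then have "E k = (1 / t k) *\<^sub>R (Dg (y k) (dk k) - Dg xb (dk k) - D2g xb (y k - xb) (dk k))"
        using t0[of k] by (simp add: E_def scaleR_diff_right)
      then have "norm (E k) = (1 / t k) * norm (Dg (y k) (dk k) - Dg xb (dk k) - D2g xb (y k - xb) (dk k))"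
        using t0[of k] by simp
      also have "\<dots> \<le> (1 / t k) * ((\<epsilon> / (2 * B)) * norm (y k - xb) * norm (dk k))"
        using r(1) N[OF that] t0[of k] by (intro mult_left_mono r(2)) (auto simp: dist_commute)
      also have "\<dots> \<le> (1 / t k) * ((\<epsilon> / (2 * B)) * norm (y k - xb) * B)"
        using B e t0[of k] by (intro mult_left_mono mult_nonneg_nonneg) auto
      also have "\<dots> = \<epsilon> / 2" using t0[of k] B by (simp add: t_def)
      finally show ?thesis using e by simp
    qed
    then show "\<exists>N. \<forall>k\<ge>N. norm (E k - 0) < \<epsilon>" by blast
  qed
  moreover have "(\<lambda>k. D2g xb (vk k) (dk k)) \<longlonglongrightarrow> D2g xb v d"
    using v d by (intro B2g.tendsto) (simp_all add: vk_def t_def)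
  ultimately have "(\<lambda>k. E k + D2g xb (vk k) (dk k)) \<longlonglongrightarrow> 0 + D2g xb v d"
    by (rule tendsto_add)
  then show ?thesis by (simp add: E_def t_def)
qed

text \<open>Any limit direction of \<open>g (y k)\<close> lies in the cone, in the range of \<open>Dg xb\<close> and in the
  orthogonal complement of \<open>\<mu>\<close>, hence vanishes; this is why \<open>g (y k)\<close> is of second order in
  \<open>y k - xb\<close>.\<close>
lemma second_order_limit:
  assumes K_null: "\<forall>u\<in>crit_cone (feas g) xb (- grad Df xb). Dg xb u = 0"
    and \<mu>: "multiplier xb \<mu> (- grad Df xb)"
    and y: "y \<longlonglongrightarrow> xb" "\<And>k::nat. y k \<noteq> xb" and v: "(\<lambda>k. (1 / norm (y k - xb)) *\<^sub>R (y k - xb)) \<longlonglongrightarrow> v"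
    and m: "m \<longlonglongrightarrow> \<mu>" "\<And>k. g (y k) \<in> SOC" "\<And>k. m k \<bullet> g (y k) = 0"
  obtains r w where "strict_mono (r :: nat \<Rightarrow> nat)" "Dg xb v = 0"
    "(\<lambda>k. (1 / (norm (y (r k) - xb))\<^sup>2) *\<^sub>R g (y (r k))) \<longlonglongrightarrow> Dg xb w + (1/2) *\<^sub>R D2g xb v v"
    "Dg xb w + (1/2) *\<^sub>R D2g xb v v \<in> SOC" "\<mu> \<bullet> (Dg xb w + (1/2) *\<^sub>R D2g xb v v) = 0"
proof -
  interpret A: bounded_linear "Dg xb" by (rule regular_linear(2)[OF regular_xb])
  define t where "t = (\<lambda>k. norm (y k - xb))"
  define vk where "vk = (\<lambda>k. (1 / t k) *\<^sub>R (y k - xb))"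
  have t0: "t k > 0" for k using y(2)[of k] by (simp add: t_def)
  have yv: "y k = xb + t k *\<^sub>R vk k" for k using t0[of k] by (simp add: vk_def)
  have "(\<lambda>k. y k - xb) \<longlonglongrightarrow> xb - xb" by (intro tendsto_intros y)
  then have tlim: "t \<longlonglongrightarrow> 0" unfolding t_def using tendsto_norm_zero by fastforce
  have vlim: "vk \<longlonglongrightarrow> v" using v by (simp add: vk_def t_def)
  have "(\<lambda>k. (1 / t k) *\<^sub>R (g (xb + t k *\<^sub>R vk k) - g xb)) \<longlonglongrightarrow> Dg xb v"
    using regular_xb by (intro has_derivative_along_sequence t0 tlim vlim) (simp add: regular_at_def)
  then have gq: "(\<lambda>k. (1 / t k) *\<^sub>R g (y k)) \<longlonglongrightarrow> Dg xb v" by (simp add: yv[symmetric] g_zero)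
  have "Dg xb v \<in> SOC"
    by (rule closed_sequentially[OF closed_SOC _ gq]) (use t0 m(2) in \<open>auto intro!: SOC_scaleR simp: less_imp_le\<close>)
  moreover have "\<mu> \<bullet> Dg xb v = 0"
  proof (rule LIMSEQ_unique)
    show "(\<lambda>k. m k \<bullet> ((1 / t k) *\<^sub>R g (y k))) \<longlonglongrightarrow> \<mu> \<bullet> Dg xb v" by (intro tendsto_intros m gq)
    show "(\<lambda>k. m k \<bullet> ((1 / t k) *\<^sub>R g (y k))) \<longlonglongrightarrow> 0" by (simp add: m(3))
  qed
  ultimately have Av: "Dg xb v = 0" by (rule critical_range_zero[OF K_null \<mu>])
  define a where "a = (\<lambda>k. (1 / (t k)\<^sup>2) *\<^sub>R g (y k))"
  have aS: "a k \<in> SOC" for k unfolding a_def by (intro SOC_scaleR m(2)) simp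
  have am: "m k \<bullet> a k = 0" for k by (simp add: a_def m(3))
  \<comment> \<open>The argument of \<open>Dg xb\<close> here need not converge; \<open>w\<close> is
    found only as a preimage of the limit.\<close>
  have "a k = Dg xb ((1 / (t k)\<^sup>2) *\<^sub>R (y k - xb)) + (1 / (t k)\<^sup>2) *\<^sub>R (g (y k) - Dg xb (y k - xb))" for k
    unfolding A.scaleR by (simp add: a_def scaleR_diff_right)
  then obtain r w where r: "strict_mono (r :: nat \<Rightarrow> nat)"
    and lim: "(\<lambda>k. a (r k)) \<longlonglongrightarrow> Dg xb w + (1/2) *\<^sub>R D2g xb v v"
  proof (rule affine_range_subseq[OF A.bounded_linear_axioms])
    show "(\<lambda>k. (1 / (t k)\<^sup>2) *\<^sub>R (g (y k) - Dg xb (y k - xb))) \<longlonglongrightarrow> (1/2) *\<^sub>R D2g xb v v"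
      unfolding t_def by (rule second_order_quotient[OF y v])
    fix r q assume r: "filterlim r sequentially sequentially"
      and l: "(\<lambda>n::nat. (1 / norm (a (r n))) *\<^sub>R a (r n)) \<longlonglongrightarrow> Dg xb q" and n1: "norm (Dg xb q) = 1"
    have "Dg xb q \<in> SOC" by (rule closed_sequentially[OF closed_SOC _ l]) (auto intro!: SOC_scaleR aS)
    moreover have "\<mu> \<bullet> Dg xb q = 0"
    proof (rule LIMSEQ_unique)
      show "(\<lambda>n. m (r n) \<bullet> ((1 / norm (a (r n))) *\<^sub>R a (r n))) \<longlonglongrightarrow> \<mu> \<bullet> Dg xb q"
        by (intro tendsto_intros tendsto_reindex[OF m(1) r] l)
      show "(\<lambda>n. m (r n) \<bullet> ((1 / norm (a (r n))) *\<^sub>R a (r n))) \<longlonglongrightarrow> 0" by (simp add: am)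
    qed
    ultimately have "Dg xb q = 0" by (rule critical_range_zero[OF K_null \<mu>])
    with n1 show False by simp
  qed
  have "Dg xb w + (1/2) *\<^sub>R D2g xb v v \<in> SOC"
    by (rule closed_sequentially[OF closed_SOC _ lim]) (rule aS)
  moreover have "\<mu> \<bullet> (Dg xb w + (1/2) *\<^sub>R D2g xb v v) = 0"
  proof (rule LIMSEQ_unique)
    show "(\<lambda>n. m (r n) \<bullet> a (r n)) \<longlonglongrightarrow> \<mu> \<bullet> (Dg xb w + (1/2) *\<^sub>R D2g xb v v)"
      by (intro tendsto_inner tendsto_reindex[OF m(1) filterlim_subseq[OF r]] lim)
    show "(\<lambda>n. m (r n) \<bullet> a (r n)) \<longlonglongrightarrow> 0" by (simp add: am)
  qed
  ultimately show ?thesis using that[of r w] r Av lim by (simp add: a_def t_def)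
qed


text \<open>The two signs come from the two ends: \<open>l\<close> is normal at \<open>x\<close> and
  nonpositive at the moving points, while \<open>m n\<close> is normal at the moving points and
  nonpositive at \<open>x\<close>.\<close>

lemma tangent_inner_zero:
  assumes l: "l \<in> SOCdual" "l \<bullet> g x = 0" and reg: "regular_at x" and x: "g x \<in> SOC"
    and t: "\<And>n::nat. t n > 0" "t \<longlonglongrightarrow> 0" and u: "us \<longlonglongrightarrow> u" and m: "m \<longlonglongrightarrow> l"
    and y: "\<And>n. g (x + t n *\<^sub>R us n) \<in> SOC" "\<And>n. m n \<in> SOCdual" "\<And>n. m n \<bullet> g (x + t n *\<^sub>R us n) = 0"
  shows "l \<bullet> Dg x u = 0"
proof (rule antisym)
  have q: "(\<lambda>n. (1 / t n) *\<^sub>R (g (x + t n *\<^sub>R us n) - g x)) \<longlonglongrightarrow> Dg x u"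
    using reg by (intro has_derivative_along_sequence t u) (simp add: regular_at_def)
  have "(\<lambda>n. l \<bullet> ((1 / t n) *\<^sub>R (g (x + t n *\<^sub>R us n) - g x))) \<longlonglongrightarrow> l \<bullet> Dg x u"
    by (intro tendsto_intros q)
  moreover have "l \<bullet> ((1 / t n) *\<^sub>R (g (x + t n *\<^sub>R us n) - g x)) \<le> 0" for n
    using SOC_SOCdual_inner[OF l(1) y(1), of n] l(2) t(1)[of n]
    by (simp add: inner_diff_right divide_nonpos_pos)
  ultimately show "l \<bullet> Dg x u \<le> 0" by (intro LIMSEQ_le_const2) auto
  have "(\<lambda>n. m n \<bullet> ((1 / t n) *\<^sub>R (g (x + t n *\<^sub>R us n) - g x))) \<longlonglongrightarrow> l \<bullet> Dg x u"
    by (intro tendsto_intros q m)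
  moreover have "0 \<le> m n \<bullet> ((1 / t n) *\<^sub>R (g (x + t n *\<^sub>R us n) - g x))" for n
    using SOC_SOCdual_inner[OF y(2) x, of n] y(3)[of n] t(1)[of n]
    by (simp add: inner_diff_right divide_nonpos_pos)
  ultimately show "0 \<le> l \<bullet> Dg x u" by (intro LIMSEQ_le_const) auto
qed

text \<open>Nonzero multipliers at nonzero values live on the boundary and are multiples of
  \<open>hatq\<close>, so the gap is a sum of two null-vector products. As \<open>y\<close> tends to
  \<open>x\<close> the coefficient tends to that of \<open>curvQ\<close>.\<close>

lemma multiplier_gap_curvature:
  assumes l: "multiplier x l xs" "l \<noteq> 0" "g x \<noteq> 0" and m: "multiplier y m ys" "m \<noteq> 0" "g y \<noteq> 0"
  shows "(m - l) \<bullet> (g y - g x) = (- fst l / fst (g x) - fst m / fst (g y)) / 2 * lorentz (g y - g x)"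
proof -
  have l': "l \<in> SOCdual" "g x \<in> SOC" "l \<bullet> g x = 0" and m': "m \<in> SOCdual" "g y \<in> SOC" "m \<bullet> g y = 0"
    using l m by (auto simp: multiplier_def)
  have bx: "norm (snd (g x)) = fst (g x)" by (rule SOC_complementary_frontier(1)[OF l' l(3,2)])
  have by': "norm (snd (g y)) = fst (g y)" by (rule SOC_complementary_frontier(1)[OF m' m(3,2)])
  define L where "L = lorentz (g y - g x)"
  have L': "lorentz (g x - g y) = L" by (simp add: L_def norm_minus_commute power2_commute)
  have "l \<bullet> g y = (- fst l / fst (g x)) * (hatq (g x) \<bullet> g y)"
    by (subst SOC_complementary[OF l' l(3)]) simp
  moreover have "m \<bullet> g x = (- fst m / fst (g y)) * (hatq (g y) \<bullet> g x)"
    by (subst SOC_complementary[OF m' m(3)]) simp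
  ultimately show ?thesis
    unfolding multiplier_monotone(2)[OF l(1) m(1)] inner_hatq_frontier[OF bx by'] inner_hatq_frontier[OF by' bx]
      L_def[symmetric] L' by (simp add: field_simps)
qed

text \<open>Here \<open>x\<close> is fixed and the violating pairs approach it. The curvature
  estimate is multiplied by \<open>fst (g x)\<close>, which makes it meaningful also at the apex.
  One approximating \<open>y\<close> with its multiplier is returned as well: when
  \<open>x = xb\<close>, second-order information can only be read off from such points.\<close>

lemma nonmonotone_limit:
  assumes e: "\<epsilon> > 0"
  obtains \<eta> where "\<eta> > 0"
    "\<And>x v. \<lbrakk>subgrad x v; norm (x - xb) < \<eta>; norm v < \<eta>;
       \<forall>\<delta>>0. \<exists>y w. subgrad y w \<and> norm (y - x) < \<delta> \<and> norm (w - v) < \<delta> \<and>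
          (w - v) \<bullet> (y - x) < c * (norm (y - x))\<^sup>2\<rbrakk> \<Longrightarrow>
     \<exists>l u y m. norm u = 1 \<and> multiplier x l (v - grad Df x) \<and> norm l \<le> \<sigma> * norm (v - grad Df x) \<and>
       l \<bullet> Dg x u = 0 \<and> D2f xb u u + l \<bullet> D2g xb u u \<le> c + \<epsilon> \<and>
       - fst l * lorentz (Dg x u) \<le> (c + \<epsilon> - (D2f xb u u + l \<bullet> D2g xb u u)) * fst (g x) \<and>
       y \<noteq> x \<and> norm (y - x) < \<epsilon> \<and> norm (m - l) < \<epsilon> \<and> g y \<in> SOC \<and> m \<bullet> g y = 0 \<and>
       norm ((1 / norm (y - x)) *\<^sub>R (y - x) - u) < \<epsilon>"
proof -
  obtain \<eta>1 M where \<eta>1: "\<eta>1 > 0" and M: "M > 0" and regular: "\<And>x. x \<in> ball xb \<eta>1 \<Longrightarrow> regular_at x"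
    and mult: "\<And>x v. subgrad x v \<Longrightarrow> norm (x - xb) < \<eta>1 \<Longrightarrow> norm v < \<eta>1 \<Longrightarrow>
      \<exists>l. multiplier x l (v - grad Df x) \<and> norm l \<le> \<sigma> * norm (v - grad Df x) \<and> norm l \<le> M"
    by (rule subgrad_multiplier) (rule that)
  obtain \<delta>1 where \<delta>1: "\<delta>1 > 0" and two: "\<And>x y v w l m. \<lbrakk>x \<in> ball xb \<delta>1; y \<in> ball xb \<delta>1; multiplier x l (v - grad Df x);
        multiplier y m (w - grad Df y); norm l \<le> M; norm m \<le> M\<rbrakk> \<Longrightarrow>
      D2f xb (y - x) (y - x) + 1/2 * ((l + m) \<bullet> D2g xb (y - x) (y - x)) + (m - l) \<bullet> (g y - g x)
        - \<epsilon> * (norm (y - x))\<^sup>2 \<le> (w - v) \<bullet> (y - x)"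
    by (rule subgrad_two_point[OF e M]) (rule that)
  define \<eta> where "\<eta> = min \<eta>1 \<delta>1"
  show ?thesis
  proof (rule that[of \<eta>])
    show "\<eta> > 0" using \<eta>1 \<delta>1 by (simp add: \<eta>_def)
    fix x v
    assume sg: "subgrad x v" and x: "norm (x - xb) < \<eta>" and v: "norm v < \<eta>"
      and viol: "\<forall>\<delta>>0. \<exists>y w. subgrad y w \<and> norm (y - x) < \<delta> \<and> norm (w - v) < \<delta> \<and>
          (w - v) \<bullet> (y - x) < c * (norm (y - x))\<^sup>2"
    have reg: "regular_at x" using regular[of x] x by (simp add: \<eta>_def dist_norm norm_minus_commute)
    have gx: "g x \<in> SOC" using subgrad_feas[OF sg] by (simp add: feas_def)
    define \<delta> where "\<delta> = (\<lambda>j. min (inverse (real (Suc j))) (min (\<eta> - norm (x - xb)) (\<eta> - norm v)))"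
    have "\<delta> j > 0" for j using x v by (simp add: \<delta>_def)
    then have "\<exists>y w. subgrad y w \<and> norm (y - x) < \<delta> j \<and> norm (w - v) < \<delta> j \<and>
          (w - v) \<bullet> (y - x) < c * (norm (y - x))\<^sup>2" for j using viol by blast
    then obtain y w where yw: "\<And>j. subgrad (y j) (w j)" "\<And>j. norm (y j - x) < \<delta> j" "\<And>j. norm (w j - v) < \<delta> j"
      "\<And>j. (w j - v) \<bullet> (y j - x) < c * (norm (y j - x))\<^sup>2" by metis
    have yx: "y j \<noteq> x" for j using yw(4)[of j] by auto
    have yn: "norm (y j - xb) < \<eta>" for j
      using yw(2)[of j] norm_triangle_ineq[of "y j - x" "x - xb"] by (simp add: \<delta>_def)
    have wn: "norm (w j) < \<eta>" for j
      using yw(3)[of j] norm_triangle_ineq[of "w j - v" v] by (simp add: \<delta>_def)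
    have "\<exists>l. multiplier (y j) l (w j - grad Df (y j)) \<and> norm l \<le> \<sigma> * norm (w j - grad Df (y j)) \<and> norm l \<le> M" for j
      using yn[of j] wn[of j] by (intro mult yw) (auto simp: \<eta>_def)
    then obtain m where m: "\<And>j. multiplier (y j) (m j) (w j - grad Df (y j))"
      "\<And>j. norm (m j) \<le> \<sigma> * norm (w j - grad Df (y j))" "\<And>j. norm (m j) \<le> M" by metis
    define us where "us = (\<lambda>j. (1 / norm (y j - x)) *\<^sub>R (y j - x))"
    have us1: "norm (us j) = 1" for j using yx[of j] by (simp add: us_def)
    have "norm (us j, m j) \<le> 1 + M" for j
      using norm_Pair_le[of "us j" "m j"] us1[of j] m(3)[of j] by linarith
    then have "bounded (range (\<lambda>j. (us j, m j)))" by (auto simp: bounded_iff)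
    then obtain ul q where q: "strict_mono (q :: nat \<Rightarrow> nat)" and ul: "((\<lambda>j. (us j, m j)) \<circ> q) \<longlonglongrightarrow> ul"
      by (rule bounded_convergent_subseq)
    define u where "u = fst ul"
    define l where "l = snd ul"
    have ulim: "(\<lambda>j. us (q j)) \<longlonglongrightarrow> u" using tendsto_fst[OF ul] by (simp add: u_def o_def)
    have mlim: "(\<lambda>j. m (q j)) \<longlonglongrightarrow> l" using tendsto_snd[OF ul] by (simp add: l_def o_def)
    define t where "t = (\<lambda>j. norm (y (q j) - x))"
    have t0: "t j > 0" for j using yx[of "q j"] by (simp add: t_def)
    have inv: "(\<lambda>j. inverse (real (Suc (q j)))) \<longlonglongrightarrow> 0"
      using LIMSEQ_subseq_LIMSEQ[OF LIMSEQ_inverse_real_of_nat q] by (simp add: o_def)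
    have tlim: "t \<longlonglongrightarrow> 0"
      by (rule tendsto_sandwich[OF _ _ tendsto_const inv])
         (use yw(2) in \<open>auto simp: t_def \<delta>_def less_imp_le\<close>)
    have "(\<lambda>j. norm (w (q j) - v)) \<longlonglongrightarrow> 0"
      by (rule tendsto_sandwich[OF _ _ tendsto_const inv])
         (use yw(3) in \<open>auto simp: \<delta>_def less_imp_le\<close>)
    then have wlim: "(\<lambda>j. w (q j)) \<longlonglongrightarrow> v" by (simp add: LIM_zero_iff tendsto_norm_zero_iff)
    have ylim: "(\<lambda>j. y (q j)) \<longlonglongrightarrow> x" using tlim unfolding t_def by (simp add: LIM_zero_iff tendsto_norm_zero_iff)
    have yt: "y (q j) = x + t j *\<^sub>R us (q j)" for j using t0[of j] by (simp add: us_def t_def)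
    have xslim: "(\<lambda>j. w (q j) - grad Df (y (q j))) \<longlonglongrightarrow> v - grad Df x"
      by (intro tendsto_diff wlim isCont_tendsto_compose[OF isCont_grad[OF reg] ylim])
    have l: "multiplier x l (v - grad Df x)"
      by (rule multiplier_limit[OF reg ylim mlim xslim m(1)])
    have lM: "norm l \<le> M" by (rule LIMSEQ_le_const2[OF tendsto_norm[OF mlim]]) (simp add: m)
    have ln: "norm l \<le> \<sigma> * norm (v - grad Df x)"
      by (rule LIMSEQ_le[OF tendsto_norm[OF mlim] tendsto_mult[OF tendsto_const tendsto_norm[OF xslim]]])
         (simp add: m)
    have u1: "norm u = 1" using LIMSEQ_unique[OF tendsto_norm[OF ulim]] us1 by simp
    have gm: "g (y j) \<in> SOC" "m j \<in> SOCdual" "m j \<bullet> g (y j) = 0" for j using m(1)[of j] by (auto simp: multiplier_def)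
    have lu: "l \<bullet> Dg x u = 0"
      by (rule tangent_inner_zero[OF _ _ reg gx t0 tlim ulim mlim])
         (use l gm in \<open>auto simp: multiplier_def yt[symmetric]\<close>)
    define d where "d = (\<lambda>j. (1 / t j) *\<^sub>R (g (y (q j)) - g x))"
    have dlim: "d \<longlonglongrightarrow> Dg x u" unfolding d_def yt
      using reg by (intro has_derivative_along_sequence t0 tlim ulim) (simp add: regular_at_def)
    \<comment> \<open>After division by the squared distance, \<open>S\<close> is the Hessian part
      and \<open>R\<close> the gap part of the two-point estimate.\<close>
    define S where "S = (\<lambda>j. D2f xb (us (q j)) (us (q j)) + 1/2 * ((l + m (q j)) \<bullet> D2g xb (us (q j)) (us (q j))))"
    define R where "R = (\<lambda>j. (1 / (t j)\<^sup>2) * ((m (q j) - l) \<bullet> (g (y (q j)) - g x)))"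
    define S0 where "S0 = D2f xb u u + l \<bullet> D2g xb u u"
    have "S \<longlonglongrightarrow> D2f xb u u + 1/2 * ((l + l) \<bullet> D2g xb u u)"
      unfolding S_def by (intro tendsto_intros B2f.tendsto B2g.tendsto ulim mlim)
    then have Slim: "S \<longlonglongrightarrow> S0" by (simp add: S0_def inner_add_left)
    have R0: "R j \<ge> 0" for j
      unfolding R_def by (intro mult_nonneg_nonneg multiplier_monotone(1)[OF l m(1)]) simp
    have RS: "R j \<le> c + \<epsilon> - S j" for j
    proof -
      define s where "s = y (q j) - x"
      have s: "s = t j *\<^sub>R us (q j)" by (simp add: s_def yt)
      have ns: "norm s = t j" by (simp add: s_def t_def)
      have "D2f xb s s + 1/2 * ((l + m (q j)) \<bullet> D2g xb s s) + (m (q j) - l) \<bullet> (g (y (q j)) - g x)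
        - \<epsilon> * (norm s)\<^sup>2 \<le> (w (q j) - v) \<bullet> s"
        unfolding s_def using x yn[of "q j"]
        by (intro two l m lM) (auto simp: \<eta>_def dist_norm norm_minus_commute)
      also have "\<dots> \<le> c * (norm s)\<^sup>2" using yw(4)[of "q j"] by (simp add: s_def)
      finally have "(t j)\<^sup>2 * S j + (m (q j) - l) \<bullet> (g (y (q j)) - g x) \<le> (t j)\<^sup>2 * (c + \<epsilon>)"
        unfolding ns unfolding s S_def B2f.scaleR_left B2f.scaleR_right B2g.scaleR_left B2g.scaleR_right
        by (simp add: power2_eq_square algebra_simps)
      also have "(m (q j) - l) \<bullet> (g (y (q j)) - g x) = (t j)\<^sup>2 * R j" using t0[of j] by (simp add: R_def)
      finally have "(t j)\<^sup>2 * (S j + R j) \<le> (t j)\<^sup>2 * (c + \<epsilon>)" by (simp add: distrib_left)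
      then have "S j + R j \<le> c + \<epsilon>" using t0[of j] by (simp add: mult_le_cancel_left_pos)
      then show ?thesis by simp
    qed
    have S0: "S0 \<le> c + \<epsilon>"
    proof (rule LIMSEQ_le_const2[OF Slim])
      have "S j \<le> c + \<epsilon>" for j using R0[of j] RS[of j] by linarith
      then show "\<exists>N. \<forall>n\<ge>N. S n \<le> c + \<epsilon>" by blast
    qed
    have g0: "fst (g x) \<ge> 0" using gx by (auto simp: SOC_def intro: order_trans[OF norm_ge_zero])
    have curv: "- fst l * lorentz (Dg x u) \<le> (c + \<epsilon> - S0) * fst (g x)"
    proof -
      \<comment> \<open>For \<open>l = 0\<close> the left side vanishes. At the apex
        \<open>Dg x u\<close> is a limit of cone elements, so the Lorentz form has the favourable
        sign. Only the remaining case needs the exact identity for the gap.\<close>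
      consider "l = 0" | "g x = 0" | "l \<noteq> 0" "g x \<noteq> 0" by blast
      then show ?thesis
      proof cases
        case 1
        then show ?thesis using S0 g0 by simp
      next
        case 2
        have "Dg x u \<in> SOC"
          by (rule closed_sequentially[OF closed_SOC _ dlim])
             (use t0 gm 2 in \<open>auto simp: d_def less_imp_le intro!: SOC_scaleR\<close>)
        then show ?thesis using lorentz_nonpos[of l "Dg x u"] l 2 by (simp add: multiplier_def)
      next
        case 3
        have gpos: "fst (g x) > 0" using SOC_complementary_frontier(2)[of l "g x"] l 3 by (simp add: multiplier_def)
        have glim: "(\<lambda>j. g (y (q j))) \<longlonglongrightarrow> g x" by (rule isCont_tendsto_compose[OF isCont_g[OF reg] ylim])
        have "\<forall>\<^sub>F j in sequentially. m (q j) \<noteq> 0" by (rule tendsto_imp_eventually_ne[OF mlim 3(1)])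
        moreover have "\<forall>\<^sub>F j in sequentially. g (y (q j)) \<noteq> 0" by (rule tendsto_imp_eventually_ne[OF glim 3(2)])
        ultimately have ev: "\<forall>\<^sub>F j in sequentially. (- fst l / fst (g x) - fst (m (q j)) / fst (g (y (q j)))) / 2 * lorentz (d j) \<le> c + \<epsilon> - S j"
        proof eventually_elim
          case (elim j)
          have "R j = (- fst l / fst (g x) - fst (m (q j)) / fst (g (y (q j)))) / 2 * lorentz (d j)"
            unfolding R_def d_def lorentz_scaleR multiplier_gap_curvature[OF l 3 m(1) elim]
            by (simp add: power_one_over)
          then show ?case using RS[of j] by simp
        qed
        have "(\<lambda>j. (- fst l / fst (g x) - fst (m (q j)) / fst (g (y (q j)))) / 2 * lorentz (d j)) \<longlonglongrightarrow>
            (- fst l / fst (g x) - fst l / fst (g x)) / 2 * lorentz (Dg x u)"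
          using gpos by (intro tendsto_intros tendsto_lorentz dlim mlim glim) auto
        moreover have "(\<lambda>j. c + \<epsilon> - S j) \<longlonglongrightarrow> c + \<epsilon> - S0" by (intro tendsto_intros Slim)
        ultimately have "(- fst l / fst (g x) - fst l / fst (g x)) / 2 * lorentz (Dg x u) \<le> c + \<epsilon> - S0"
          using ev by (intro tendsto_le[OF sequentially_bot])
        moreover have "(- fst l / fst (g x) - fst l / fst (g x)) / 2 * lorentz (Dg x u) = (- fst l * lorentz (Dg x u)) / fst (g x)"
          by simp
        ultimately show ?thesis using gpos by (simp only: pos_divide_le_eq)
      qed
    qed
    have "\<forall>\<^sub>F j in sequentially. t j < \<epsilon>" using order_tendstoD(2)[OF tlim e] .
    moreover have "\<forall>\<^sub>F j in sequentially. norm (m (q j) - l) < \<epsilon>"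
      using tendstoD[OF mlim e] by (simp add: dist_norm)
    moreover have "\<forall>\<^sub>F j in sequentially. norm (us (q j) - u) < \<epsilon>"
      using tendstoD[OF ulim e] by (simp add: dist_norm)
    ultimately have "\<forall>\<^sub>F j in sequentially. t j < \<epsilon> \<and> norm (m (q j) - l) < \<epsilon> \<and> norm (us (q j) - u) < \<epsilon>"
      by eventually_elim simp
    then obtain j where j: "t j < \<epsilon>" "norm (m (q j) - l) < \<epsilon>" "norm (us (q j) - u) < \<epsilon>"
      using eventually_happens by fastforce
    show "\<exists>l u y m. norm u = 1 \<and> multiplier x l (v - grad Df x) \<and> norm l \<le> \<sigma> * norm (v - grad Df x) \<and>
       l \<bullet> Dg x u = 0 \<and> D2f xb u u + l \<bullet> D2g xb u u \<le> c + \<epsilon> \<and>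
       - fst l * lorentz (Dg x u) \<le> (c + \<epsilon> - (D2f xb u u + l \<bullet> D2g xb u u)) * fst (g x) \<and>
       y \<noteq> x \<and> norm (y - x) < \<epsilon> \<and> norm (m - l) < \<epsilon> \<and> g y \<in> SOC \<and> m \<bullet> g y = 0 \<and>
       norm ((1 / norm (y - x)) *\<^sub>R (y - x) - u) < \<epsilon>"
      using u1 l ln lu S0 curv j yx[of "q j"] gm[of "q j"] unfolding S0_def t_def us_def by blast
  qed
qed

lemma rho_nonneg:
  assumes "l \<in> SOCdual" shows "0 \<le> rho Dg D2g xb u l v"
  unfolding rho_def
proof (rule INF_greatest)
  fix z assume "z \<in> {z. l \<bullet> (Dg xb z + D2g xb v u) = 0}"
  then show "0 \<le> ereal (- fst l * lorentz (Dg xb z + D2g xb v u))"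
    using lorentz_nonneg[OF assms, of "Dg xb z + D2g xb v u"] by simp
qed

text \<open>Both sides of \<open>curv\<close> are of order |x_k - xb|^2. After division by it the
  right side converges by \<open>second_order_limit\<close>, and on the left the derivatives scaled
  by 1 / |x_k - xb| converge to an admissible value in the constraint of \<open>rho\<close>.\<close>

lemma curvature_limit:
  assumes K_null: "\<forall>u\<in>crit_cone (feas g) xb (- grad Df xb). Dg xb u = 0"
    and \<mu>: "multiplier xb \<mu> (- grad Df xb)"
    and x: "x \<longlonglongrightarrow> xb" "\<And>k::nat. x k \<noteq> xb" and l: "l \<longlonglongrightarrow> \<mu>" and u: "u \<longlonglongrightarrow> u0"
    and C: "C \<longlonglongrightarrow> C0" "C0 \<ge> 0"
    and feas: "\<And>k. g (x k) \<in> SOC" "\<And>k. l k \<bullet> g (x k) = 0" "\<And>k. l k \<bullet> Dg (x k) (u k) = 0"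
    and curv: "\<And>k. - fst (l k) * lorentz (Dg (x k) (u k)) \<le> C k * fst (g (x k))"
  obtains v w where "norm v = 1" "\<mu> \<bullet> Dg xb u0 = 0" "fst \<mu> * lorentz (Dg xb u0) = 0" "Dg xb v = 0"
    "Dg xb w + (1/2) *\<^sub>R D2g xb v v \<in> SOC" "\<mu> \<bullet> (Dg xb w + (1/2) *\<^sub>R D2g xb v v) = 0"
    "rho Dg D2g xb u0 \<mu> v \<le> ereal (C0 * fst (Dg xb w + (1/2) *\<^sub>R D2g xb v v))"
proof -
  interpret A: bounded_linear "Dg xb" by (rule regular_linear(2)[OF regular_xb])
  have \<mu>d: "\<mu> \<in> SOCdual" using \<mu> by (simp add: multiplier_def)
  have n1: "norm ((1 / norm (x k - xb)) *\<^sub>R (x k - xb)) = 1" for k using x(2)[of k] by simp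
  then have "bounded (range (\<lambda>k. (1 / norm (x k - xb)) *\<^sub>R (x k - xb)))" 
    by (intro boundedI[of _ 1]) (simp only: image_iff, elim bexE, simp only: order_refl)
  then obtain v r1 where r1: "strict_mono (r1 :: nat \<Rightarrow> nat)"
    and v1: "((\<lambda>k. (1 / norm (x k - xb)) *\<^sub>R (x k - xb)) \<circ> r1) \<longlonglongrightarrow> v" by (rule bounded_convergent_subseq)
  have f1: "filterlim r1 sequentially sequentially" by (rule filterlim_subseq[OF r1])
  have v1': "(\<lambda>k. (1 / norm (x (r1 k) - xb)) *\<^sub>R (x (r1 k) - xb)) \<longlonglongrightarrow> v" using v1 by (simp add: o_def)
  have nv: "norm v = 1" using LIMSEQ_unique[OF tendsto_norm[OF v1']] n1 by simp
  obtain r2 w where r2: "strict_mono (r2 :: nat \<Rightarrow> nat)" and Av: "Dg xb v = 0"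
    and gl: "(\<lambda>k. (1 / (norm (x (r1 (r2 k)) - xb))\<^sup>2) *\<^sub>R g (x (r1 (r2 k)))) \<longlonglongrightarrow> Dg xb w + (1/2) *\<^sub>R D2g xb v v"
    and wS: "Dg xb w + (1/2) *\<^sub>R D2g xb v v \<in> SOC" and wl: "\<mu> \<bullet> (Dg xb w + (1/2) *\<^sub>R D2g xb v v) = 0"
    by (rule second_order_limit[OF K_null \<mu>, where y = "\<lambda>k. x (r1 k)" and m = "\<lambda>k. l (r1 k)" and v = v])
       (use tendsto_reindex[OF x(1) f1] tendsto_reindex[OF l f1] x(2) v1' feas in auto)
  define q where "q = (\<lambda>k. r1 (r2 k))"
  define qh where "qh = Dg xb w + (1/2) *\<^sub>R D2g xb v v"
  have f2: "filterlim r2 sequentially sequentially" by (rule filterlim_subseq[OF r2])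
  have fq: "filterlim q sequentially sequentially" unfolding q_def by (rule filterlim_compose[OF f1 f2])
  have xq: "(\<lambda>k. x (q k)) \<longlonglongrightarrow> xb" by (rule tendsto_reindex[OF x(1) fq])
  have lq: "(\<lambda>k. l (q k)) \<longlonglongrightarrow> \<mu>" by (rule tendsto_reindex[OF l fq])
  have uq: "(\<lambda>k. u (q k)) \<longlonglongrightarrow> u0" by (rule tendsto_reindex[OF u fq])
  have Cq: "(\<lambda>k. C (q k)) \<longlonglongrightarrow> C0" by (rule tendsto_reindex[OF C(1) fq])
  have vq: "(\<lambda>k. (1 / norm (x (q k) - xb)) *\<^sub>R (x (q k) - xb)) \<longlonglongrightarrow> v"
    unfolding q_def by (rule tendsto_reindex[OF v1' f2])
  define t where "t = (\<lambda>k. norm (x (q k) - xb))"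
  have t0: "t k > 0" for k using x(2) by (simp add: t_def)
  have "(\<lambda>k. x (q k) - xb) \<longlonglongrightarrow> xb - xb" by (intro tendsto_intros xq)
  then have tlim: "t \<longlonglongrightarrow> 0" unfolding t_def using tendsto_norm_zero by fastforce
  define d where "d = (\<lambda>k. Dg (x (q k)) (u (q k)))"
  define b where "b = (\<lambda>k. (1 / t k) *\<^sub>R (d k - Dg xb (u (q k))))"
  have blim: "b \<longlonglongrightarrow> D2g xb v u0"
    unfolding b_def d_def t_def by (rule derivative_quotient[OF xq _ vq uq]) (rule x(2))
  have "(\<lambda>k. t k *\<^sub>R b k + Dg xb (u (q k))) \<longlonglongrightarrow> 0 *\<^sub>R D2g xb v u0 + Dg xb u0"
    by (intro tendsto_intros tlim blim A.tendsto uq)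
  moreover have "t k *\<^sub>R b k + Dg xb (u (q k)) = d k" for k using t0[of k] by (simp add: b_def)
  ultimately have dlim: "d \<longlonglongrightarrow> Dg xb u0" by simp
  have ld: "l (q k) \<bullet> d k = 0" for k by (simp add: d_def feas)
  have \<mu>u: "\<mu> \<bullet> Dg xb u0 = 0"
    using LIMSEQ_unique[OF tendsto_inner[OF lq dlim]] by (simp add: ld)
  have gx0: "(\<lambda>k. g (x (q k))) \<longlonglongrightarrow> 0"
    using isCont_tendsto_compose[OF isCont_g[OF regular_xb] xq] by (simp add: g_zero)
  \<comment> \<open>Before any rescaling the right side already tends to 0, which squeezes the
    Lorentz term at \<open>u0\<close>.\<close>
  have "(\<lambda>k. - fst (l (q k)) * lorentz (d k)) \<longlonglongrightarrow> - fst \<mu> * lorentz (Dg xb u0)"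
    by (intro tendsto_mult tendsto_minus tendsto_fst lq tendsto_lorentz dlim)
  moreover have "(\<lambda>k. C (q k) * fst (g (x (q k)))) \<longlonglongrightarrow> C0 * fst (0 :: real \<times> 'b)"
    by (intro tendsto_mult tendsto_fst Cq gx0)
  ultimately have "- fst \<mu> * lorentz (Dg xb u0) \<le> C0 * fst (0 :: real \<times> 'b)"
    by (rule LIMSEQ_le) (use curv d_def in auto)
  with lorentz_nonneg[OF \<mu>d \<mu>u] have \<mu>lor: "fst \<mu> * lorentz (Dg xb u0) = 0" by simp
  have qh0: "fst qh \<ge> 0" using wS by (auto simp: SOC_def qh_def intro: order_trans[OF norm_ge_zero])
  \<comment> \<open>For \<open>\<mu> = 0\<close> the objective of \<open>rho\<close> vanishes
    identically. Otherwise \<open>fst \<mu> < 0\<close>, and \<open>curv\<close> genuinely bounds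
    the Lorentz form of the scaled derivatives.\<close>
  have rho: "rho Dg D2g xb u0 \<mu> v \<le> ereal (C0 * fst qh)"
  proof (cases "\<mu> = 0")
    case True
    have "rho Dg D2g xb u0 \<mu> v \<le> ereal (- fst \<mu> * lorentz (Dg xb 0 + D2g xb v u0))"
      unfolding rho_def by (rule INF_lower) (simp add: True)
    also have "\<dots> \<le> ereal (C0 * fst qh)" using True C(2) qh0 by simp
    finally show ?thesis .
  next
    case False
    then have \<mu>neg: "fst \<mu> < 0" using SOCdual_fst_nonpos[OF \<mu>d] SOCdual_fst_zero[OF \<mu>d] by fastforce
    \<comment> \<open>The Lorentz form is quadratic, so dividing the derivative by
      \<open>t k\<close> divides \<open>curv\<close> by \<open>(t k)\<^sup>2\<close>, the order of
      \<open>g\<close>.\<close>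
    define a where "a = (\<lambda>k. (1 / t k) *\<^sub>R d k)"
    define B where "B = (\<lambda>k. C (q k) * fst ((1 / (t k)\<^sup>2) *\<^sub>R g (x (q k))))"
    have Blim: "B \<longlonglongrightarrow> C0 * fst qh"
      unfolding B_def qh_def using gl by (intro tendsto_mult tendsto_fst Cq) (simp add: t_def q_def)
    have la: "l (q k) \<bullet> a k = 0" for k by (simp add: a_def ld)
    have aB: "- fst (l (q k)) * lorentz (a k) \<le> B k" for k
    proof -
      have "- fst (l (q k)) * lorentz (a k) = (1 / (t k)\<^sup>2) * (- fst (l (q k)) * lorentz (d k))"
        unfolding a_def lorentz_scaleR by (simp add: power_one_over)
      also have "\<dots> \<le> (1 / (t k)\<^sup>2) * (C (q k) * fst (g (x (q k))))"
        unfolding d_def by (intro mult_left_mono curv) simp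
      finally show ?thesis by (simp add: B_def)
    qed
    have ab: "a k = Dg xb ((1 / t k) *\<^sub>R u (q k)) + b k" for k
      unfolding A.scaleR by (simp add: a_def b_def scaleR_diff_right)
    obtain r3 z where r3: "strict_mono (r3 :: nat \<Rightarrow> nat)" and alim: "(\<lambda>k. a (r3 k)) \<longlonglongrightarrow> Dg xb z + D2g xb v u0"
    proof (rule affine_range_subseq[OF A.bounded_linear_axioms ab blim])
      fix r p assume r: "filterlim r sequentially sequentially"
        and rn: "filterlim (\<lambda>n::nat. norm (a (r n))) at_top sequentially"
        and lim: "(\<lambda>n. (1 / norm (a (r n))) *\<^sub>R a (r n)) \<longlonglongrightarrow> Dg xb p" and p1: "norm (Dg xb p) = 1"
      have "(\<lambda>n. l (q (r n)) \<bullet> ((1 / norm (a (r n))) *\<^sub>R a (r n))) \<longlonglongrightarrow> \<mu> \<bullet> Dg xb p"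
        by (intro tendsto_inner tendsto_reindex[OF lq r] lim)
      then have \<mu>p: "\<mu> \<bullet> Dg xb p = 0" by (simp add: la LIMSEQ_const_iff)
      have inv: "(\<lambda>n. 1 / norm (a (r n))) \<longlonglongrightarrow> 0"
        using tendsto_inverse_0_at_top[OF rn] by (simp add: divide_inverse)
      have "(\<lambda>n. - fst (l (q (r n))) * lorentz ((1 / norm (a (r n))) *\<^sub>R a (r n))) \<longlonglongrightarrow> - fst \<mu> * lorentz (Dg xb p)"
        by (intro tendsto_mult tendsto_minus tendsto_fst tendsto_reindex[OF lq r] tendsto_lorentz lim)
      moreover have "(\<lambda>n. (1 / norm (a (r n)))\<^sup>2 * B (r n)) \<longlonglongrightarrow> 0\<^sup>2 * (C0 * fst qh)"
        by (intro tendsto_mult tendsto_power inv tendsto_reindex[OF Blim r])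
      moreover have "- fst (l (q (r n))) * lorentz ((1 / norm (a (r n))) *\<^sub>R a (r n)) \<le> (1 / norm (a (r n)))\<^sup>2 * B (r n)" for n
        using mult_left_mono[OF aB[of "r n"], of "(1 / norm (a (r n)))\<^sup>2"] unfolding lorentz_scaleR
        by (simp add: mult.left_commute)
      ultimately have "- fst \<mu> * lorentz (Dg xb p) \<le> 0\<^sup>2 * (C0 * fst qh)" by (intro LIMSEQ_le) auto
      \<comment> \<open>A divergent \<open>a\<close> would give a unit vector in the range,
        orthogonal to \<open>\<mu>\<close>, with nonpositive Lorentz form. Up to sign it lies in the
        cone, and the range contains both signs.\<close>
      then have "lorentz (Dg xb p) \<le> 0" using \<mu>neg by (simp add: zero_le_mult_iff) 
      then have "Dg xb p \<in> SOC \<or> - Dg xb p \<in> SOC" by (rule lorentz_null_in_SOC)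
      then have "Dg xb p = 0"
      proof
        assume "Dg xb p \<in> SOC"
        then show ?thesis using critical_range_zero[OF K_null \<mu>] \<mu>p by blast
      next
        assume "- Dg xb p \<in> SOC"
        then have "Dg xb (- p) = 0" using \<mu>p by (intro critical_range_zero[OF K_null \<mu>]) (simp_all add: A.neg)
        then show ?thesis by (simp add: A.neg)
      qed
      with p1 show False by simp
    qed
    have f3: "filterlim r3 sequentially sequentially" by (rule filterlim_subseq[OF r3])
    have "(\<lambda>n. l (q (r3 n)) \<bullet> a (r3 n)) \<longlonglongrightarrow> \<mu> \<bullet> (Dg xb z + D2g xb v u0)"
      by (intro tendsto_inner tendsto_reindex[OF lq f3] alim)
    then have z: "\<mu> \<bullet> (Dg xb z + D2g xb v u0) = 0" by (simp add: la LIMSEQ_const_iff)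
    have "(\<lambda>n. - fst (l (q (r3 n))) * lorentz (a (r3 n))) \<longlonglongrightarrow> - fst \<mu> * lorentz (Dg xb z + D2g xb v u0)"
      by (intro tendsto_mult tendsto_minus tendsto_fst tendsto_reindex[OF lq f3] tendsto_lorentz alim)
    then have "- fst \<mu> * lorentz (Dg xb z + D2g xb v u0) \<le> C0 * fst qh"
      by (rule LIMSEQ_le[OF _ tendsto_reindex[OF Blim f3]]) (use aB in auto)
    moreover have "rho Dg D2g xb u0 \<mu> v \<le> ereal (- fst \<mu> * lorentz (Dg xb z + D2g xb v u0))"
      unfolding rho_def by (rule INF_lower) (simp add: z)
    ultimately show ?thesis by (meson ereal_less_eq(3) order_trans)
  qed
  show ?thesis using that[OF nv \<mu>u \<mu>lor Av wS wl] rho by (simp add: qh_def)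
qed


text \<open>Failure yields, for every tolerance 1/(k+1), a base point \<open>X k\<close> with limit
  objects from \<open>nonmonotone_limit\<close>. Their limit has second-order form \<open>S\<close>
  at most \<open>c\<close>, and the hypotheses say it must be larger once the limit is placed in the
  right set.\<close>

lemma locally_strongly_monotone:
  assumes K_null: "\<forall>u\<in>crit_cone (feas g) xb (- grad Df xb). Dg xb u = 0"
    and cond_a: "\<forall>u\<in>crit_cone (feas g) xb (- grad Df xb). norm u = 1 \<longrightarrow>
        (\<forall>l\<in>LamDir g Dg D2g xb (- grad Df xb) u. D2f xb u u + l \<bullet> D2g xb u u > c)"
    and cond_b: "\<forall>u l v w. (u, l, v, w) \<in> Zset g Dg D2g Df xb \<longrightarrow>
        ((Dg xb w + (1/2) *\<^sub>R D2g xb v v \<noteq> 0 \<longrightarrow>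
            ereal (D2f xb u u + l \<bullet> D2g xb u u)
              + rho Dg D2g xb u l v / ereal (fst (Dg xb w + (1/2) *\<^sub>R D2g xb v v))
            > ereal c) \<and>
         (rho Dg D2g xb u l v = 0 \<longrightarrow> D2f xb u u + l \<bullet> D2g xb u u > c))"
  obtains \<eta> where "\<eta> > 0" "\<And>x v. \<lbrakk>subgrad x v; norm (x - xb) < \<eta>; norm v < \<eta>\<rbrakk> \<Longrightarrow>
        \<exists>\<delta>>0. \<forall>y w. subgrad y w \<longrightarrow> norm (y - x) < \<delta> \<longrightarrow> norm (w - v) < \<delta> \<longrightarrow>
          c * (norm (y - x))\<^sup>2 \<le> (w - v) \<bullet> (y - x)"
proof (rule ccontr)
  assume contra: "\<not> thesis"
  note witness = that
  have bad: "\<exists>x v. subgrad x v \<and> norm (x - xb) < \<eta> \<and> norm v < \<eta> \<and>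
      (\<forall>\<delta>>0. \<exists>y w. subgrad y w \<and> norm (y - x) < \<delta> \<and> norm (w - v) < \<delta> \<and>
          (w - v) \<bullet> (y - x) < c * (norm (y - x))\<^sup>2)" if "\<eta> > 0" for \<eta>
  proof (rule ccontr)
    assume no: "\<not> ?thesis"
    have "thesis"
    proof (rule witness[OF \<open>\<eta> > 0\<close>])
      fix x v assume "subgrad x v" "norm (x - xb) < \<eta>" "norm v < \<eta>"
      with no have "\<not> (\<forall>\<delta>>0. \<exists>y w. subgrad y w \<and> norm (y - x) < \<delta> \<and> norm (w - v) < \<delta> \<and>
          (w - v) \<bullet> (y - x) < c * (norm (y - x))\<^sup>2)" by blast
      then show "\<exists>\<delta>>0. \<forall>y w. subgrad y w \<longrightarrow> norm (y - x) < \<delta> \<longrightarrow> norm (w - v) < \<delta> \<longrightarrow>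
          c * (norm (y - x))\<^sup>2 \<le> (w - v) \<bullet> (y - x)" by (meson not_less)
    qed
    with contra show False by blast
  qed
  define \<epsilon> where "\<epsilon> = (\<lambda>k. inverse (real (Suc k)))"
  have e0: "\<epsilon> k > 0" for k by (simp add: \<epsilon>_def)
  have elim: "\<epsilon> \<longlonglongrightarrow> 0" unfolding \<epsilon>_def by (rule LIMSEQ_inverse_real_of_nat)
  define data where "data = (\<lambda>k x v l u y m. norm (x - xb) < \<epsilon> k \<and> norm v < \<epsilon> k \<and>
       norm u = 1 \<and> multiplier x l (v - grad Df x) \<and> norm l \<le> \<sigma> * norm (v - grad Df x) \<and>
       l \<bullet> Dg x u = 0 \<and> D2f xb u u + l \<bullet> D2g xb u u \<le> c + \<epsilon> k \<and>
       - fst l * lorentz (Dg x u) \<le> (c + \<epsilon> k - (D2f xb u u + l \<bullet> D2g xb u u)) * fst (g x) \<and>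
       y \<noteq> x \<and> norm (y - x) < \<epsilon> k \<and> norm (m - l) < \<epsilon> k \<and> g y \<in> SOC \<and> m \<bullet> g y = 0 \<and>
       norm ((1 / norm (y - x)) *\<^sub>R (y - x) - u) < \<epsilon> k)"
  have "\<exists>x v l u y m. data k x v l u y m" for k
  proof -
    obtain \<eta> where \<eta>: "\<eta> > 0" and lim: "\<And>x v. \<lbrakk>subgrad x v; norm (x - xb) < \<eta>; norm v < \<eta>;
       \<forall>\<delta>>0. \<exists>y w. subgrad y w \<and> norm (y - x) < \<delta> \<and> norm (w - v) < \<delta> \<and>
          (w - v) \<bullet> (y - x) < c * (norm (y - x))\<^sup>2\<rbrakk> \<Longrightarrow>
     \<exists>l u y m. norm u = 1 \<and> multiplier x l (v - grad Df x) \<and> norm l \<le> \<sigma> * norm (v - grad Df x) \<and>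
       l \<bullet> Dg x u = 0 \<and> D2f xb u u + l \<bullet> D2g xb u u \<le> c + \<epsilon> k \<and>
       - fst l * lorentz (Dg x u) \<le> (c + \<epsilon> k - (D2f xb u u + l \<bullet> D2g xb u u)) * fst (g x) \<and>
       y \<noteq> x \<and> norm (y - x) < \<epsilon> k \<and> norm (m - l) < \<epsilon> k \<and> g y \<in> SOC \<and> m \<bullet> g y = 0 \<and>
       norm ((1 / norm (y - x)) *\<^sub>R (y - x) - u) < \<epsilon> k"
      by (rule nonmonotone_limit[OF e0, of c k]) (rule that)
    obtain x v where xv: "subgrad x v" "norm (x - xb) < min \<eta> (\<epsilon> k)" "norm v < min \<eta> (\<epsilon> k)"
      "\<forall>\<delta>>0. \<exists>y w. subgrad y w \<and> norm (y - x) < \<delta> \<and> norm (w - v) < \<delta> \<and>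
          (w - v) \<bullet> (y - x) < c * (norm (y - x))\<^sup>2"
      using bad[of "min \<eta> (\<epsilon> k)"] \<eta> e0[of k] by auto
    then show ?thesis using lim[OF xv(1) _ _ xv(4)] unfolding data_def min_less_iff_conj by blast
  qed
  then obtain X V L U Y M where data: "\<And>k. data k (X k) (V k) (L k) (U k) (Y k) (M k)" by metis
  have tozero: "Z \<longlonglongrightarrow> z" if "\<And>k. norm (Z k - z) < \<epsilon> k" for Z :: "nat \<Rightarrow> 'n::real_normed_vector" and z
  proof -
    have "(\<lambda>k. norm (Z k - z)) \<longlonglongrightarrow> 0"
      by (rule tendsto_sandwich[OF _ _ tendsto_const elim]) (use that in \<open>auto simp: less_imp_le\<close>)
    then show ?thesis by (simp add: LIM_zero_iff tendsto_norm_zero_iff)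
  qed
  have Xlim: "X \<longlonglongrightarrow> xb" using data by (intro tozero) (simp add: data_def)
  have Vlim: "V \<longlonglongrightarrow> 0" using data by (intro tozero) (simp add: data_def)
  have "(\<lambda>k. V k - grad Df (X k)) \<longlonglongrightarrow> 0 - grad Df xb"
    by (intro tendsto_diff Vlim isCont_tendsto_compose[OF isCont_grad[OF regular_xb] Xlim])
  then have xslim: "(\<lambda>k. V k - grad Df (X k)) \<longlonglongrightarrow> - grad Df xb" by simp
  obtain B where B: "\<And>k. norm (V k - grad Df (X k)) \<le> B"
    using convergent_imp_Bseq[OF convergentI[OF xslim]] by (auto simp: Bseq_def)
  have "norm (U k, L k) \<le> 1 + \<sigma> * B" for k
  proof -
    have "norm (L k) \<le> \<sigma> * norm (V k - grad Df (X k))" "norm (U k) = 1" using data[of k] by (auto simp: data_def)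
    moreover have "\<sigma> * norm (V k - grad Df (X k)) \<le> \<sigma> * B" using B[of k] sigma_pos by simp
    ultimately show ?thesis using norm_Pair_le[of "U k" "L k"] by linarith
  qed
  then have "bounded (range (\<lambda>k. (U k, L k)))" by (auto simp: bounded_iff)
  then obtain ul q where q: "strict_mono (q :: nat \<Rightarrow> nat)" and ul: "((\<lambda>k. (U k, L k)) \<circ> q) \<longlonglongrightarrow> ul"
    by (rule bounded_convergent_subseq)
  define u where "u = fst ul"
  define \<mu> where "\<mu> = snd ul"
  have fq: "filterlim q sequentially sequentially" by (rule filterlim_subseq[OF q])
  have ulim: "(\<lambda>k. U (q k)) \<longlonglongrightarrow> u" using tendsto_fst[OF ul] by (simp add: u_def o_def)
  have llim: "(\<lambda>k. L (q k)) \<longlonglongrightarrow> \<mu>" using tendsto_snd[OF ul] by (simp add: \<mu>_def o_def)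
  note xq = tendsto_reindex[OF Xlim fq] and xsq = tendsto_reindex[OF xslim fq] and eq = tendsto_reindex[OF elim fq]
  have \<mu>: "multiplier xb \<mu> (- grad Df xb)"
    by (rule multiplier_limit[OF regular_xb xq llim xsq]) (use data in \<open>simp add: data_def\<close>)
  have \<mu>d: "\<mu> \<in> SOCdual" using \<mu> by (simp add: multiplier_def)
  have \<mu>n: "norm \<mu> \<le> \<sigma> * norm (- grad Df xb)"
    by (rule LIMSEQ_le[OF tendsto_norm[OF llim] tendsto_mult[OF tendsto_const tendsto_norm[OF xsq]]])
       (use data in \<open>simp add: data_def\<close>)
  \<comment> \<open>If the gradient vanishes, \<open>\<mu>n\<close> gives \<open>\<mu> = 0\<close>,
    as \<open>Lam0\<close> requires in that case.\<close>
  have \<mu>Lam0: "\<mu> \<in> Lam0 g Dg xb (- grad Df xb)"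
    using \<mu>n \<mu> mem_Lam_iff[OF regular_xb] by (auto simp: Lam0_def)
  have "(\<lambda>k. norm (U (q k))) \<longlonglongrightarrow> norm u" by (rule tendsto_norm[OF ulim])
  then have u1: "norm u = 1" using data by (simp add: data_def LIMSEQ_const_iff)
  define S where "S = D2f xb u u + \<mu> \<bullet> D2g xb u u"
  have Slim: "(\<lambda>k. D2f xb (U (q k)) (U (q k)) + L (q k) \<bullet> D2g xb (U (q k)) (U (q k))) \<longlonglongrightarrow> S"
    unfolding S_def by (intro tendsto_intros B2f.tendsto B2g.tendsto ulim llim)
  have "(\<lambda>k. c + \<epsilon> (q k)) \<longlonglongrightarrow> c + 0" by (intro tendsto_intros eq)
  then have celim: "(\<lambda>k. c + \<epsilon> (q k)) \<longlonglongrightarrow> c" by simp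
  have Sc: "S \<le> c"
    by (rule LIMSEQ_le[OF Slim celim]) (use data in \<open>simp add: data_def\<close>)
  \<comment> \<open>Infinitely many base points different from \<open>xb\<close> lead to condition
    (b); otherwise the base point is eventually \<open>xb\<close> and the auxiliary points
    \<open>Y\<close> lead to condition (a).\<close>
  show False
  proof (cases "finite {k. X (q k) \<noteq> xb}")
    case False
    then obtain s where s: "strict_mono (s :: nat \<Rightarrow> nat)" "\<And>n. X (q (s n)) \<noteq> xb"
      using infinite_enumerate by (metis (mono_tags) mem_Collect_eq)
    have fs: "filterlim s sequentially sequentially" by (rule filterlim_subseq[OF s(1)])
    have clim: "(\<lambda>k. c + \<epsilon> (q (s k)) - (D2f xb (U (q (s k))) (U (q (s k))) + L (q (s k)) \<bullet> D2g xb (U (q (s k))) (U (q (s k))))) \<longlonglongrightarrow> c - S"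
      by (intro tendsto_diff tendsto_reindex[OF celim fs] tendsto_reindex[OF Slim fs])
    obtain v w where vw: "norm v = 1" "\<mu> \<bullet> Dg xb u = 0" "fst \<mu> * lorentz (Dg xb u) = 0" "Dg xb v = 0"
      "Dg xb w + (1/2) *\<^sub>R D2g xb v v \<in> SOC" "\<mu> \<bullet> (Dg xb w + (1/2) *\<^sub>R D2g xb v v) = 0"
      and rho: "rho Dg D2g xb u \<mu> v \<le> ereal ((c - S) * fst (Dg xb w + (1/2) *\<^sub>R D2g xb v v))"
    proof (rule curvature_limit[OF K_null \<mu> tendsto_reindex[OF xq fs] s(2) tendsto_reindex[OF llim fs] tendsto_reindex[OF ulim fs] clim])
      fix k
      show "0 \<le> c - S" using Sc by simp
      show "g (X (q (s k))) \<in> SOC" "L (q (s k)) \<bullet> g (X (q (s k))) = 0"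
        "L (q (s k)) \<bullet> Dg (X (q (s k))) (U (q (s k))) = 0"
        "- fst (L (q (s k))) * lorentz (Dg (X (q (s k))) (U (q (s k)))) \<le>
          (c + \<epsilon> (q (s k)) - (D2f xb (U (q (s k))) (U (q (s k))) + L (q (s k)) \<bullet> D2g xb (U (q (s k))) (U (q (s k))))) * fst (g (X (q (s k))))"
        using data[of "q (s k)"] unfolding data_def multiplier_def by blast+
    qed
    define qh where "qh = Dg xb w + (1/2) *\<^sub>R D2g xb v v"
    have Z: "(u, \<mu>, v, w) \<in> Zset g Dg D2g Df xb"
      using u1 \<mu>Lam0 vw \<mu>d by (simp add: Zset_def mem_normQ_iff)
    have rho0: "0 \<le> rho Dg D2g xb u \<mu> v" by (rule rho_nonneg[OF \<mu>d])
    show False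
    \<comment> \<open>If \<open>qh = 0\<close>, the upper bound on \<open>rho\<close> is 0 and the
      second clause of (b) applies. Otherwise \<open>fst qh > 0\<close> and the same bound can be
      divided by it.\<close>
    proof (cases "qh = 0")
      case True
      then have "rho Dg D2g xb u \<mu> v = 0" using rho rho0 unfolding qh_def by (simp add: zero_ereal_def[symmetric])
      then have "S > c" using cond_b Z unfolding S_def by blast
      with Sc show False by simp
    next
      case False
      have "fst qh \<ge> norm (snd qh)" using vw(5) by (simp add: SOC_def qh_def)
      then have pos: "fst qh > 0" using False
        by (metis fst_zero norm_ge_zero norm_le_zero_iff order_le_less order_trans prod.expand snd_zero)
      obtain R where R: "rho Dg D2g xb u \<mu> v = ereal R" using rho rho0 by (cases "rho Dg D2g xb u \<mu> v") auto
      have "ereal S + rho Dg D2g xb u \<mu> v / ereal (fst qh) > ereal c"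
        using cond_b Z False unfolding S_def qh_def by blast
      then have "S + R / fst qh > c" using pos by (simp add: R)
      moreover have "R \<le> (c - S) * fst qh" using rho R by (simp add: qh_def)
      then have "R / fst qh \<le> c - S" using pos by (simp add: pos_divide_le_eq)
      ultimately show False by simp
    qed
  next
    case True
    then obtain N where N: "\<And>k. k \<ge> N \<Longrightarrow> X (q k) = xb"
      by (metis (mono_tags, lifting) finite_nat_set_iff_bounded mem_Collect_eq not_less)
    define p where "p = (\<lambda>k. q (k + N))"
    have Xp: "X (p k) = xb" for k using N by (simp add: p_def)
    have fp: "filterlim p sequentially sequentially"
      unfolding p_def by (rule filterlim_compose[OF fq]) (simp add: filterlim_add_const_nat_at_top)
    have Ylim: "Y \<longlonglongrightarrow> xb"
    proof -
      have "(\<lambda>k. Y k - X k) \<longlonglongrightarrow> 0" using data by (intro tozero) (simp add: data_def)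
      from tendsto_add[OF this Xlim] show ?thesis by simp
    qed
    have Ml: "(\<lambda>k. M k - L k) \<longlonglongrightarrow> 0" using data by (intro tozero) (simp add: data_def)
    have Uy: "(\<lambda>k. (1 / norm (Y k - X k)) *\<^sub>R (Y k - X k) - U k) \<longlonglongrightarrow> 0"
      using data by (intro tozero) (simp add: data_def)
    have fN: "filterlim (\<lambda>k. k + N) sequentially sequentially" by (simp add: filterlim_add_const_nat_at_top)
    have mp: "(\<lambda>k. M (p k)) \<longlonglongrightarrow> \<mu>"
      using tendsto_add[OF tendsto_reindex[OF Ml fp] tendsto_reindex[OF llim fN]] by (simp add: p_def)
    have up: "(\<lambda>k. (1 / norm (Y (p k) - xb)) *\<^sub>R (Y (p k) - xb)) \<longlonglongrightarrow> u"
      using tendsto_add[OF tendsto_reindex[OF Uy fp] tendsto_reindex[OF ulim fN]]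
      unfolding Xp by (simp add: p_def)
    \<comment> \<open>Around \<open>xb\<close> the direction of approach of the points
      \<open>Y\<close> is \<open>u\<close> itself, so it takes the place of \<open>v\<close> in the
      second-order limit.\<close>
    obtain r w where Au: "Dg xb u = 0"
      and wS: "Dg xb w + (1/2) *\<^sub>R D2g xb u u \<in> SOC" and wl: "\<mu> \<bullet> (Dg xb w + (1/2) *\<^sub>R D2g xb u u) = 0"
    proof (rule second_order_limit[OF K_null \<mu> tendsto_reindex[OF Ylim fp] _ up mp])
      show "Y (p k) \<noteq> xb" "g (Y (p k)) \<in> SOC" "M (p k) \<bullet> g (Y (p k)) = 0" for k
        using data[of "p k"] Xp[of k] by (auto simp: data_def)
    qed
    have "u \<in> tangent_cone (feas g) xb" using Au zero_in_SOC by (intro linearized_tangent) simp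
    moreover have "- grad Df xb \<bullet> u = 0"
      using \<mu> Au unfolding multiplier_def by (metis inner_zero_right)
    ultimately have ucrit: "u \<in> crit_cone (feas g) xb (- grad Df xb)" by (simp add: crit_cone_def)
    have "\<mu> \<in> LamDir g Dg D2g xb (- grad Df xb) u"
      unfolding LamDir_def mem_Collect_eq mem_Lam_iff[OF regular_xb]
    proof (intro conjI ballI \<mu>)
      \<comment> \<open>A duality certificate: \<open>w\<close> makes the second-order vector lie in
        the cone and orthogonal to \<open>\<mu>\<close>, and all multipliers agree on
        \<open>Dg xb w\<close>, so none gives a larger value than \<open>\<mu>\<close>. The
        curvature terms vanish because \<open>g xb = 0\<close>.\<close>
      fix \<nu> assume "\<nu> \<in> Lam g Dg xb (- grad Df xb)"
      then have \<nu>: "multiplier xb \<nu> (- grad Df xb)" by (simp add: mem_Lam_iff[OF regular_xb])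
      have "\<nu> \<bullet> (Dg xb w + (1/2) *\<^sub>R D2g xb u u) \<le> 0"
        using \<nu> wS by (intro SOC_SOCdual_inner) (auto simp: multiplier_def)
      moreover have "\<nu> \<bullet> Dg xb w = \<mu> \<bullet> Dg xb w" using \<mu> \<nu> by (simp add: multiplier_def)
      ultimately have "\<nu> \<bullet> D2g xb u u \<le> \<mu> \<bullet> D2g xb u u" using wl by (simp add: inner_add_right)
      then show "\<nu> \<bullet> D2g xb u u + curvQ g Dg xb \<nu> u \<le> \<mu> \<bullet> D2g xb u u + curvQ g Dg xb \<mu> u"
        by (simp add: curvQ_def g_zero)
    qed
    then have "S > c" using cond_a ucrit u1 unfolding S_def by blast
    with Sc show False by simp
  qed
qed

lemma tilt_stable_of_conditions:
  assumes stationary: "- grad Df xb \<in> lim_normal (feas g) xb"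
    and K_null: "\<forall>u\<in>crit_cone (feas g) xb (- grad Df xb). Dg xb u = 0"
    and \<kappa>: "\<kappa> > 0"
    and cond_a: "\<forall>u\<in>crit_cone (feas g) xb (- grad Df xb). norm u = 1 \<longrightarrow>
        (\<forall>l\<in>LamDir g Dg D2g xb (- grad Df xb) u. D2f xb u u + l \<bullet> D2g xb u u > 1 / \<kappa>)"
    and cond_b: "\<forall>u l v w. (u, l, v, w) \<in> Zset g Dg D2g Df xb \<longrightarrow>
        ((Dg xb w + (1/2) *\<^sub>R D2g xb v v \<noteq> 0 \<longrightarrow>
            ereal (D2f xb u u + l \<bullet> D2g xb u u)
              + rho Dg D2g xb u l v / ereal (fst (Dg xb w + (1/2) *\<^sub>R D2g xb v v))
            > ereal (1 / \<kappa>)) \<and>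
         (rho Dg D2g xb u l v = 0 \<longrightarrow> D2f xb u u + l \<bullet> D2g xb u u > 1 / \<kappa>))"
  shows "tilt_stable (phi f (feas g)) xb \<kappa>"
proof -
  obtain \<mu> where \<mu>: "multiplier xb \<mu> (- grad Df xb)" by (rule stationary_multiplier[OF stationary])
  obtain \<eta>1 where \<eta>1: "\<eta>1 > 0" and mono: "\<And>x v. \<lbrakk>subgrad x v; norm (x - xb) < \<eta>1; norm v < \<eta>1\<rbrakk> \<Longrightarrow>
        \<exists>\<delta>>0. \<forall>y w. subgrad y w \<longrightarrow> norm (y - x) < \<delta> \<longrightarrow> norm (w - v) < \<delta> \<longrightarrow>
          1 / \<kappa> * (norm (y - x))\<^sup>2 \<le> (w - v) \<bullet> (y - x)"
    by (rule locally_strongly_monotone[OF K_null cond_a cond_b]) (rule that)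
  obtain \<eta>2 r where \<eta>2: "\<eta>2 > 0" and hypo:
    "\<And>x v y w. \<lbrakk>subgrad x v; subgrad y w; norm (x - xb) < \<eta>2; norm v < \<eta>2; norm (y - xb) < \<eta>2; norm w < \<eta>2\<rbrakk>
        \<Longrightarrow> - r * (norm (y - x))\<^sup>2 \<le> (w - v) \<bullet> (y - x)"
    by (rule subgrad_hypomonotone) (rule that)
  obtain \<gamma>1 where \<gamma>1: "\<gamma>1 > 0" and reg: "\<And>x. x \<in> ball xb \<gamma>1 \<Longrightarrow> regular_at x"
    by (rule regular_near) (rule that)
  obtain \<gamma>2 C where \<gamma>2: "\<gamma>2 > 0"
    and growth: "\<And>x. x \<in> feas g \<Longrightarrow> norm (x - xb) < \<gamma>2 \<Longrightarrow> f xb - C * (norm (x - xb))\<^sup>2 \<le> f x"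
    by (rule quadratic_lower_bound[OF \<mu>]) (rule that)
  define \<gamma> where "\<gamma> = min \<gamma>1 \<gamma>2 / 2"
  have \<gamma>: "\<gamma> > 0" "\<gamma> < \<gamma>1" "\<gamma> < \<gamma>2" using \<gamma>1 \<gamma>2 by (auto simp: \<gamma>_def min_def)
  have regc: "regular_at x" if "x \<in> cball xb \<gamma>" for x using that \<gamma> by (intro reg) auto
  show ?thesis
  proof (rule tilt_stable_if_locally_strongly_monotone[OF \<gamma>(1) compact_feas_near(1)[OF regc] xb_feas
        compact_feas_near(2)[OF regc] \<kappa>, where \<eta> = "min \<eta>1 \<eta>2" and G = subgrad and C = C and r = r])
    show "min \<eta>1 \<eta>2 > 0" using \<eta>1 \<eta>2 by simp
    show "subgrad x (v - s *\<^sub>R (x - xb))"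
      if "0 \<le> s" "x \<in> feas g" "norm (x - xb) < \<gamma>'" "\<gamma>' \<le> \<gamma>"
        "\<And>y. y \<in> feas g \<Longrightarrow> norm (y - xb) \<le> \<gamma>' \<Longrightarrow>
          f x + s/2 * (norm (x - xb))\<^sup>2 - v \<bullet> x \<le> f y + s/2 * (norm (y - xb))\<^sup>2 - v \<bullet> y" for s v x \<gamma>'
      using that by (intro local_minimizer_subgrad[where \<gamma> = \<gamma>'] regc) (auto simp: dist_norm norm_minus_commute)
    show "f xb - C * (norm (x - xb))\<^sup>2 \<le> f x" if "x \<in> feas g" "norm (x - xb) \<le> \<gamma>" for x
      using that \<gamma> by (intro growth) auto
    show "- r * (norm (y - x))\<^sup>2 \<le> (w - v) \<bullet> (y - x)"
      if "subgrad x v" "subgrad y w" "norm (x - xb) < min \<eta>1 \<eta>2" "norm v < min \<eta>1 \<eta>2"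
        "norm (y - xb) < min \<eta>1 \<eta>2" "norm w < min \<eta>1 \<eta>2" for x v y w
      using that by (intro hypo) auto
    show "\<exists>\<delta>>0. \<forall>y w. subgrad y w \<longrightarrow> norm (y - x) < \<delta> \<longrightarrow> norm (w - v) < \<delta> \<longrightarrow>
          1 / \<kappa> * (norm (y - x))\<^sup>2 \<le> (w - v) \<bullet> (y - x)"
      if "subgrad x v" "norm (x - xb) < min \<eta>1 \<eta>2" "norm v < min \<eta>1 \<eta>2" for x v
      using that by (intro mono) auto
  qed
qed

end

section \<open>The exact bound of tilt stability\<close>

lemma tilt_bound_le:
  assumes "tilt_stable \<phi> xb \<kappa>" "\<kappa> > 0" shows "tilt_bound \<phi> xb \<le> ereal \<kappa>"
proof -
  obtain \<gamma> U where U: "\<gamma> > 0" "open U" "0 \<in> U" "lip_on (Mtilt \<phi> xb \<gamma>) U \<kappa>"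
    using assms(1) unfolding tilt_stable_def by blast
  have "tilt_bound \<phi> xb \<le> lipM0 \<phi> xb \<gamma>" unfolding tilt_bound_def using U(1) by (intro INF_lower) simp
  also have "\<dots> \<le> ereal \<kappa>" unfolding lipM0_def using U assms(2) by (intro Inf_lower) auto
  finally show ?thesis .
qed

theorem theorem4p5:
  fixes f :: "'a::euclidean_space \<Rightarrow> real" and Df :: "'a \<Rightarrow> 'a \<Rightarrow> real"
    and D2f :: "'a \<Rightarrow> 'a \<Rightarrow> 'a \<Rightarrow> real"
    and g :: "'a \<Rightarrow> real \<times> 'b::euclidean_space" and Dg :: "'a \<Rightarrow> 'a \<Rightarrow> real \<times> 'b"
    and D2g :: "'a \<Rightarrow> 'a \<Rightarrow> 'a \<Rightarrow> real \<times> 'b"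
    and xb :: 'a and \<sigma> \<kappa> :: real
  assumes C2f: "C2_near f Df D2f xb"
    and C2g: "C2_near g Dg D2g xb"
    and feasible: "xb \<in> feas g"
    and g_zero: "g xb = 0"
    and stationary: "- grad Df xb \<in> lim_normal (feas g) xb"
    and sigma_pos: "\<sigma> > 0"
    and mscq: "MSCQ g xb \<sigma>"
    and K_null: "\<forall>u\<in>crit_cone (feas g) xb (- grad Df xb). Dg xb u = 0"
    and kappa_pos: "\<kappa> > 0"
    and cond_a: "\<forall>u\<in>crit_cone (feas g) xb (- grad Df xb). norm u = 1 \<longrightarrow>
        (\<forall>l\<in>LamDir g Dg D2g xb (- grad Df xb) u. D2f xb u u + l \<bullet> D2g xb u u > 1 / \<kappa>)"
    and cond_b: "\<forall>u l v w. (u, l, v, w) \<in> Zset g Dg D2g Df xb \<longrightarrow>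
        ((Dg xb w + (1/2) *\<^sub>R D2g xb v v \<noteq> 0 \<longrightarrow>
            ereal (D2f xb u u + l \<bullet> D2g xb u u)
              + rho Dg D2g xb u l v / ereal (fst (Dg xb w + (1/2) *\<^sub>R D2g xb v v))
            > ereal (1 / \<kappa>)) \<and>
         (rho Dg D2g xb u l v = 0 \<longrightarrow> D2f xb u u + l \<bullet> D2g xb u u > 1 / \<kappa>))"
  shows "tilt_stable (phi f (feas g)) xb \<kappa> \<and>
    tilt_bound (phi f (feas g)) xb \<le> 1 / min
      (Inf {ereal (D2f xb u u + l \<bullet> D2g xb u u) | u l.
             u \<in> crit_cone (feas g) xb (- grad Df xb) \<and> norm u = 1 \<and>
             l \<in> LamDir g Dg D2g xb (- grad Df xb) u})
      (min
      (Inf {ereal (D2f xb u u + l \<bullet> D2g xb u u) | u l.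
             \<exists>v w. (u, l, v, w) \<in> Zset g Dg D2g Df xb \<and> rho Dg D2g xb u l v = 0})
      (Inf {ereal (D2f xb u u + l \<bullet> D2g xb u u)
              + rho Dg D2g xb u l v / ereal (fst (Dg xb w + (1/2) *\<^sub>R D2g xb v v)) | u l v w.
             (u, l, v, w) \<in> Zset g Dg D2g Df xb \<and> Dg xb w + (1/2) *\<^sub>R D2g xb v v \<noteq> 0}))"
    (is "_ \<and> _ \<le> 1 / min (Inf ?A) (min (Inf ?B) (Inf ?C))")
proof -
  interpret soc_program f Df D2f g Dg D2g xb \<sigma>
    by unfold_locales (fact C2f C2g g_zero sigma_pos mscq)+
  define \<theta> where "\<theta> = min (Inf ?A) (min (Inf ?B) (Inf ?C))"
  have "ereal (1 / \<kappa>) \<le> Inf ?A" using cond_a by (intro Inf_greatest) (auto intro: less_imp_le)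
  moreover have "ereal (1 / \<kappa>) \<le> Inf ?B" using cond_b by (intro Inf_greatest) (auto intro: less_imp_le)
  moreover have "ereal (1 / \<kappa>) \<le> Inf ?C" using cond_b by (intro Inf_greatest) (auto intro: less_imp_le)
  ultimately have \<theta>\<kappa>: "ereal (1 / \<kappa>) \<le> \<theta>" by (simp add: \<theta>_def)
  \<comment> \<open>The conditions are strict, so they hold again with every modulus
    \<open>k\<close> for which \<open>1 / k\<close> is strictly below the three infima, and the
    whole argument can be repeated with \<open>k\<close>.\<close>
  have bound: "tilt_bound (phi f (feas g)) xb \<le> ereal k" if k: "k > 0" "ereal (1 / k) < \<theta>" for k
  proof (rule tilt_bound_le[OF tilt_stable_of_conditions[OF stationary K_null k(1)] k(1)])
    have lt: "ereal (1 / k) < a" if "a \<in> ?A \<or> a \<in> ?B \<or> a \<in> ?C" for a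
    proof -
      have "\<theta> \<le> a" using that unfolding \<theta>_def by (meson Inf_lower min.coboundedI1 min.coboundedI2)
      with k(2) show ?thesis by (rule less_le_trans)
    qed
    show "\<forall>u\<in>crit_cone (feas g) xb (- grad Df xb). norm u = 1 \<longrightarrow>
        (\<forall>l\<in>LamDir g Dg D2g xb (- grad Df xb) u. D2f xb u u + l \<bullet> D2g xb u u > 1 / k)"
    proof (intro ballI impI)
      fix u l assume "u \<in> crit_cone (feas g) xb (- grad Df xb)" "norm u = 1" "l \<in> LamDir g Dg D2g xb (- grad Df xb) u"
      then have "ereal (D2f xb u u + l \<bullet> D2g xb u u) \<in> ?A" by blast
      from lt[OF disjI1[OF this]] show "D2f xb u u + l \<bullet> D2g xb u u > 1 / k" by simp
    qed
    show "\<forall>u l v w. (u, l, v, w) \<in> Zset g Dg D2g Df xb \<longrightarrow>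
        ((Dg xb w + (1/2) *\<^sub>R D2g xb v v \<noteq> 0 \<longrightarrow>
            ereal (D2f xb u u + l \<bullet> D2g xb u u)
              + rho Dg D2g xb u l v / ereal (fst (Dg xb w + (1/2) *\<^sub>R D2g xb v v))
            > ereal (1 / k)) \<and>
         (rho Dg D2g xb u l v = 0 \<longrightarrow> D2f xb u u + l \<bullet> D2g xb u u > 1 / k))"
    proof (intro allI impI conjI)
      fix u l v w assume Z: "(u, l, v, w) \<in> Zset g Dg D2g Df xb"
      {
        assume "Dg xb w + (1/2) *\<^sub>R D2g xb v v \<noteq> 0"
        with Z have "ereal (D2f xb u u + l \<bullet> D2g xb u u)
              + rho Dg D2g xb u l v / ereal (fst (Dg xb w + (1/2) *\<^sub>R D2g xb v v)) \<in> ?C" by blast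
        then show "ereal (D2f xb u u + l \<bullet> D2g xb u u)
              + rho Dg D2g xb u l v / ereal (fst (Dg xb w + (1/2) *\<^sub>R D2g xb v v)) > ereal (1 / k)"
          by (rule lt[OF disjI2[OF disjI2]])
      }
      assume "rho Dg D2g xb u l v = 0"
      with Z have "ereal (D2f xb u u + l \<bullet> D2g xb u u) \<in> ?B" by blast
      from lt[OF disjI2[OF disjI1[OF this]]] show "D2f xb u u + l \<bullet> D2g xb u u > 1 / k" by simp
    qed
  qed
  have "tilt_bound (phi f (feas g)) xb \<le> 1 / \<theta>"
  proof (cases \<theta>)
    case (real r)
    have r: "r > 0" using \<theta>\<kappa> real kappa_pos by (simp add: less_le_trans[of 0 "1 / \<kappa>"])
    \<comment> \<open>The value \<open>1 / r\<close> itself is not admissible in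
      \<open>bound\<close>, so it is approached from above.\<close>
    have "tilt_bound (phi f (feas g)) xb \<le> ereal (1 / r) + ereal e" if "e > 0" for e
    proof -
      have "inverse (1 / r + e) < inverse (1 / r)" using r that by (intro less_imp_inverse_less) auto
      then have "1 / (1 / r + e) < r" by (simp add: inverse_eq_divide)
      then show ?thesis using bound[of "1 / r + e"] r that by (simp add: real add_pos_pos)
    qed
    then have "tilt_bound (phi f (feas g)) xb \<le> ereal (1 / r)" by (rule ereal_le_epsilon2)
    then show ?thesis using r by (simp add: real one_ereal_def)
  next
    case PInf
    \<comment> \<open>When all three infima are infinite, for instance over empty sets, every
      positive modulus is admissible, which agrees with \<open>1 / \<infinity> = 0\<close>.\<close>
    have "tilt_bound (phi f (feas g)) xb \<le> 0 + ereal e" if "e > 0" for e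
      using bound[OF that] by (simp add: PInf)
    then have "tilt_bound (phi f (feas g)) xb \<le> 0" by (rule ereal_le_epsilon2)
    then show ?thesis by (simp add: PInf)
  next
    case MInf
    with \<theta>\<kappa> show ?thesis by simp
  qed
  with tilt_stable_of_conditions[OF stationary K_null kappa_pos cond_a cond_b] show ?thesis
    unfolding \<theta>_def by blast
qed

end
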